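(* Let $\Omega\subset\mathbb R^n$ be open and bounded with smooth boundary, and for each $\tau\in\partial\Omega$ let $A_\tau\subset\mathbb R^m$ be a non-empty compact convex set varying continuously in $\tau$ with respect to the Hausdorff metric. Let $F=F_{sub}=\{A\in\operatorname{Sym}^2(\mathbb R^n):\operatorname{tr}(A)\ge0\}$, and for $x\in\Omega$ let $A_x$ be the $F_{sub}$-interpolation of $\{A_\tau\}$. Then for all $x\in\Omega$ $$A_x=\int_{\partial\Omega}A_\tau\,d\omega_x(\tau),$$ where $d\omega_x$ is the harmonic measure on $\partial\Omega$ with respect to $x$; that is, the $F_{sub}$-interpolation agrees with the harmonic interpolation. In particular, for the harmonic interpolation (with $\operatorname{vol}(A_x)>0$ for $x\in\Omega$), the function $x\mapsto-\log\operatorname{vol}(A_x)$ is subharmonic on $\Omega$.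
   Context: $F$-interpolation: for $k\in\mathbb N$ and $\tau\in\partial\Omega$ put $\phi_{\tau,k}(y)=e^{k\,\mathrm{dist}(y,A_\tau)}-1$ for $y\in\mathbb R^m$. Let $$\Phi_k=\sup\{\zeta\in USC(\overline\Omega\times\mathbb R^m):\zeta|_{\Omega\times\mathbb R^m}\text{ is }F\star\mathcal P\text{-subharmonic and }\zeta(\tau,y)\le\phi_{\tau,k}(y)\ \forall(\tau,y)\in\partial\Omega\times\mathbb R^m\},$$ $\Phi=\sup_k\Phi_k$ (values in $\mathbb R\cup\{+\infty\}$), and $A_x=\{y\in\mathbb R^m:\Phi(x,y)\le0\}$. Here $USC(Z)$ is the set of upper-semicontinuous functions $Z\to\mathbb R\cup\{-\infty\}$. $\mathcal P_m$ is the set of positive semidefinite matrices in $\operatorname{Sym}^2(\mathbb R^m)$ (real symmetric matrices). Write $A\in\operatorname{Sym}^2(\mathbb R^{n+m})$ in blocks as $A=\begin{pmatrix}B&C\\C^T&D\end{pmatrix}$ with $B\in\operatorname{Sym}^2(\mathbb R^n)$, $D\in\operatorname{Sym}^2(\mathbb R^m)$, and for a real $m\times n$ matrix $\Gamma$ put $i_\Gamma^*A=B+C\Gamma+\Gamma^TC^T+\Gamma^TD\Gamma$. Then $F\star\mathcal P$ is the set of all $A$ with $D\in\mathcal P_m$ and $i_\Gamma^*A\in F$ for all $\Gamma$. For $Y\subset\mathbb R^N$ open, $G\subset\operatorname{Sym}^2(\mathbb R^N)$ and $f\in USC(Y)$, $f$ is $G$-subharmonic if $\operatorname{Hess}_{x_0}(g)\in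 G$ whenever $x_0\in Y$ and $g$ is smooth on a neighbourhood of $x_0$ with $g\ge f$ there and $g(x_0)=f(x_0)$. $F_{sub}$-subharmonicity is ordinary subharmonicity (upper-semicontinuous functions with values in $\mathbb R\cup\{-\infty\}$). The harmonic measure $d\omega_x$ is the Borel probability measure on $\partial\Omega$ such that for every continuous $g:\partial\Omega\to\mathbb R$ the function $x\mapsto\int_{\partial\Omega}g\,d\omega_x$ is the harmonic function on $\Omega$ with boundary values $g$. The integral $\int_{\partial\Omega}A_\tau\,d\omega_x(\tau)$ is the limit of Riemann sums formed with Minkowski addition. Equivalently, it is the unique compact convex set with support function $u\mapsto\int_{\partial\Omega}h_{A_\tau}(u)\,d\omega_x(\tau)$, where $h_A(u)=\sup_{z\in A}z\cdot u$. *)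

theory Defs
  imports "HOL-Analysis.Analysis" "HOL-Probability.Probability_Measure"
begin

text \<open>The usual class \<open>C^k\<close> when the set is open: in finite dimension it suffices that the
  derivative in every fixed direction is of class \<open>C^(k - 1)\<close>.\<close>

primrec Ck_on :: "nat \<Rightarrow> 'a::euclidean_space set \<Rightarrow> ('a \<Rightarrow> real) \<Rightarrow> bool" where
  "Ck_on 0 S f \<longleftrightarrow> continuous_on S f"
| "Ck_on (Suc k) S f \<longleftrightarrow>
     (\<forall>x\<in>S. f differentiable (at x)) \<and> (\<forall>v. Ck_on k S (\<lambda>x. frechet_derivative f (at x) v))"

definition smooth_on :: "'a::euclidean_space set \<Rightarrow> ('a \<Rightarrow> real) \<Rightarrow> bool" where
  "smooth_on S f \<longleftrightarrow> (\<forall>k. Ck_on k S f)"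

definition Hess :: "(real^'N \<Rightarrow> real) \<Rightarrow> real^'N \<Rightarrow> real^'N^'N" where
  "Hess g x =
     (\<chi> i j. frechet_derivative (\<lambda>z. frechet_derivative g (at z) (axis j 1)) (at x) (axis i 1))"

definition harmonic_on :: "(real^'n) set \<Rightarrow> (real^'n \<Rightarrow> real) \<Rightarrow> bool" where
  "harmonic_on \<Omega> u \<longleftrightarrow> Ck_on 2 \<Omega> u \<and> (\<forall>x\<in>\<Omega>. trace (Hess u x) = 0)"

text \<open>The boundary is locally a regular level set, with the domain lying on one side of it.\<close>

definition smooth_boundary :: "(real^'n) set \<Rightarrow> bool" where
  "smooth_boundary \<Omega> \<longleftrightarrow>
     (\<forall>p\<in>frontier \<Omega>. \<exists>U \<rho>. open U \<and> p \<in> U \<and> smooth_on U \<rho> \<and>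
        (\<forall>z\<in>U. \<exists>v. frechet_derivative \<rho> (at z) v \<noteq> 0) \<and>
        \<Omega> \<inter> U = {z\<in>U. \<rho> z < 0})"


definition USC :: "'a::topological_space set \<Rightarrow> ('a \<Rightarrow> ereal) set" where
  "USC Z = {f. \<forall>z\<in>Z. f z \<noteq> \<infinity> \<and> (\<forall>c>f z. \<forall>\<^sub>F w in at z within Z. f w < c)}"

definition G_subharmonic ::
  "(real^'N^'N) set \<Rightarrow> (real^'N) set \<Rightarrow> (real^'N \<Rightarrow> ereal) \<Rightarrow> bool" where
  "G_subharmonic G Y f \<longleftrightarrow>
     f \<in> USC Y \<and>
     (\<forall>x\<in>Y. \<forall>U g. open U \<and> x \<in> U \<and> U \<subseteq> Y \<and> smooth_on U g \<and>
        (\<forall>z\<in>U. f z \<le> ereal (g z)) \<and> f x = ereal (g x) \<longrightarrow> Hess g x \<in> G)"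

definition Sym2 :: "(real^'N^'N) set" where
  "Sym2 = {A. transpose A = A}"

definition PSD :: "(real^'N^'N) set" where
  "PSD = {A\<in>Sym2. \<forall>v. 0 \<le> v \<bullet> (A *v v)}"

definition F_sub :: "(real^'n^'n) set" where
  "F_sub = {A\<in>Sym2. 0 \<le> trace A}"


text \<open>The space \<open>real^('n + 'm)\<close> stands for the product of \<open>real^'n\<close> and \<open>real^'m\<close>: the
  coordinates with index \<open>Inl i\<close> come from the first factor, those with index \<open>Inr j\<close> from the
  second. The blocks B, C, D of a matrix are taken accordingly.\<close>

definition vec_left :: "real^('n::finite + 'm::finite) \<Rightarrow> real^'n" where
  "vec_left z = (\<chi> i. z $ Inl i)"

definition vec_right :: "real^('n::finite + 'm::finite) \<Rightarrow> real^'m" where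
  "vec_right z = (\<chi> j. z $ Inr j)"

definition blockB :: "real^('n::finite + 'm::finite)^('n + 'm) \<Rightarrow> real^'n^'n" where
  "blockB A = (\<chi> i j. A $ Inl i $ Inl j)"

definition blockC :: "real^('n::finite + 'm::finite)^('n + 'm) \<Rightarrow> real^'m^'n" where
  "blockC A = (\<chi> i j. A $ Inl i $ Inr j)"

definition blockD :: "real^('n::finite + 'm::finite)^('n + 'm) \<Rightarrow> real^'m^'m" where
  "blockD A = (\<chi> i j. A $ Inr i $ Inr j)"

definition pullback :: "real^'n^'m \<Rightarrow> real^('n::finite + 'm::finite)^('n + 'm) \<Rightarrow> real^'n^'n" where
  "pullback \<Gamma> A =
     blockB A + blockC A ** \<Gamma> + transpose \<Gamma> ** transpose (blockC A)
       + transpose \<Gamma> ** blockD A ** \<Gamma>"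

definition star_P :: "(real^'n^'n) set \<Rightarrow> (real^('n::finite + 'm::finite)^('n + 'm)) set" where
  "star_P F = {A\<in>Sym2. blockD A \<in> PSD \<and> (\<forall>\<Gamma>. pullback \<Gamma> A \<in> F)}"


definition interp_competitors ::
  "(real^'n^'n) set \<Rightarrow> (real^'n) set \<Rightarrow> (real^'n \<Rightarrow> (real^'m) set) \<Rightarrow> nat
     \<Rightarrow> ((real^'n) \<times> (real^'m) \<Rightarrow> ereal) set" where
  "interp_competitors F \<Omega> A k =
     {\<zeta> \<in> USC (closure \<Omega> \<times> UNIV).
        G_subharmonic (star_P F) {z. vec_left z \<in> \<Omega>} (\<lambda>z. \<zeta> (vec_left z, vec_right z)) \<and>
        (\<forall>\<tau>\<in>frontier \<Omega>. \<forall>y. \<zeta> (\<tau>, y) \<le> ereal (exp (real k * infdist y (A \<tau>)) - 1))}"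

definition interp_fun ::
  "(real^'n^'n) set \<Rightarrow> (real^'n) set \<Rightarrow> (real^'n \<Rightarrow> (real^'m) set)
     \<Rightarrow> (real^'n) \<times> (real^'m) \<Rightarrow> ereal" where
  "interp_fun F \<Omega> A p = (SUP k. SUP \<zeta>\<in>interp_competitors F \<Omega> A k. \<zeta> p)"

definition F_interpolation ::
  "(real^'n^'n) set \<Rightarrow> (real^'n) set \<Rightarrow> (real^'n \<Rightarrow> (real^'m) set) \<Rightarrow> real^'n \<Rightarrow> (real^'m) set" where
  "F_interpolation F \<Omega> A x = {y. interp_fun F \<Omega> A (x, y) \<le> 0}"


text \<open>Only meaningful for non-empty bounded sets.\<close>

definition hausdorff_dist :: "'a::metric_space set \<Rightarrow> 'a set \<Rightarrow> real" where
  "hausdorff_dist S T = max (SUP x\<in>S. infdist x T) (SUP y\<in>T. infdist y S)"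

definition tagged_partition ::
  "'a::metric_space measure \<Rightarrow> real \<Rightarrow> 'a set set \<Rightarrow> ('a set \<Rightarrow> 'a) \<Rightarrow> bool" where
  "tagged_partition M \<delta> P t \<longleftrightarrow>
     finite P \<and> P \<subseteq> sets M \<and> disjoint P \<and> \<Union>P = space M \<and>
     (\<forall>E\<in>P. t E \<in> E \<and> diameter E < \<delta>)"

text \<open>The sum of sets is the Minkowski sum of \<open>HOL-Library.Set_Algebras\<close>.\<close>

definition riemann_sum ::
  "'a measure \<Rightarrow> ('a \<Rightarrow> 'b::euclidean_space set) \<Rightarrow> 'a set set \<Rightarrow> ('a set \<Rightarrow> 'a) \<Rightarrow> 'b set" where
  "riemann_sum M A P t = (\<Sum>E\<in>P. (\<lambda>y. measure M E *\<^sub>R y) ` A (t E))"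

definition has_minkowski_integral ::
  "'a::metric_space measure \<Rightarrow> ('a \<Rightarrow> 'b::euclidean_space set) \<Rightarrow> 'b set \<Rightarrow> bool" where
  "has_minkowski_integral M A K \<longleftrightarrow>
     compact K \<and> K \<noteq> {} \<and>
     (\<forall>\<epsilon>>0. \<exists>\<delta>>0. \<forall>P t. tagged_partition M \<delta> P t \<longrightarrow>
        hausdorff_dist (riemann_sum M A P t) K < \<epsilon>)"

definition minkowski_integral ::
  "'a::metric_space measure \<Rightarrow> ('a \<Rightarrow> 'b::euclidean_space set) \<Rightarrow> 'b set" where
  "minkowski_integral M A = (THE K. has_minkowski_integral M A K)"

text \<open>The measure at x lives on the subspace \<open>frontier \<Omega>\<close>. The condition on \<open>\<omega>\<close> couples all
  points x and determines \<open>\<omega>\<close> on \<open>\<Omega>\<close>.\<close>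

definition harmonic_measure ::
  "(real^'n) set \<Rightarrow> (real^'n \<Rightarrow> (real^'n) measure) \<Rightarrow> bool" where
  "harmonic_measure \<Omega> \<omega> \<longleftrightarrow>
     (\<forall>x\<in>\<Omega>. prob_space (\<omega> x) \<and> sets (\<omega> x) = sets (restrict_space borel (frontier \<Omega>))) \<and>
     (\<forall>g::real^'n \<Rightarrow> real. continuous_on (frontier \<Omega>) g \<longrightarrow>
        harmonic_on \<Omega> (\<lambda>x. \<integral>\<tau>. g \<tau> \<partial>\<omega> x) \<and>
        (\<forall>\<tau>\<in>frontier \<Omega>. ((\<lambda>x. \<integral>\<sigma>. g \<sigma> \<partial>\<omega> x) \<longlongrightarrow> g \<tau>) (at \<tau> within \<Omega>)))"

definition harmonic_interpolation ::
  "(real^'n \<Rightarrow> (real^'n) measure) \<Rightarrow> (real^'n \<Rightarrow> (real^'m) set) \<Rightarrow> real^'n \<Rightarrow> (real^'m) set" where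
  "harmonic_interpolation \<omega> A x = minkowski_integral (\<omega> x) A"

end

theory Submission
  imports Defs "HOL-Library.Landau_Symbols"
begin

text \<open>Let \<open>H x u\<close> be the harmonic function of \<open>x\<close> whose boundary values are the support functions of
  the given sets, and let \<open>K x\<close> be the convex body with support function \<open>H x\<close>. Riemann sums have
  support functions close to \<open>H x\<close>, so \<open>K x\<close> is the Minkowski integral.

  A point \<open>y\<close> outside \<open>K x\<close> is separated by a unit vector \<open>u\<close>, and \<open>(x, y) \<mapsto> y \<bullet> u - H x u\<close> is a
  competitor which is positive there. A point \<open>y\<close> of \<open>K x\<close> is the value at \<open>x\<close> of a harmonic map
  \<open>f\<close> whose boundary values lie almost in the given sets. For a competitor \<open>\<zeta>\<close>, maximise
  \<open>\<zeta> (x, y) + d |x|\<^sup>2 - K |y - f x|\<^sup>2\<close> with \<open>K\<close> large near the graph of \<open>f\<close>. An interior maximum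
  contradicts the trace condition for \<open>\<Gamma> = Df\<close>, hence \<open>\<zeta> (x, f x)\<close> is bounded by its boundary values.

  For the volume, replace \<open>H\<close> by finite sums \<open>\<Sum>t. c t x * h t u\<close> with harmonic coefficients. For
  these, averaging over \<open>x \<plusminus> s e\<^sub>i\<close> changes the body by \<open>o(s\<^sup>2)\<close>, and the logarithmic
  Brunn-Minkowski inequality (proved as in Hadwiger-Ohmann by cutting unions of boxes) gives the
  viscosity inequality, which survives the uniform limit.\<close>

text \<open>Harmonic functions come with two derivatives only, while subharmonicity is tested by
  smooth functions, so comparison functions built from harmonic data are not admissible tests. What
  is kept of them is a second-order expansion at the contact point: a slightly wider paraboloid
  replaces them, and the small error in its Hessian is absorbed by a strict inequality held in
  reserve.

  The harmonic map is made from one point per set over a finite net of the boundary, blended by a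
  partition of unity. Convexity leaves its values near the sets but not inside them. This suffices
  because for fixed \<open>k\<close> the exponential boundary bound tends to 0 with the distance.

  A volume comparison needs the expansion of \<open>H x u\<close> in \<open>x\<close> uniformly in
  \<open>u\<close>. With finitely many harmonic coefficients this uniformity is automatic, which is
  the reason for the finite sums. Passing back to \<open>H\<close> only preserves uniform closeness,
  not derivatives, so the conclusion has to be drawn from a touching point.

  Volumes are controlled through support functions: inside a body containing a ball of radius
  \<open>r\<close>, an additive error \<open>s * norm u\<close> costs at most a dilation by
  \<open>1 + s / r\<close>.\<close>

abbreviation vol :: "'a::euclidean_space set \<Rightarrow> real" where
  "vol \<equiv> measure lebesgue"

section \<open>Second-order expansions\<close>

text \<open>The matrix need not be symmetric, which keeps the closure rules short;
  \<open>quad_form_Sym2\<close> symmetrises it when a Hessian is wanted.\<close>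

definition quad_form :: "(real^'N \<Rightarrow> real) \<Rightarrow> bool" where
  "quad_form Q \<longleftrightarrow> (\<exists>X. \<forall>h. Q h = h \<bullet> (X *v h))"

lemma quad_formI: "(\<And>h. Q h = h \<bullet> (X *v h)) \<Longrightarrow> quad_form Q"
  by (auto simp: quad_form_def)

lemma inner_transpose: "h \<bullet> (transpose X *v k) = k \<bullet> (X *v h)" for X :: "real^'N^'N"
  by (metis dot_lmul_matrix inner_commute transpose_matrix_vector)

lemma quad_form_Sym2:
  assumes "quad_form Q"
  obtains X where "X \<in> Sym2" "\<And>h. Q h = h \<bullet> (X *v h)"
proof -
  from assms obtain X where X: "\<And>h. Q h = h \<bullet> (X *v h)" by (auto simp: quad_form_def)
  show ?thesis
  proof (rule that[of "(1/2) *\<^sub>R (X + transpose X)"])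
    show "(1/2) *\<^sub>R (X + transpose X) \<in> Sym2"
      by (simp add: Sym2_def transpose_def vec_eq_iff)
    fix h
    show "Q h = h \<bullet> ((1/2) *\<^sub>R (X + transpose X) *v h)"
      by (simp add: X scaleR_matrix_vector_assoc[symmetric] matrix_vector_mult_add_rdistrib
          inner_add_right inner_transpose del: transpose_matrix_vector)
  qed
qed

lemma quad_form_add: "quad_form P \<Longrightarrow> quad_form Q \<Longrightarrow> quad_form (\<lambda>h. P h + Q h)"
  unfolding quad_form_def by (metis inner_add_right matrix_vector_mult_add_rdistrib)

lemma quad_form_cmult: "quad_form Q \<Longrightarrow> quad_form (\<lambda>h. c * Q h)"
  unfolding quad_form_def by (metis inner_scaleR_right scaleR_matrix_vector_assoc)

lemma quad_form_comp:
  fixes T :: "real^'M \<Rightarrow> real^'N"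
  assumes "quad_form Q" "linear T"
  shows "quad_form (\<lambda>h. Q (T h))"
proof -
  from assms obtain X where X: "\<And>h. Q h = h \<bullet> (X *v h)" by (auto simp: quad_form_def)
  show ?thesis
  proof (rule quad_formI)
    fix h
    have "T h = matrix T *v h" using assms(2) by (simp add: matrix_works)
    then show "Q (T h) = h \<bullet> ((transpose (matrix T) ** X ** matrix T) *v h)"
      by (simp add: X matrix_vector_mul_assoc[symmetric] )
        (metis dot_lmul_matrix inner_commute vector_transpose_matrix)
  qed
qed

lemma quad_form_norm: "quad_form (\<lambda>h. (norm h)\<^sup>2)"
  by (rule quad_formI[of _ "mat 1"]) (simp add: power2_norm_eq_inner)

lemma quad_form_linear_square:
  fixes L :: "real^'N \<Rightarrow> real"
  assumes "linear L" shows "quad_form (\<lambda>h. (L h)\<^sup>2)"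
proof -
  have p: "L h = adjoint L 1 \<bullet> h" for h
    using adjoint_works[OF assms, of h 1] by (simp add: inner_commute)
  define p where "p = adjoint L 1"
  note p = p[folded p_def]
  show ?thesis
  proof (rule quad_formI[of _ "\<chi> i j. p$i * p$j"])
    fix h
    have "h \<bullet> ((\<chi> i j. p$i * p$j) *v h) = (\<Sum>i\<in>UNIV. h$i * (\<Sum>j\<in>UNIV. p$i*p$j*h$j))"
      by (simp add: inner_vec_def matrix_vector_mult_def)
    also have "\<dots> = (\<Sum>i\<in>UNIV. p$i*h$i) * (\<Sum>j\<in>UNIV. p$j*h$j)"
      by (simp add: sum_distrib_left sum_distrib_right mult_ac)
    also have "\<dots> = (L h)\<^sup>2" by (simp add: p inner_vec_def power2_eq_square)
    finally show "(L h)\<^sup>2 = h \<bullet> ((\<chi> i j. p$i * p$j) *v h)" by simp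
  qed
qed

lemma quad_form_bound:
  assumes "quad_form Q" obtains C where "C \<ge> 0" "\<And>h. \<bar>Q h\<bar> \<le> C * (norm h)\<^sup>2"
proof -
  from assms obtain X where X: "\<And>h. Q h = h \<bullet> (X *v h)" by (auto simp: quad_form_def)
  obtain K where K: "K > 0" "\<And>h. norm (X *v h) \<le> norm h * K"
    using bounded_linear.pos_bounded[OF matrix_vector_mul_bounded_linear] by blast
  have "\<bar>Q h\<bar> \<le> K * (norm h)\<^sup>2" for h
  proof -
    have "\<bar>Q h\<bar> \<le> norm h * norm (X *v h)" by (simp add: X Cauchy_Schwarz_ineq2)
    also have "\<dots> \<le> norm h * (norm h * K)" by (intro mult_left_mono K) auto
    finally show ?thesis by (simp add: power2_eq_square mult_ac)
  qed
  with that[of K] K show ?thesis by auto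
qed

lemma quad_form_scaleR: "quad_form Q \<Longrightarrow> Q (t *\<^sub>R h) = t\<^sup>2 * Q h"
  by (auto simp: quad_form_def matrix_vector_mult_scaleR power2_eq_square)

text \<open>\<open>Q\<close> is the full second derivative, hence the factor 1/2. A pointwise
  expansion is stable under sums, squares and linear substitutions without computing partial
  derivatives, and later uses only evaluate \<open>Q\<close> in chosen directions.\<close>

definition jet2 :: "(real^'N \<Rightarrow> real) \<Rightarrow> real^'N \<Rightarrow> (real^'N \<Rightarrow> real) \<Rightarrow> (real^'N \<Rightarrow> real) \<Rightarrow> bool" where
  "jet2 f x L Q \<longleftrightarrow> linear L \<and> quad_form Q \<and>
     (\<lambda>h. f (x + h) - f x - L h - Q h / 2) \<in> o[at 0](\<lambda>h. (norm h)\<^sup>2)"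

lemma jet2I:
  assumes "linear L" "quad_form Q"
    and "\<And>e. e > 0 \<Longrightarrow> \<exists>d>0. \<forall>h. norm h < d \<longrightarrow> \<bar>f (x + h) - f x - L h - Q h / 2\<bar> \<le> e * (norm h)\<^sup>2"
  shows "jet2 f x L Q"
  unfolding jet2_def
proof (intro conjI assms(1,2) landau_o.smallI)
  fix c :: real assume "c > 0"
  from assms(3)[OF this] obtain d where "d > 0" "\<And>h. norm h < d \<Longrightarrow> \<bar>f (x + h) - f x - L h - Q h / 2\<bar> \<le> c * (norm h)\<^sup>2"
    by auto
  then show "\<forall>\<^sub>F h in at 0. norm (f (x + h) - f x - L h - Q h / 2) \<le> c * norm ((norm h)\<^sup>2)"
    unfolding eventually_at by (intro exI[of _ d]) auto
qed

lemma jet2D: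
  assumes "jet2 f x L Q" "e > 0"
  obtains d where "d > 0" "\<And>h. norm h < d \<Longrightarrow> \<bar>f (x + h) - f x - L h - Q h / 2\<bar> \<le> e * (norm h)\<^sup>2"
proof -
  from assms have lq: "linear L" "quad_form Q" by (auto simp: jet2_def)
  from assms have "\<forall>\<^sub>F h in at 0. norm (f (x + h) - f x - L h - Q h / 2) \<le> e * norm ((norm h)\<^sup>2)"
    unfolding jet2_def by (auto dest: landau_o.smallD)
  then obtain d where d: "d > 0" "\<And>h. h \<noteq> 0 \<Longrightarrow> dist h 0 < d \<Longrightarrow> norm (f (x + h) - f x - L h - Q h / 2) \<le> e * norm ((norm h)\<^sup>2)"
    unfolding eventually_at by auto
  have "\<bar>f (x + h) - f x - L h - Q h / 2\<bar> \<le> e * (norm h)\<^sup>2" if "norm h < d" for h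
  proof (cases "h = 0")
    case True
    then show ?thesis using linear_0[OF lq(1)] quad_form_scaleR[OF lq(2), of 0] by simp
  qed (use d(2)[of h] that in auto)
  with d(1) that show ?thesis by blast
qed

lemma jet2_add:
  assumes "jet2 f x L Q" "jet2 g x M P"
  shows "jet2 (\<lambda>z. f z + g z) x (\<lambda>h. L h + M h) (\<lambda>h. Q h + P h)"
proof -
  have "(\<lambda>h. (f (x + h) - f x - L h - Q h / 2) + (g (x + h) - g x - M h - P h / 2)) \<in> o[at 0](\<lambda>h. (norm h)\<^sup>2)"
    by (rule sum_in_smallo) (use assms in \<open>auto simp: jet2_def\<close>)
  also have "(\<lambda>h. (f (x + h) - f x - L h - Q h / 2) + (g (x + h) - g x - M h - P h / 2)) =
    (\<lambda>h. f (x + h) + g (x + h) - (f x + g x) - (L h + M h) - (Q h + P h) / 2)"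
    by (auto simp: field_simps)
  finally show ?thesis using assms unfolding jet2_def
    by (auto intro: linear_compose_add quad_form_add)
qed

lemma jet2_cmult:
  assumes "jet2 f x L Q"
  shows "jet2 (\<lambda>z. c * f z) x (\<lambda>h. c * L h) (\<lambda>h. c * Q h)"
proof -
  have "(\<lambda>h. c * (f (x + h) - f x - L h - Q h / 2)) \<in> o[at 0](\<lambda>h. (norm h)\<^sup>2)"
    using assms unfolding jet2_def by (cases "c = 0") auto
  also have "(\<lambda>h. c * (f (x + h) - f x - L h - Q h / 2)) = (\<lambda>h. c * f (x + h) - c * f x - c * L h - (c * Q h) / 2)"
    by (auto simp: field_simps)
  finally show ?thesis using assms linear_compose_scale_right[of L c] unfolding jet2_def
    by (auto intro: quad_form_cmult)
qed

lemma quad_form_zero: "quad_form (\<lambda>h. 0)"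
  by (rule quad_formI[of _ 0]) (simp add: inner_vec_def matrix_vector_mult_def)

lemma jet2_const: "jet2 (\<lambda>z. c) x (\<lambda>h. 0) (\<lambda>h. 0)"
  unfolding jet2_def by (auto simp: quad_form_zero linear_zero)

lemma jet2_linear: "linear T \<Longrightarrow> jet2 T x T (\<lambda>h. 0)"
  unfolding jet2_def by (auto simp: quad_form_zero linear_add)

lemma jet2_sum:
  assumes "finite I" "\<And>i. i \<in> I \<Longrightarrow> jet2 (f i) x (L i) (Q i)"
  shows "jet2 (\<lambda>z. \<Sum>i\<in>I. f i z) x (\<lambda>h. \<Sum>i\<in>I. L i h) (\<lambda>h. \<Sum>i\<in>I. Q i h)"
  using assms by (induction I rule: finite_induct) (auto intro: jet2_const jet2_add)

lemma jet2_comp: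
  fixes T :: "real^'M \<Rightarrow> real^'N"
  assumes j: "jet2 f (T x) L Q" and T: "linear T"
  shows "jet2 (\<lambda>z. f (T z)) x (\<lambda>h. L (T h)) (\<lambda>h. Q (T h))"
proof (rule jet2I)
  from j have LQ: "linear L" "quad_form Q" by (auto simp: jet2_def)
  show "linear (\<lambda>h. L (T h))" using linear_compose[OF T LQ(1)] by (simp add: o_def)
  show "quad_form (\<lambda>h. Q (T h))" by (rule quad_form_comp[OF LQ(2) T])
  obtain K where K: "K > 0" "\<And>h. norm (T h) \<le> K * norm h"
    using linear_bounded_pos[OF T] by blast
  fix e :: real assume "e > 0"
  then have "e / K\<^sup>2 > 0" using K by simp
  from jet2D[OF j this] obtain d where d: "d > 0"
    "\<And>h. norm h < d \<Longrightarrow> \<bar>f (T x + h) - f (T x) - L h - Q h / 2\<bar> \<le> e / K\<^sup>2 * (norm h)\<^sup>2" by blast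
  show "\<exists>d>0. \<forall>h. norm h < d \<longrightarrow> \<bar>f (T (x + h)) - f (T x) - L (T h) - Q (T h) / 2\<bar> \<le> e * (norm h)\<^sup>2"
  proof (intro exI[of _ "d / K"] conjI allI impI)
    show "d / K > 0" using d K by simp
    fix h :: "real^'M" assume "norm h < d / K"
    then have "norm (T h) < d" using K(2)[of h] K(1) by (simp add: field_simps)
    from d(2)[OF this] have "\<bar>f (T (x + h)) - f (T x) - L (T h) - Q (T h) / 2\<bar> \<le> e / K\<^sup>2 * (norm (T h))\<^sup>2"
      by (simp add: linear_add[OF T])
    also have "\<dots> \<le> e / K\<^sup>2 * (K * norm h)\<^sup>2"
      using \<open>e > 0\<close> K by (intro mult_left_mono power_mono) auto
    also have "\<dots> = e * (norm h)\<^sup>2" using K by (simp add: power_mult_distrib)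
    finally show "\<bar>f (T (x + h)) - f (T x) - L (T h) - Q (T h) / 2\<bar> \<le> e * (norm h)\<^sup>2" .
  qed
qed

lemma jet2_square:
  assumes j: "jet2 f x L Q"
  shows "jet2 (\<lambda>z. (f z)\<^sup>2) x (\<lambda>h. 2 * f x * L h) (\<lambda>h. 2 * f x * Q h + 2 * (L h)\<^sup>2)"
proof -
  from j have LQ: "linear L" "quad_form Q" by (auto simp: jet2_def)
  let ?N = "\<lambda>h::real^'a. norm h"
  let ?F = "at (0 :: real^'a)"
  define r where "r h = f (x + h) - f x - L h - Q h / 2" for h
  have r: "r \<in> o[?F](\<lambda>h. (?N h)\<^sup>2)" using j unfolding jet2_def r_def by auto
  obtain K where K: "\<And>h. norm (L h) \<le> K * norm h"
    using linear_bounded_pos[OF LQ(1)] by blast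
  have L: "L \<in> O[?F](?N)" by (rule bigoI[of _ K]) (use K in auto)
  obtain C where C: "\<And>h. \<bar>Q h\<bar> \<le> C * (norm h)\<^sup>2" using quad_form_bound[OF LQ(2)] by blast
  have Q: "(\<lambda>h. Q h / 2) \<in> O[?F](\<lambda>h. (?N h)\<^sup>2)"
    by (rule bigoI[of _ "C/2"]) (use C in \<open>auto simp: field_simps\<close>)
  have N1: "?N \<in> o[?F](\<lambda>h. 1 :: real)"
    by (rule smalloI_tendsto) (auto intro!: tendsto_eq_intros)
  have NN: "(\<lambda>h. (?N h)\<^sup>2) \<in> o[?F](?N)"
    using landau_o.small.mult_right[OF N1, of ?N] by (simp add: power2_eq_square)
  \<comment> \<open>\<open>b\<close> gathers everything of order two. When
    \<open>f x + L h + b h\<close> is squared, \<open>L h * b h\<close> and \<open>b h * b h\<close>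
    are negligible, so the square of \<open>L h\<close> is the only new quadratic term.\<close>
  define b where "b h = Q h / 2 + r h" for h
  have b: "b \<in> O[?F](\<lambda>h. (?N h)\<^sup>2)" unfolding b_def
    by (intro sum_in_bigo Q landau_o.small_imp_big[OF r])
  have b': "b \<in> o[?F](?N)" by (rule landau_o.big_small_trans[OF b NN])
  have Lb: "(\<lambda>h. L h * b h) \<in> o[?F](\<lambda>h. ?N h * ?N h)"
    by (rule landau_o.big_small_mult[OF L b'])
  have bb: "(\<lambda>h. b h * b h) \<in> o[?F](\<lambda>h. ?N h * ?N h)"
    by (rule landau_o.small_mult[OF b' b'])
  have "(\<lambda>h. 2 * f x * r h + (2 * (L h * b h) + b h * b h)) \<in> o[?F](\<lambda>h. (?N h)\<^sup>2)"
    unfolding power2_eq_square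
    using Lb bb r by (cases "f x = 0") (auto simp: power2_eq_square intro!: sum_in_smallo)
  also have "(\<lambda>h. 2 * f x * r h + (2 * (L h * b h) + b h * b h)) =
     (\<lambda>h. (f (x + h))\<^sup>2 - (f x)\<^sup>2 - 2 * f x * L h - (2 * f x * Q h + 2 * (L h)\<^sup>2) / 2)"
  proof
    fix h
    have 1: "f (x + h) = f x + L h + b h" by (simp add: b_def r_def)
    have 2: "r h = b h - Q h / 2" by (simp add: b_def)
    show "2 * f x * r h + (2 * (L h * b h) + b h * b h) =
     (f (x + h))\<^sup>2 - (f x)\<^sup>2 - 2 * f x * L h - (2 * f x * Q h + 2 * (L h)\<^sup>2) / 2"
      unfolding 1 2 by (simp add: power2_eq_square field_simps)
  qed
  finally show ?thesis
    unfolding jet2_def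
    by (intro conjI quad_form_add quad_form_cmult[of Q "2 * f x"]
        quad_form_cmult[OF quad_form_linear_square] LQ)
      (use linear_compose_scale_right[OF LQ(1), of "2 * f x"] in auto)
qed

lemma jet2_norm_square: "jet2 (\<lambda>z. (norm (z - a))\<^sup>2) x (\<lambda>h. 2 * ((x - a) \<bullet> h)) (\<lambda>h. 2 * (norm h)\<^sup>2)"
proof -
  have "(\<lambda>h. (norm (x + h - a))\<^sup>2 - (norm (x - a))\<^sup>2 - 2 * ((x - a) \<bullet> h) - (2 * (norm h)\<^sup>2) / 2) = (\<lambda>h. 0)"
    by (auto simp: power2_norm_eq_inner inner_simps inner_commute)
  then show ?thesis
    unfolding jet2_def using quad_form_cmult[OF quad_form_norm, of 2]
    by (auto intro!: linearI simp: inner_simps algebra_simps)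
qed

text \<open>First-order terms cancel in the symmetric difference, so \<open>Q\<close> is recovered
  from values of \<open>f\<close> alone. Local minima and the Brunn-Minkowski inequality, which only
  compare values, reach second derivatives this way.\<close>

lemma jet2_second_difference:
  assumes j: "jet2 f x L Q"
  shows "((\<lambda>t. (f (x + t *\<^sub>R v) + f (x - t *\<^sub>R v) - 2 * f x) / t\<^sup>2) \<longlongrightarrow> Q v) (at 0)"
proof (rule LIM_I)
  from j have LQ: "linear L" "quad_form Q" by (auto simp: jet2_def)
  fix r :: real assume "r > 0"
  \<comment> \<open>The 2 counts the remainders at \<open>x + t *\<^sub>R v\<close> and
    \<open>x - t *\<^sub>R v\<close>; the \<open>+ 1\<close> covers \<open>v = 0\<close>.\<close>
  define e where "e = r / (2 * (norm v)\<^sup>2 + 1)"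
  have e0: "2 * (norm v)\<^sup>2 + 1 > 0" by (auto intro: add_nonneg_pos)
  have "e > 0" unfolding e_def using \<open>r > 0\<close> e0 by auto
  have er: "2 * e * (norm v)\<^sup>2 < r"
    using e0 \<open>r > 0\<close> by (simp add: e_def field_simps)
  from jet2D[OF j \<open>e > 0\<close>] obtain d where d: "d > 0"
     "\<And>h. norm h < d \<Longrightarrow> \<bar>f (x + h) - f x - L h - Q h / 2\<bar> \<le> e * (norm h)\<^sup>2" by blast
  show "\<exists>s>0. \<forall>t. t \<noteq> 0 \<and> norm (t - 0) < s \<longrightarrow>
     norm ((f (x + t *\<^sub>R v) + f (x - t *\<^sub>R v) - 2 * f x) / t\<^sup>2 - Q v) < r"
  proof (intro exI[of _ "d / (norm v + 1)"] conjI allI impI)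
    show "d / (norm v + 1) > 0" using d by (simp add: add_nonneg_pos)
    fix t :: real assume t: "t \<noteq> 0 \<and> norm (t - 0) < d / (norm v + 1)"
    have "norm v + 1 > 0" by (simp add: add_nonneg_pos)
    with t have "\<bar>t\<bar> * norm v + \<bar>t\<bar> < d" by (simp add: field_simps)
    then have n: "norm (t *\<^sub>R v) < d" by (smt (verit) norm_scaleR abs_ge_zero)
    have n': "norm (- (t *\<^sub>R v)) < d" using n by simp
    have q: "Q (t *\<^sub>R v) = t\<^sup>2 * Q v" "Q (- (t *\<^sub>R v)) = t\<^sup>2 * Q v" "L (- (t *\<^sub>R v)) = - L (t *\<^sub>R v)"
      using quad_form_scaleR[OF LQ(2), of t v] quad_form_scaleR[OF LQ(2), of "-t" v] linear_neg[OF LQ(1)] by auto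
    have "\<bar>f (x + t *\<^sub>R v) + f (x - t *\<^sub>R v) - 2 * f x - t\<^sup>2 * Q v\<bar> \<le> 2 * e * (norm (t *\<^sub>R v))\<^sup>2"
      using d(2)[OF n] d(2)[OF n'] unfolding q by simp
    also have "\<dots> = t\<^sup>2 * (2 * e * (norm v)\<^sup>2)" by (simp add: power_mult_distrib)
    also have "\<dots> < t\<^sup>2 * r" using er t by simp
    finally have A: "\<bar>f (x + t *\<^sub>R v) + f (x - t *\<^sub>R v) - 2 * f x - t\<^sup>2 * Q v\<bar> < t\<^sup>2 * r" .
    have "(f (x + t *\<^sub>R v) + f (x - t *\<^sub>R v) - 2 * f x) / t\<^sup>2 - Q v =
       (f (x + t *\<^sub>R v) + f (x - t *\<^sub>R v) - 2 * f x - t\<^sup>2 * Q v) / t\<^sup>2"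
      using t by (simp add: field_simps)
    with A t show "norm ((f (x + t *\<^sub>R v) + f (x - t *\<^sub>R v) - 2 * f x) / t\<^sup>2 - Q v) < r"
      by (simp add: field_simps)
  qed
qed

lemma tendsto_add_scaleR_at_0: "((\<lambda>t. x + t *\<^sub>R v) \<longlongrightarrow> x) (at (0::real))"
  "((\<lambda>t. x - t *\<^sub>R v) \<longlongrightarrow> x) (at (0::real))" for x v :: "'a::real_normed_vector"
  by (auto intro!: tendsto_eq_intros)

lemma jet2_local_min:
  assumes j: "jet2 f x L Q" and m: "\<forall>\<^sub>F z in nhds x. f x \<le> f z"
  shows "Q v \<ge> 0"
proof (rule tendsto_lowerbound[OF jet2_second_difference[OF j]])
  have "\<forall>\<^sub>F t in at 0. f x \<le> f (x + t *\<^sub>R v)" "\<forall>\<^sub>F t in at 0. f x \<le> f (x - t *\<^sub>R v)"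
    using filterlim_iff[THEN iffD1, OF tendsto_add_scaleR_at_0(1), rule_format, OF m]
      filterlim_iff[THEN iffD1, OF tendsto_add_scaleR_at_0(2), rule_format, OF m] by auto
  then show "\<forall>\<^sub>F t in at 0. 0 \<le> (f (x + t *\<^sub>R v) + f (x - t *\<^sub>R v) - 2 * f x) / t\<^sup>2"
    by eventually_elim auto
qed auto

section \<open>Second-order calculus and smooth test functions\<close>

lemma Ck_on_Suc_imp: "Ck_on (Suc k) S f \<Longrightarrow> open S \<Longrightarrow> Ck_on k S f"
proof (induction k arbitrary: f)
  case 0
  then show ?case
    by (auto intro!: continuous_at_imp_continuous_on differentiable_imp_continuous_within)
next
  case (Suc k)
  from Suc.prems(1) have f: "\<forall>x\<in>S. f differentiable (at x)"
    and v: "Ck_on (Suc k) S (\<lambda>x. frechet_derivative f (at x) v)" for v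
    unfolding Ck_on.simps(2)[of "Suc k"] by blast+
  show ?case unfolding Ck_on.simps(2)[of k] using f Suc.IH[OF v Suc.prems(2)] by blast
qed

lemma linear_eq_inner_vec:
  fixes L :: "real^'N \<Rightarrow> real" assumes "linear L"
  shows "L h = (\<Sum>i\<in>UNIV. h $ i * L (axis i 1))"
proof -
  have "L h = L (\<Sum>i\<in>UNIV. h $ i *\<^sub>R axis i 1)"
    using basis_expansion[of h] by (simp add: scalar_mult_eq_scaleR)
  also have "\<dots> = (\<Sum>i\<in>UNIV. h $ i * L (axis i 1))"
    using assms by (simp add: linear_sum linear_scale)
  finally show ?thesis .
qed

text \<open>Differentiation is along \<open>v\<close> first and along \<open>w\<close> second; the
  order is immaterial only after \<open>D2_commute\<close>.\<close>

definition D2 :: "(real^'N \<Rightarrow> real) \<Rightarrow> real^'N \<Rightarrow> real^'N \<Rightarrow> real^'N \<Rightarrow> real" where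
  "D2 f x v w = frechet_derivative (\<lambda>z. frechet_derivative f (at z) v) (at x) w"

section \<open>Taylor expansion and symmetry of second derivatives\<close>

context
  fixes U :: "(real^'N) set" and f :: "real^'N \<Rightarrow> real"
  assumes U: "open U" and C2: "Ck_on 2 U f"
begin

lemma C2_facts:
  shows C2_diff: "x \<in> U \<Longrightarrow> (f has_derivative frechet_derivative f (at x)) (at x)"
    and C2_diff2: "x \<in> U \<Longrightarrow> ((\<lambda>z. frechet_derivative f (at z) v) has_derivative D2 f x v) (at x)"
    and C2_cont: "continuous_on U (\<lambda>x. D2 f x v w)"
proof -
  have C: "Ck_on (Suc (Suc 0)) U f" using C2 by (simp add: numeral_2_eq_2)
  show "x \<in> U \<Longrightarrow> (f has_derivative frechet_derivative f (at x)) (at x)"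
    using C by (auto simp del: frechet_derivative_works intro!: frechet_derivative_works[THEN iffD1])
  show "x \<in> U \<Longrightarrow> ((\<lambda>z. frechet_derivative f (at z) v) has_derivative D2 f x v) (at x)"
    unfolding D2_def using C by (auto simp del: frechet_derivative_works intro!: frechet_derivative_works[THEN iffD1])
  show "continuous_on U (\<lambda>x. D2 f x v w)"
    unfolding D2_def using C by auto
qed

text \<open>In \<open>w\<close> this is linearity of a derivative. In \<open>v\<close> it results
  from differentiating the linearity of \<open>frechet_derivative f (at z)\<close>, an identity
  valid for all \<open>z\<close> in the open set \<open>U\<close>.\<close>

lemma C2_linear:
  assumes "x \<in> U"
  shows "linear (frechet_derivative f (at x))" "linear (D2 f x v)" "linear (\<lambda>v. D2 f x v w)"
proof -
  have 1: "linear (frechet_derivative f (at x))" if "x \<in> U" for x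
    using C2_diff[OF that] has_derivative_linear by blast
  then show "linear (frechet_derivative f (at x))" using assms .
  show "linear (D2 f x v)" for v using C2_diff2[OF assms] has_derivative_linear by blast
  show "linear (\<lambda>v. D2 f x v w)"
  proof (rule linearI)
    fix a b
    have "((\<lambda>z. frechet_derivative f (at z) a + frechet_derivative f (at z) b) has_derivative (\<lambda>h. D2 f x a h + D2 f x b h)) (at x)"
      by (intro has_derivative_add C2_diff2 assms)
    then have "((\<lambda>z. frechet_derivative f (at z) (a + b)) has_derivative (\<lambda>h. D2 f x a h + D2 f x b h)) (at x)"
      by (rule has_derivative_transform_within_open[OF _ U assms]) (use 1 linear_add in metis)
    from has_derivative_unique[OF this C2_diff2[OF assms]]
    show "D2 f x (a + b) w = D2 f x a w + D2 f x b w" by metis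
  next
    fix c :: real and a
    have "((\<lambda>z. c * frechet_derivative f (at z) a) has_derivative (\<lambda>h. c * D2 f x a h)) (at x)"
      by (intro has_derivative_mult_right C2_diff2 assms)
    then have "((\<lambda>z. frechet_derivative f (at z) (c *\<^sub>R a)) has_derivative (\<lambda>h. c * D2 f x a h)) (at x)"
      by (rule has_derivative_transform_within_open[OF _ U assms]) (use 1 linear_scale in \<open>metis real_scaleR_def\<close>)
    from has_derivative_unique[OF this C2_diff2[OF assms]]
    show "D2 f x (c *\<^sub>R a) w = c *\<^sub>R D2 f x a w" by (metis real_scaleR_def)
  qed
qed

lemma D2_eq_Hess:
  assumes "x \<in> U"
  shows "D2 f x v w = w \<bullet> (Hess f x *v v)"
proof -
  have "D2 f x v w = (\<Sum>i\<in>UNIV. w $ i * D2 f x v (axis i 1))"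
    by (rule linear_eq_inner_vec[OF C2_linear(2)[OF assms]])
  also have "\<dots> = (\<Sum>i\<in>UNIV. w $ i * (\<Sum>j\<in>UNIV. v $ j * D2 f x (axis j 1) (axis i 1)))"
    using linear_eq_inner_vec[OF C2_linear(3)[OF assms], of v] by simp
  also have "\<dots> = w \<bullet> (Hess f x *v v)"
    by (simp add: inner_vec_def matrix_vector_mult_def Hess_def D2_def mult.commute)
  finally show ?thesis .
qed

lemma C2_line:
  assumes "x + t *\<^sub>R h \<in> U"
  shows "((\<lambda>t. f (x + t *\<^sub>R h)) has_real_derivative frechet_derivative f (at (x + t *\<^sub>R h)) h) (at t)"
    and "((\<lambda>t. frechet_derivative f (at (x + t *\<^sub>R h)) v) has_real_derivative D2 f (x + t *\<^sub>R h) v h) (at t)"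
proof -
  have l: "((\<lambda>t. x + t *\<^sub>R h) has_derivative (\<lambda>s. s *\<^sub>R h)) (at t)"
    by (auto intro!: derivative_eq_intros)
  have *: "(\<lambda>s. L (s *\<^sub>R h)) = (\<lambda>s. s * L h)" if "linear L" for L :: "real^'N \<Rightarrow> real"
    using linear_scale[OF that] by auto
  show "((\<lambda>t. f (x + t *\<^sub>R h)) has_real_derivative frechet_derivative f (at (x + t *\<^sub>R h)) h) (at t)"
    using has_derivative_compose[OF l C2_diff[OF assms]] *[OF C2_linear(1)[OF assms]]
    by (simp add: has_field_derivative_def mult_commute_abs)
  show "((\<lambda>t. frechet_derivative f (at (x + t *\<^sub>R h)) v) has_real_derivative D2 f (x + t *\<^sub>R h) v h) (at t)"
    using has_derivative_compose[OF l C2_diff2[OF assms]] *[OF C2_linear(2)[OF assms]]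
    by (simp add: has_field_derivative_def mult_commute_abs)
qed

lemma C2_Hess_uniform:
  assumes x: "x \<in> U" and e: "e > 0"
  obtains d where "d > 0" "ball x d \<subseteq> U"
    "\<And>y v w. y \<in> ball x d \<Longrightarrow> \<bar>D2 f y v w - D2 f x v w\<bar> \<le> e * norm v * norm w"
proof -
  \<comment> \<open>The number of matrix entries: an error \<open>e / N\<close> in each entry adds
    up to \<open>e\<close> in the bilinear form.\<close>
  define N where "N = real CARD('N) * real CARD('N)"
  have N: "N > 0" by (simp add: N_def)
  have "\<forall>\<^sub>F y in nhds x. \<forall>i j. \<bar>D2 f y (axis i 1) (axis j 1) - D2 f x (axis i 1) (axis j 1)\<bar> < e / N"
  proof (intro eventually_all_finite)
    fix i j :: 'N
    have "isCont (\<lambda>y. D2 f y (axis i 1) (axis j 1)) x"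
      using C2_cont U x continuous_on_eq_continuous_at by blast
    then have "((\<lambda>y. D2 f y (axis i 1) (axis j 1)) \<longlongrightarrow> D2 f x (axis i 1) (axis j 1)) (nhds x)"
      using tendsto_at_iff_tendsto_nhds isCont_def by blast
    from tendstoD[OF this, of "e / N"] e N
    show "\<forall>\<^sub>F y in nhds x. \<bar>D2 f y (axis i 1) (axis j 1) - D2 f x (axis i 1) (axis j 1)\<bar> < e / N"
      by (simp add: dist_real_def)
  qed
  moreover have "\<forall>\<^sub>F y in nhds x. y \<in> U" using U x eventually_nhds by blast
  ultimately have "\<forall>\<^sub>F y in nhds x. y \<in> U \<and> (\<forall>i j. \<bar>D2 f y (axis i 1) (axis j 1) - D2 f x (axis i 1) (axis j 1)\<bar> < e / N)"
    by eventually_elim auto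
  then obtain d where d: "d > 0" "\<And>y. dist y x < d \<Longrightarrow> y \<in> U \<and> (\<forall>i j. \<bar>D2 f y (axis i 1) (axis j 1) - D2 f x (axis i 1) (axis j 1)\<bar> < e / N)"
    unfolding eventually_nhds_metric by blast
  show thesis
  proof (rule that[of d])
    show "ball x d \<subseteq> U" using d by (auto simp: dist_commute)
    fix y v w assume "y \<in> ball x d"
    then have y: "y \<in> U" "\<And>i j. \<bar>D2 f y (axis i 1) (axis j 1) - D2 f x (axis i 1) (axis j 1)\<bar> < e / N"
      using d by (auto simp: dist_commute)
    have ex: "D2 f y v w = (\<Sum>i\<in>UNIV. \<Sum>j\<in>UNIV. w $ i * v $ j * D2 f y (axis j 1) (axis i 1))" if "y \<in> U" for y
      using linear_eq_inner_vec[OF C2_linear(2)[OF that], of v w] linear_eq_inner_vec[OF C2_linear(3)[OF that], of v]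
      by (simp add: sum_distrib_left mult.assoc)
    have "\<bar>D2 f y v w - D2 f x v w\<bar> = \<bar>\<Sum>i\<in>UNIV. \<Sum>j\<in>UNIV. w $ i * v $ j * (D2 f y (axis j 1) (axis i 1) - D2 f x (axis j 1) (axis i 1))\<bar>"
      by (simp add: ex[OF y(1)] ex[OF x] sum_subtractf right_diff_distrib)
    also have "\<dots> \<le> (\<Sum>i\<in>UNIV. \<Sum>j\<in>UNIV. \<bar>w $ i * v $ j * (D2 f y (axis j 1) (axis i 1) - D2 f x (axis j 1) (axis i 1))\<bar>)"
      by (intro order_trans[OF sum_abs] sum_mono sum_abs)
    also have "\<dots> \<le> (\<Sum>i\<in>(UNIV::'N set). \<Sum>j\<in>(UNIV::'N set). norm w * norm v * (e / N))"
      unfolding abs_mult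
      by (intro sum_mono mult_mono component_le_norm_cart less_imp_le[OF y(2)]) auto
    also have "\<dots> = e * norm v * norm w" using N by (simp add: N_def field_simps)
    finally show "\<bar>D2 f y v w - D2 f x v w\<bar> \<le> e * norm v * norm w" .
  qed (use d in auto)
qed

text \<open>Taylor's formula along the segment has its Lagrange remainder at an intermediate point;
  \<open>C2_Hess_uniform\<close> moves that remainder back to \<open>x\<close>.\<close>

lemma C2_jet:
  assumes x: "x \<in> U"
  shows "jet2 f x (frechet_derivative f (at x)) (\<lambda>h. h \<bullet> (Hess f x *v h))"
proof (rule jet2I[OF C2_linear(1)[OF x]])
  show "quad_form (\<lambda>h. h \<bullet> (Hess f x *v h))" by (rule quad_formI) simp
  fix e :: real assume e: "e > 0"
  obtain d where d: "d > 0" "ball x d \<subseteq> U"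
    "\<And>y v w. y \<in> ball x d \<Longrightarrow> \<bar>D2 f y v w - D2 f x v w\<bar> \<le> e * norm v * norm w"
    using C2_Hess_uniform[OF x e] by blast
  show "\<exists>d>0. \<forall>h. norm h < d \<longrightarrow>
     \<bar>f (x + h) - f x - frechet_derivative f (at x) h - h \<bullet> (Hess f x *v h) / 2\<bar> \<le> e * (norm h)\<^sup>2"
  proof (intro exI[of _ d] conjI d(1) allI impI)
    fix h :: "real^'N" assume h: "norm h < d"
    have B: "x + t *\<^sub>R h \<in> ball x d" if "t \<in> {0..1}" for t
    proof -
      have "\<bar>t\<bar> * norm h \<le> 1 * norm h" using that by (intro mult_right_mono) auto
      then show ?thesis using h by (auto simp: dist_norm)
    qed
    define ph where "ph m t = (if m = (0::nat) then f (x + t *\<^sub>R h)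
       else if m = 1 then frechet_derivative f (at (x + t *\<^sub>R h)) h else D2 f (x + t *\<^sub>R h) h h)" for m t
    have ph: "ph 0 = (\<lambda>t. f (x + t *\<^sub>R h))" "ph (Suc 0) = (\<lambda>t. frechet_derivative f (at (x + t *\<^sub>R h)) h)"
      by (auto simp: ph_def)
    have "\<exists>t>0. t < 1 \<and> ph 0 1 = (\<Sum>m<2. ph m 0 / fact m * (1 - 0) ^ m) + ph 2 t / fact 2 * (1 - 0) ^ 2"
      by (rule Taylor_up[of 2 ph "ph 0" 0 1 0])
        (use B d(2) in \<open>auto simp: ph ph_def[of "Suc (Suc 0)"] less_2_cases_iff intro!: C2_line subsetD[OF d(2)]\<close>)
    then obtain t where t: "t > 0" "t < 1" "f (x + h) = f x + frechet_derivative f (at x) h + D2 f (x + t *\<^sub>R h) h h / 2"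
      by (auto simp: ph_def numeral_2_eq_2)
    have "\<bar>D2 f (x + t *\<^sub>R h) h h - D2 f x h h\<bar> \<le> e * norm h * norm h"
      by (rule d(3)) (use B t in auto)
    then have "\<bar>D2 f (x + t *\<^sub>R h) h h / 2 - D2 f x h h / 2\<bar> \<le> e * (norm h)\<^sup>2"
      unfolding power2_eq_square by (smt (verit) e mult_nonneg_nonneg norm_ge_zero field_sum_of_halves mult.assoc)
    then show "\<bar>f (x + h) - f x - frechet_derivative f (at x) h - h \<bullet> (Hess f x *v h) / 2\<bar> \<le> e * (norm h)\<^sup>2"
      by (simp add: t(3) D2_eq_Hess[OF x, symmetric])
  qed
qed

text \<open>The mixed second difference along two directions is \<open>t\<^sup>2\<close> times a second derivative at a
  nearby point, in either order.\<close>

lemma C2_mixed_difference: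
  assumes d: "d > 0" "ball x d \<subseteq> U" and t: "t > 0" "t * (norm a + norm b) < d"
  obtains y where "y \<in> ball x d"
    "f (x + t *\<^sub>R a + t *\<^sub>R b) - f (x + t *\<^sub>R a) - f (x + t *\<^sub>R b) + f x = t\<^sup>2 * D2 f y a b"
proof -
  have B: "x + s *\<^sub>R a + r *\<^sub>R b \<in> ball x d" if "0 \<le> s" "s \<le> t" "0 \<le> r" "r \<le> t" for s r
  proof -
    have "norm (s *\<^sub>R a + r *\<^sub>R b) \<le> s * norm a + r * norm b"
      using norm_triangle_ineq[of "s *\<^sub>R a" "r *\<^sub>R b"] that by simp
    also have "\<dots> \<le> t * norm a + t * norm b" using that by (intro add_mono mult_right_mono) auto
    finally have "norm (s *\<^sub>R a + r *\<^sub>R b) < d" using t by (simp add: algebra_simps)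
    moreover have "dist x (x + (s *\<^sub>R a + r *\<^sub>R b)) = norm (s *\<^sub>R a + r *\<^sub>R b)"
      using norm_minus_cancel by (metis add_diff_cancel_left' dist_commute dist_norm)
    ultimately show ?thesis by (simp add: add.assoc)
  qed
  define ph where "ph s = f (x + t *\<^sub>R b + s *\<^sub>R a) - f (x + s *\<^sub>R a)" for s
  have 1: "(ph has_real_derivative frechet_derivative f (at (x + t *\<^sub>R b + s *\<^sub>R a)) a - frechet_derivative f (at (x + s *\<^sub>R a)) a) (at s)"
    if "0 \<le> s" "s \<le> t" for s
  proof -
    have eq: "x + t *\<^sub>R b + s *\<^sub>R a = x + s *\<^sub>R a + t *\<^sub>R b" by (simp add: add_ac)
    have "x + s *\<^sub>R a + t *\<^sub>R b \<in> U" "x + s *\<^sub>R a + 0 *\<^sub>R b \<in> U"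
      using B[of s t] B[of s 0] that t(1) d(2) by auto
    then have "x + t *\<^sub>R b + s *\<^sub>R a \<in> U" "x + s *\<^sub>R a \<in> U" unfolding eq by simp_all
    then show ?thesis unfolding ph_def by (intro DERIV_diff C2_line)
  qed
  obtain s where s: "0 < s" "s < t"
    "ph t - ph 0 = (t - 0) * (frechet_derivative f (at (x + t *\<^sub>R b + s *\<^sub>R a)) a - frechet_derivative f (at (x + s *\<^sub>R a)) a)"
    using MVT2[OF t(1) 1] by blast
  have 2: "((\<lambda>r. frechet_derivative f (at (x + s *\<^sub>R a + r *\<^sub>R b)) a) has_real_derivative D2 f (x + s *\<^sub>R a + r *\<^sub>R b) a b) (at r)"
    if "0 \<le> r" "r \<le> t" for r
    using B[of s r] that s d(2) by (intro C2_line) auto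
  obtain r where r: "0 < r" "r < t"
    "frechet_derivative f (at (x + s *\<^sub>R a + t *\<^sub>R b)) a - frechet_derivative f (at (x + s *\<^sub>R a + 0 *\<^sub>R b)) a = (t - 0) * D2 f (x + s *\<^sub>R a + r *\<^sub>R b) a b"
    using MVT2[OF t(1) 2] by blast
  show thesis
  proof (rule that[of "x + s *\<^sub>R a + r *\<^sub>R b"])
    show "x + s *\<^sub>R a + r *\<^sub>R b \<in> ball x d" using B s r by auto
    have e: "x + t *\<^sub>R b + s *\<^sub>R a = x + s *\<^sub>R a + t *\<^sub>R b" "x + t *\<^sub>R b + t *\<^sub>R a = x + t *\<^sub>R a + t *\<^sub>R b"
      by (auto simp: add_ac)
    show "f (x + t *\<^sub>R a + t *\<^sub>R b) - f (x + t *\<^sub>R a) - f (x + t *\<^sub>R b) + f x = t\<^sup>2 * D2 f (x + s *\<^sub>R a + r *\<^sub>R b) a b"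
      using s(3) r(3) by (simp add: ph_def e power2_eq_square)
  qed
qed

text \<open>Schwarz's theorem: the mixed difference does not depend on the order of \<open>a\<close>
  and \<open>b\<close>, so the two second derivatives agree at two nearby, possibly different,
  points. Each is within a quarter of the supposed gap \<open>c\<close> of its value at
  \<open>x\<close>. Symmetry is required because members of \<open>F_sub\<close> and
  \<open>star_P F\<close> are symmetric matrices.\<close>

lemma D2_commute:
  assumes x: "x \<in> U"
  shows "D2 f x a b = D2 f x b a"
proof (rule ccontr)
  assume "D2 f x a b \<noteq> D2 f x b a"
  define c where "c = \<bar>D2 f x a b - D2 f x b a\<bar>"
  have c: "c > 0" using \<open>D2 f x a b \<noteq> D2 f x b a\<close> by (simp add: c_def)
  define e where "e = c / (4 * (norm a * norm b + 1))"
  have p: "norm a * norm b + 1 > 0" by (simp add: add_nonneg_pos)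
  have e: "e > 0" using c p by (simp add: e_def)
  have ec: "e * norm a * norm b \<le> c / 4" using c p by (simp add: e_def field_simps)
  obtain d where d: "d > 0" "ball x d \<subseteq> U"
    "\<And>y v w. y \<in> ball x d \<Longrightarrow> \<bar>D2 f y v w - D2 f x v w\<bar> \<le> e * norm v * norm w"
    using C2_Hess_uniform[OF x e] by blast
  define t where "t = d / (2 * (norm a + norm b + 1))"
  have q: "norm a + norm b + 1 > 0" by (simp add: add_nonneg_pos)
  have t: "t > 0" "t * (norm a + norm b) < d"
    using d(1) q by (auto simp: t_def field_simps add_nonneg_pos)
  obtain y where y: "y \<in> ball x d"
    "f (x + t *\<^sub>R a + t *\<^sub>R b) - f (x + t *\<^sub>R a) - f (x + t *\<^sub>R b) + f x = t\<^sup>2 * D2 f y a b"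
    using C2_mixed_difference[OF d(1,2) t] by blast
  obtain z where z: "z \<in> ball x d"
    "f (x + t *\<^sub>R b + t *\<^sub>R a) - f (x + t *\<^sub>R b) - f (x + t *\<^sub>R a) + f x = t\<^sup>2 * D2 f z b a"
    using C2_mixed_difference[OF d(1,2) t(1), of b a] t(2) by (auto simp: add_ac)
  have "t\<^sup>2 * D2 f y a b = t\<^sup>2 * D2 f z b a"
    unfolding y(2)[symmetric] z(2)[symmetric] by (simp add: add_ac)
  then have "D2 f y a b = D2 f z b a" using t by simp
  then show False
    using d(3)[OF y(1), of a b] d(3)[OF z(1), of b a] ec c unfolding c_def
    by (auto simp: mult_ac abs_if split: if_splits)
qed

lemma C2_Hess_Sym2:
  assumes x: "x \<in> U" shows "Hess f x \<in> Sym2"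
  unfolding Sym2_def
  using D2_commute[OF x] by (simp add: transpose_def vec_eq_iff Hess_def D2_def)

end

section \<open>Smooth quadratic test functions\<close>

lemma smooth_on_Ck: "smooth_on U g \<Longrightarrow> Ck_on k U g" by (simp add: smooth_on_def)

lemma jet2_smooth:
  assumes "open U" "smooth_on U g" "x \<in> U"
  shows "jet2 g x (frechet_derivative g (at x)) (\<lambda>h. h \<bullet> (Hess g x *v h))" "Hess g x \<in> Sym2"
  using C2_jet[OF assms(1) smooth_on_Ck assms(3)] C2_Hess_Sym2[OF assms(1) smooth_on_Ck assms(3)] assms(2) by blast+

lemma Ck_on_const: "Ck_on k S (\<lambda>_. c)"
  by (induction k arbitrary: c) auto

lemma Ck_on_affine: "linear L \<Longrightarrow> Ck_on k S (\<lambda>x. c + L x)" for L :: "real^'N \<Rightarrow> real"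
proof (cases k)
  case (Suc k)
  assume L: "linear L"
  then have D: "((\<lambda>x. c + L x) has_derivative L) (at x)" for x
    by (auto intro!: derivative_eq_intros linear_imp_has_derivative)
  show ?thesis using D frechet_derivative_at[OF D, symmetric]
    by (auto simp: Suc differentiable_def Ck_on_const)
next
  case 0
  assume "linear L"
  then show ?thesis unfolding 0 Ck_on.simps
    by (intro continuous_on_add continuous_on_const linear_continuous_on) (simp add: linear_linear)
qed

text \<open>Paraboloids are the only test functions that have to be exhibited. Their first
  derivatives are affine, which settles smoothness of every order at once.\<close>

lemma quadratic_derivatives:
  fixes X :: "real^'N^'N" and L :: "real^'N \<Rightarrow> real" and a :: "real^'N" and c :: real
  assumes X: "X \<in> Sym2" and L: "linear L"
  defines "q \<equiv> \<lambda>z. c + L (z - a) + (z - a) \<bullet> (X *v (z - a)) / 2"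
  shows "frechet_derivative q (at z) = (\<lambda>v. L v + v \<bullet> (X *v (z - a)))"
    and "smooth_on S q" and "Hess q z = X"
proof -
  have sym: "v \<bullet> (X *v w) = w \<bullet> (X *v v)" for v w
    using X inner_transpose[of v X w] by (simp add: Sym2_def del: transpose_matrix_vector)
  have bl: "bounded_linear L" using L by (simp add: linear_linear)
  have D: "(q has_derivative (\<lambda>v. L v + v \<bullet> (X *v (z - a)))) (at z)" for z
  proof -
    have "((\<lambda>z. c + L (z - a) + (z - a) \<bullet> (X *v (z - a)) / 2) has_derivative
       (\<lambda>v. L v + ((z - a) \<bullet> (X *v v) + v \<bullet> (X *v (z - a))) / 2)) (at z)"
      by (auto intro!: derivative_eq_intros bounded_linear.has_derivative[OF bl]
          bounded_linear.has_derivative[OF matrix_vector_mul_bounded_linear])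
    then show ?thesis unfolding q_def by (simp add: sym[of "z - a"])
  qed
  show 1: "frechet_derivative q (at z) = (\<lambda>v. L v + v \<bullet> (X *v (z - a)))" for z
    using frechet_derivative_at[OF D] by simp
  have M: "linear (\<lambda>z. v \<bullet> (X *v z))" for v
    by (auto intro!: linearI simp: matrix_vector_right_distrib inner_simps matrix_vector_mult_scaleR)
  have e: "(\<lambda>z. L v + v \<bullet> (X *v (z - a))) = (\<lambda>z. (L v - v \<bullet> (X *v a)) + v \<bullet> (X *v z))" for v
    by (auto simp: matrix_vector_mult_diff_distrib inner_simps)
  show "smooth_on S q"
    unfolding smooth_on_def
  proof
    fix k show "Ck_on k S q"
    proof (cases k)
      case 0
      then show ?thesis using has_derivative_continuous[OF D]
        by (auto intro!: continuous_at_imp_continuous_on)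
    next
      case (Suc k)
      then show ?thesis using D Ck_on_affine[OF M, of k S] by (auto simp: 1 e differentiable_def)
    qed
  qed
  have "((\<lambda>z. L v + v \<bullet> (X *v (z - a))) has_derivative (\<lambda>w. v \<bullet> (X *v w))) (at z)" for v z
    unfolding e by (auto intro!: derivative_eq_intros linear_imp_has_derivative M)
  from frechet_derivative_at[OF this, symmetric]
  have "frechet_derivative (\<lambda>z. L v + v \<bullet> (X *v (z - a))) (at z) = (\<lambda>w. w \<bullet> (X *v v))" for v z
    by (metis sym)
  then show "Hess q z = X"
    unfolding Hess_def 1
    by (simp only:) (simp add: vec_eq_iff inner_axis' matrix_vector_mult_basis column_def)
qed

text \<open>The bridge from second-order contact to smooth tests. Adding \<open>e / 2\<close> times
  the squared distance to the quadratic Taylor polynomial beats the remainder near \<open>z\<close>,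
  so a paraboloid lies above \<open>\<phi>\<close> and still touches \<open>f\<close>; the price is
  the term with \<open>e\<close> in the Hessian form.\<close>

lemma G_subharmonic_jet:
  assumes G: "G_subharmonic G Y f" and Y: "open Y" "z \<in> Y"
    and j: "jet2 \<phi> z L Q" and le: "\<forall>\<^sub>F w in nhds z. f w \<le> ereal (\<phi> w)" and eq: "f z = ereal (\<phi> z)"
    and e: "e > 0"
  obtains X where "X \<in> G" "\<And>h. h \<bullet> (X *v h) = Q h + e * (norm h)\<^sup>2"
proof -
  from j have LQ: "linear L" "quad_form Q" by (auto simp: jet2_def)
  from quad_form_Sym2[OF quad_form_add[OF LQ(2) quad_form_cmult[OF quad_form_norm]], of e]
  obtain X where X: "X \<in> Sym2" "\<And>h. Q h + e * (norm h)\<^sup>2 = h \<bullet> (X *v h)" by blast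
  define q where "q = (\<lambda>w. \<phi> z + L (w - z) + (w - z) \<bullet> (X *v (w - z)) / 2)"
  obtain d where d: "d > 0" "\<And>h. norm h < d \<Longrightarrow> \<bar>\<phi> (z + h) - \<phi> z - L h - Q h / 2\<bar> \<le> e/2 * (norm h)\<^sup>2"
    using jet2D[OF j, of "e/2"] e by auto
  have "\<forall>\<^sub>F w in nhds z. w \<in> ball z d" by (rule eventually_nhds_in_open) (use d in auto)
  moreover have "\<forall>\<^sub>F w in nhds z. w \<in> Y" by (rule eventually_nhds_in_open) (use Y in auto)
  ultimately have "\<forall>\<^sub>F w in nhds z. w \<in> Y \<and> f w \<le> ereal (q w)"
    using le
  proof eventually_elim
    case (elim w)
    have "\<bar>\<phi> (z + (w - z)) - \<phi> z - L (w - z) - Q (w - z) / 2\<bar> \<le> e/2 * (norm (w - z))\<^sup>2"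
      by (rule d(2)) (use elim in \<open>simp add: dist_norm norm_minus_commute\<close>)
    from abs_le_D1[OF this] have "\<phi> w \<le> q w"
      by (simp add: q_def X(2)[symmetric] field_simps)
    with elim show ?case by (meson ereal_less_eq(3) order_trans)
  qed
  then obtain U where U: "open U" "z \<in> U" "\<And>w. w \<in> U \<Longrightarrow> w \<in> Y \<and> f w \<le> ereal (q w)"
    unfolding eventually_nhds by blast
  have "q z = \<phi> z" using linear_0[OF LQ(1)] by (simp add: q_def)
  moreover have "smooth_on U q" "Hess q z = X"
    unfolding q_def by (rule quadratic_derivatives[OF X(1) LQ(1)])+
  ultimately have "X \<in> G"
    using G Y(2) U eq unfolding G_subharmonic_def by (metis subsetI)
  with that X(2) show thesis by metis
qed

section \<open>The Brunn-Minkowski inequality\<close>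

abbreviation lvol :: "'a::euclidean_space set \<Rightarrow> real" where
  "lvol \<equiv> measure lborel"

section \<open>Minkowski combinations of unions of boxes\<close>

definition minkowski_comb :: "real \<Rightarrow> 'a::euclidean_space set \<Rightarrow> 'a set \<Rightarrow> 'a set" where
  "minkowski_comb l S T = (\<lambda>(x, y). l *\<^sub>R x + (1 - l) *\<^sub>R y) ` (S \<times> T)"

lemma comb_swap: "minkowski_comb (1 - l) T S = minkowski_comb l S T"
  unfolding minkowski_comb_def by (force simp: add.commute image_iff)

lemma comb_mono: "S \<subseteq> S' \<Longrightarrow> T \<subseteq> T' \<Longrightarrow> minkowski_comb l S T \<subseteq> minkowski_comb l S' T'"
  unfolding minkowski_comb_def by auto

lemma compact_comb: "compact S \<Longrightarrow> compact T \<Longrightarrow> compact (minkowski_comb l S T)"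
  unfolding minkowski_comb_def
  by (intro compact_continuous_image compact_Times) (auto intro!: continuous_intros simp: case_prod_unfold)

text \<open>An indexed family, so that cutting with a half-space changes the map and drops indices.
  Boxes of volume 0 are excluded: the cardinality of \<open>I\<close> then measures progress when a
  cut flattens a box.\<close>

definition boxes :: "'i set \<Rightarrow> ('i \<Rightarrow> 'a::euclidean_space set) \<Rightarrow> bool" where
  "boxes I K \<longleftrightarrow> finite I \<and> I \<noteq> {} \<and> (\<forall>i\<in>I. 0 < lvol (K i) \<and> (\<exists>a b. K i = cbox a b)) \<and>
     (\<forall>i\<in>I. \<forall>j\<in>I. i \<noteq> j \<longrightarrow> interior (K i) \<inter> interior (K j) = {})"

lemma compact_boxes: "boxes I K \<Longrightarrow> compact (\<Union>(K ` I))"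
  unfolding boxes_def by (auto intro!: compact_UN)

lemma boxes_sum_pos: "boxes I K \<Longrightarrow> (\<Sum>i\<in>I. lvol (K i)) > 0"
  unfolding boxes_def by (intro sum_pos) auto

lemma boxes_restrict:
  assumes b: "boxes I K" and H: "\<And>a b. \<exists>c d. cbox a b \<inter> H = cbox c d"
    and ne: "{i\<in>I. 0 < lvol (K i \<inter> H)} \<noteq> {}"
  shows "boxes {i\<in>I. 0 < lvol (K i \<inter> H)} (\<lambda>i. K i \<inter> H)"
    and "(\<Sum>i\<in>{i\<in>I. 0 < lvol (K i \<inter> H)}. lvol (K i \<inter> H)) = (\<Sum>i\<in>I. lvol (K i \<inter> H))"
proof -
  show "boxes {i\<in>I. 0 < lvol (K i \<inter> H)} (\<lambda>i. K i \<inter> H)"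
    unfolding boxes_def
  proof (intro conjI ballI impI ne)
    show "finite {i \<in> I. 0 < lvol (K i \<inter> H)}" using b by (auto simp: boxes_def)
  next
    fix i assume "i \<in> {i \<in> I. 0 < lvol (K i \<inter> H)}"
    then show "\<exists>a b. K i \<inter> H = cbox a b" "0 < lvol (K i \<inter> H)" using b H unfolding boxes_def by force+
  next
    fix i j assume "i \<in> {i \<in> I. 0 < lvol (K i \<inter> H)}" "j \<in> {i \<in> I. 0 < lvol (K i \<inter> H)}" "i \<noteq> j"
    then have "interior (K i) \<inter> interior (K j) = {}" using b unfolding boxes_def by auto
    then show "interior (K i \<inter> H) \<inter> interior (K j \<inter> H) = {}" by auto
  qed
  show "(\<Sum>i\<in>{i\<in>I. 0 < lvol (K i \<inter> H)}. lvol (K i \<inter> H)) = (\<Sum>i\<in>I. lvol (K i \<inter> H))"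
    by (rule sum.mono_neutral_left) (use b in \<open>auto simp: boxes_def zero_less_measure_iff\<close>)
qed

lemma cbox_Int_halfspaces:
  assumes "k \<in> Basis"
  shows "\<exists>c d. cbox a b \<inter> {x. x \<bullet> k \<le> t} = cbox c d" "\<exists>c d. cbox a b \<inter> {x. x \<bullet> k \<ge> t} = cbox c d"
  unfolding interval_split[OF assms] by blast+

text \<open>The closed form makes continuity in \<open>c\<close> visible, as the intermediate value
  argument of \<open>boxes_cut\<close> requires.\<close>

lemma content_halfspace:
  assumes k: "k \<in> Basis" and pos: "0 < lvol (cbox u v)"
  shows "lvol (cbox u v \<inter> {x. x \<bullet> k \<le> c}) =
    max 0 (min (v \<bullet> k) c - u \<bullet> k) * (\<Prod>b\<in>Basis - {k}. v \<bullet> b - u \<bullet> b)"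
proof -
  from pos have lt: "\<And>b. b \<in> Basis \<Longrightarrow> u \<bullet> b < v \<bullet> b" by (simp add: content_pos_lt_eq)
  define w where "w = (\<Sum>i\<in>Basis. (if i = k then min (v\<bullet>k) c else v\<bullet>i) *\<^sub>R i)"
  have w: "w \<bullet> b = (if b = k then min (v\<bullet>k) c else v\<bullet>b)" if "b \<in> Basis" for b
    using that by (simp add: w_def inner_sum_left_Basis)
  have eq: "cbox u v \<inter> {x. x \<bullet> k \<le> c} = cbox u w"
    unfolding w_def by (rule interval_split[OF k])
  show ?thesis
  proof (cases "u \<bullet> k \<le> min (v \<bullet> k) c")
    case True
    then have "cbox u w \<noteq> {}" unfolding box_ne_empty using w lt by (auto simp: less_imp_le)
    then have "lvol (cbox u w) = (\<Prod>b\<in>Basis. w \<bullet> b - u \<bullet> b)" by (simp add: content_cbox_if)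
    also have "\<dots> = (w \<bullet> k - u \<bullet> k) * (\<Prod>b\<in>Basis - {k}. w \<bullet> b - u \<bullet> b)"
      by (rule prod.remove) (use k in auto)
    also have "(\<Prod>b\<in>Basis - {k}. w \<bullet> b - u \<bullet> b) = (\<Prod>b\<in>Basis - {k}. v \<bullet> b - u \<bullet> b)"
      by (rule prod.cong) (auto simp: w)
    finally show ?thesis using True k by (simp add: eq w)
  next
    case False
    then have "cbox u w = {}" using k w unfolding box_eq_empty by force
    then show ?thesis using False by (auto simp: eq max_def)
  qed
qed

lemma boxes_cut:
  assumes b: "boxes J L" and k: "k \<in> Basis" and th: "0 < \<theta>" "\<theta> < 1"
  obtains c where "(\<Sum>j\<in>J. lvol (L j \<inter> {x. x \<bullet> k \<le> c})) = \<theta> * (\<Sum>j\<in>J. lvol (L j))"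
proof -
  let ?f = "\<lambda>c. \<Sum>j\<in>J. lvol (L j \<inter> {x. x \<bullet> k \<le> c})"
  from b have fin: "finite J" and L: "\<And>j. j \<in> J \<Longrightarrow> 0 < lvol (L j) \<and> (\<exists>a b. L j = cbox a b)"
    by (auto simp: boxes_def)
  have cont: "continuous_on UNIV ?f"
  proof (rule continuous_on_sum)
    fix j assume "j \<in> J"
    then obtain u v where "L j = cbox u v" "0 < lvol (cbox u v)" using L by metis
    then show "continuous_on UNIV (\<lambda>c. lvol (L j \<inter> {x. x \<bullet> k \<le> c}))"
      by (simp add: content_halfspace[OF k]) (intro continuous_intros)
  qed
  obtain B where B: "\<And>x. x \<in> \<Union>(L ` J) \<Longrightarrow> norm x \<le> B"
    using compact_imp_bounded[OF compact_boxes[OF b]] unfolding bounded_iff by blast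
  have Bk: "\<bar>x \<bullet> k\<bar> \<le> B" if "x \<in> \<Union>(L ` J)" for x
    using B[OF that] Basis_le_norm[OF k, of x] by linarith
  \<comment> \<open>The extra \<open>- 1\<close> puts the level strictly below every box, so that
    all intersections are empty rather than merely flat.\<close>
  have lo: "?f (- \<bar>B\<bar> - 1) = 0"
  proof (rule sum.neutral, rule ballI)
    fix j assume "j \<in> J"
    then have "L j \<inter> {x. x \<bullet> k \<le> - \<bar>B\<bar> - 1} = {}" using Bk by fastforce
    then show "lvol (L j \<inter> {x. x \<bullet> k \<le> - \<bar>B\<bar> - 1}) = 0" by simp
  qed
  have hi: "?f \<bar>B\<bar> = (\<Sum>j\<in>J. lvol (L j))"
  proof (rule sum.cong)
    fix j assume "j \<in> J"
    then have "L j \<inter> {x. x \<bullet> k \<le> \<bar>B\<bar>} = L j" using Bk by fastforce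
    then show "lvol (L j \<inter> {x. x \<bullet> k \<le> \<bar>B\<bar>}) = lvol (L j)" by simp
  qed simp
  have pos: "(\<Sum>j\<in>J. lvol (L j)) > 0" by (rule boxes_sum_pos[OF b])
  have "\<exists>c\<ge>- \<bar>B\<bar> - 1. c \<le> \<bar>B\<bar> \<and> ?f c = \<theta> * (\<Sum>j\<in>J. lvol (L j))"
    by (rule IVT'[of ?f]) (use lo hi pos th cont in \<open>auto intro: continuous_on_subset simp: mult_le_cancel_right1\<close>)
  with that show thesis by blast
qed

lemma cbox_subset_halfspaces:
  assumes "k \<in> Basis"
  shows "b \<bullet> k \<le> t \<Longrightarrow> cbox a b \<subseteq> {x. x \<bullet> k \<le> t}" "t \<le> a \<bullet> k \<Longrightarrow> cbox a b \<subseteq> {x. x \<bullet> k \<ge> t}"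
  using assms by (fastforce simp: mem_box)+

text \<open>Nondegenerate boxes with disjoint interiors have non-overlapping projections to some
  axis. The names \<open>p\<close> and \<open>q\<close> absorb the question which of the two lies
  below.\<close>

lemma separated_boxes:
  assumes b: "boxes I K" and ij: "i \<in> I" "j \<in> I" "i \<noteq> j"
  obtains k c p q where "k \<in> Basis" "{p, q} = {i, j}"
    "K p \<subseteq> {x. x \<bullet> k \<le> c}" "K q \<subseteq> {x. x \<bullet> k \<ge> c}"
proof -
  from b ij obtain a b c d where K: "K i = cbox a b" "K j = cbox c d"
    and pos: "0 < lvol (cbox a b)" "0 < lvol (cbox c d)"
    unfolding boxes_def by metis
  have lt: "\<And>k. k \<in> Basis \<Longrightarrow> a \<bullet> k < b \<bullet> k" "\<And>k. k \<in> Basis \<Longrightarrow> c \<bullet> k < d \<bullet> k"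
    using pos by (auto simp: content_pos_lt_eq)
  have "box a b \<inter> box c d = {}" using \<open>boxes I K\<close> ij K unfolding boxes_def by (metis interior_cbox)
  then obtain k where k: "k \<in> Basis" "b \<bullet> k \<le> c \<bullet> k \<or> d \<bullet> k \<le> a \<bullet> k"
    unfolding disjoint_interval(4) using lt by (metis not_le)
  then consider "b \<bullet> k \<le> c \<bullet> k" | "d \<bullet> k \<le> a \<bullet> k" by blast
  then show thesis
  proof cases
    case 1
    show thesis by (rule that[of k i j "b \<bullet> k"]) (use 1 k(1) cbox_subset_halfspaces(1)[OF k(1), of b "b \<bullet> k" a]
        cbox_subset_halfspaces(2)[OF k(1), of "b \<bullet> k" c d] in \<open>auto simp: K\<close>)
  next
    case 2
    show thesis by (rule that[of k j i "d \<bullet> k"]) (use 2 k(1) cbox_subset_halfspaces(1)[OF k(1), of d "d \<bullet> k" c]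
        cbox_subset_halfspaces(2)[OF k(1), of "d \<bullet> k" a b] in \<open>auto simp: K\<close>)
  qed
qed

definition bm_ineq :: "real \<Rightarrow> 'i set \<Rightarrow> ('i \<Rightarrow> 'a::euclidean_space set) \<Rightarrow> 'j set \<Rightarrow> ('j \<Rightarrow> 'a set) \<Rightarrow> bool" where
  "bm_ineq l I K J L \<longleftrightarrow> (\<Sum>i\<in>I. lvol (K i)) powr l * (\<Sum>j\<in>J. lvol (L j)) powr (1 - l)
     \<le> vol (minkowski_comb l (\<Union>(K ` I)) (\<Union>(L ` J)))"

lemma bm_swap: "bm_ineq (1 - l) J L I K \<longleftrightarrow> bm_ineq l I K J L"
  by (simp add: bm_ineq_def comb_swap mult.commute)

lemma lvol_hyperplane:
  assumes "k \<in> Basis" "S \<subseteq> {x. x \<bullet> k = c}" shows "lvol S = 0"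
proof -
  have "negligible S" by (rule negligible_subset[OF negligible_standard_hyperplane[OF assms(1)] assms(2)])
  then show ?thesis
    by (metis measure_eq_0_null_sets measure_notin_sets measure_completion negligible_iff_null_sets)
qed

text \<open>The Hadwiger-Ohmann cut. A coordinate hyperplane separating two boxes of the first
  family leaves fewer boxes on either side; a parallel hyperplane cuts the second family in the same
  volume ratio. The combinations of lower with lower and upper with upper parts lie on opposite
  sides of a third parallel hyperplane, so their volumes add.\<close>

lemma bm_step:
  fixes K :: "'i \<Rightarrow> 'a::euclidean_space set" and L :: "'j \<Rightarrow> 'a set"
  assumes I: "boxes I K" and J: "boxes J L" and l: "0 < l" "l < 1" and c: "card I \<ge> 2"
    and IH: "\<And>I' K' J' L'. boxes I' (K' :: 'i \<Rightarrow> 'a set) \<Longrightarrow> boxes J' (L' :: 'j \<Rightarrow> 'a set) \<Longrightarrow>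
       card I' + card J' < card I + card J \<Longrightarrow> bm_ineq l I' K' J' L'"
  shows "bm_ineq l I K J L"
proof -
  obtain i j where "i \<in> I" "j \<in> I" "i \<noteq> j"
    using c by (metis card_2_iff' card_le_Suc0_iff_eq finite_subset not_less_eq_eq numeral_2_eq_2 I[unfolded boxes_def])
  then obtain k c p q where k: "k \<in> Basis" and pq: "p \<in> I" "q \<in> I"
     "K p \<subseteq> {x. x \<bullet> k \<le> c}" "K q \<subseteq> {x. x \<bullet> k \<ge> c}"
    using separated_boxes[OF I] by (metis doubleton_eq_iff)
  have finI: "finite I" "finite J" using I J by (auto simp: boxes_def)
  define lo hi where "lo t = {x::'a. x \<bullet> k \<le> t}" and "hi t = {x::'a. x \<bullet> k \<ge> t}" for t
  note H = cbox_Int_halfspaces[OF k, folded lo_def hi_def]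
  have split: "lvol (K i) = lvol (K i \<inter> lo t) + lvol (K i \<inter> hi t)" if "boxes I K" "i \<in> I" for t i and I :: "'k set" and K
    using that content_split[OF k] unfolding lo_def hi_def boxes_def by metis
  define m n where "m = (\<Sum>i\<in>I. lvol (K i))" and "n = (\<Sum>j\<in>J. lvol (L j))"
  have mn: "m > 0" "n > 0" unfolding m_def n_def by (intro boxes_sum_pos I J)+
  define IL IH' where "IL = {i\<in>I. 0 < lvol (K i \<inter> lo c)}" and "IH' = {i\<in>I. 0 < lvol (K i \<inter> hi c)}"
  have "K p \<inter> lo c = K p" "K q \<inter> hi c = K q" using pq by (auto simp: lo_def hi_def)
  then have p: "p \<in> IL" and q: "q \<in> IH'" using I pq by (auto simp: IL_def IH'_def boxes_def)
  \<comment> \<open>Each of these meets the opposite half-space in the hyperplane at most and loses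
    its index there, so both halves are strictly smaller families.\<close>
  have "lvol (K q \<inter> lo c) = 0" "lvol (K p \<inter> hi c) = 0"
    using pq(3,4) by (auto simp: lo_def hi_def intro!: lvol_hyperplane[OF k, of _ c])
  then have "q \<notin> IL" "p \<notin> IH'" "IL \<subseteq> I" "IH' \<subseteq> I" by (auto simp: IL_def IH'_def)
  then have "IL \<subset> I" "IH' \<subset> I" using pq by blast+
  then have cI: "card IL < card I" "card IH' < card I" by (auto intro: psubset_card_mono finI)
  have bIL: "boxes IL (\<lambda>i. K i \<inter> lo c)" "(\<Sum>i\<in>IL. lvol (K i \<inter> lo c)) = (\<Sum>i\<in>I. lvol (K i \<inter> lo c))"
    using boxes_restrict[OF I H(1)] p unfolding IL_def by blast+
  have bIH: "boxes IH' (\<lambda>i. K i \<inter> hi c)" "(\<Sum>i\<in>IH'. lvol (K i \<inter> hi c)) = (\<Sum>i\<in>I. lvol (K i \<inter> hi c))"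
    using boxes_restrict[OF I H(2)] q unfolding IH'_def by blast+
  define a where "a = (\<Sum>i\<in>I. lvol (K i \<inter> lo c))"
  have msplit: "m = a + (\<Sum>i\<in>I. lvol (K i \<inter> hi c))"
    unfolding m_def a_def sum.distrib[symmetric] by (rule sum.cong) (auto intro: split[OF I])
  have a: "a > 0" "m - a > 0"
    using boxes_sum_pos[OF bIL(1)] boxes_sum_pos[OF bIH(1)] unfolding bIL bIH msplit a_def by auto
  define \<theta> where "\<theta> = a / m"
  have th: "0 < \<theta>" "\<theta> < 1" "a = \<theta> * m" "m - a = (1 - \<theta>) * m" using a mn by (auto simp: \<theta>_def field_simps)
  \<comment> \<open>This cut may pass through boxes, but neither half has more of them than
    \<open>J\<close>, so the total count still drops.\<close>
  obtain d where d: "(\<Sum>j\<in>J. lvol (L j \<inter> lo d)) = \<theta> * n"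
    using boxes_cut[OF J k th(1,2)] unfolding n_def lo_def by blast
  have nsplit: "n = (\<Sum>j\<in>J. lvol (L j \<inter> lo d)) + (\<Sum>j\<in>J. lvol (L j \<inter> hi d))"
    unfolding n_def sum.distrib[symmetric] by (rule sum.cong) (auto intro: split[OF J])
  then have d': "(\<Sum>j\<in>J. lvol (L j \<inter> hi d)) = (1 - \<theta>) * n" using d by (simp add: algebra_simps)
  define JL JH where "JL = {j\<in>J. 0 < lvol (L j \<inter> lo d)}" and "JH = {j\<in>J. 0 < lvol (L j \<inter> hi d)}"
  have "JL \<noteq> {}"
  proof
    assume "JL = {}"
    then have "(\<Sum>j\<in>J. lvol (L j \<inter> lo d)) \<le> 0" by (intro sum_nonpos) (auto simp: JL_def not_less)
    then show False unfolding d using th mn by (simp add: mult_le_0_iff)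
  qed
  moreover have "JH \<noteq> {}"
  proof
    assume "JH = {}"
    then have "(\<Sum>j\<in>J. lvol (L j \<inter> hi d)) \<le> 0" by (intro sum_nonpos) (auto simp: JH_def not_less)
    then show False unfolding d' using th mn by (simp add: mult_le_0_iff)
  qed
  ultimately have bJL: "boxes JL (\<lambda>i. L i \<inter> lo d)" "(\<Sum>i\<in>JL. lvol (L i \<inter> lo d)) = \<theta> * n"
    and bJH: "boxes JH (\<lambda>i. L i \<inter> hi d)" "(\<Sum>i\<in>JH. lvol (L i \<inter> hi d)) = (1 - \<theta>) * n"
    using boxes_restrict[OF J H(1)] boxes_restrict[OF J H(2)] d d' unfolding JL_def JH_def by (blast, simp, blast, simp)
  have cJ: "card JL \<le> card J" "card JH \<le> card J" by (auto simp: JL_def JH_def intro!: card_mono finI)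
  define SL SH TL TH where "SL = \<Union>((\<lambda>i. K i \<inter> lo c) ` IL)" and "SH = \<Union>((\<lambda>i. K i \<inter> hi c) ` IH')"
    and "TL = \<Union>((\<lambda>i. L i \<inter> lo d) ` JL)" and "TH = \<Union>((\<lambda>i. L i \<inter> hi d) ` JH)"
  have cpt: "compact SL" "compact SH" "compact TL" "compact TH"
    unfolding SL_def SH_def TL_def TH_def by (intro compact_boxes bIL bIH bJL bJH)+
  have 1: "(\<theta> * m) powr l * (\<theta> * n) powr (1 - l) \<le> vol (minkowski_comb l SL TL)"
    using IH[OF bIL(1) bJL(1)] cI cJ bIL(2) bJL(2) a_def th(3) unfolding bm_ineq_def SL_def TL_def by simp
  have 2: "((1 - \<theta>) * m) powr l * ((1 - \<theta>) * n) powr (1 - l) \<le> vol (minkowski_comb l SH TH)"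
    using IH[OF bIH(1) bJH(1)] cI cJ bIH(2) bJH(2) msplit th(4) unfolding bm_ineq_def SH_def TH_def by simp
  \<comment> \<open>The exponents sum to 1, so equal volume ratios come out linearly, and the
    factors \<open>\<theta>\<close> and \<open>1 - \<theta>\<close> of the two halves add up to
    1.\<close>
  have e: "(t * m) powr l * (t * n) powr (1 - l) = t * (m powr l * n powr (1 - l))" if "t > 0" for t
  proof -
    have "(t * m) powr l * (t * n) powr (1 - l) = (t powr l * t powr (1 - l)) * (m powr l * n powr (1 - l))"
      using that mn by (simp add: powr_mult)
    also have "t powr l * t powr (1 - l) = t" using that by (simp add: powr_add[symmetric])
    finally show ?thesis .
  qed
  have "minkowski_comb l SL TL \<subseteq> {x. x \<bullet> k \<le> l * c + (1 - l) * d}"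
    unfolding minkowski_comb_def SL_def TL_def lo_def using l
    by (auto simp: inner_add_left intro!: add_mono mult_left_mono)
  moreover have "minkowski_comb l SH TH \<subseteq> {x. x \<bullet> k \<ge> l * c + (1 - l) * d}"
    unfolding minkowski_comb_def SH_def TH_def hi_def using l
    by (auto simp: inner_add_left intro!: add_mono mult_left_mono)
  ultimately have "minkowski_comb l SL TL \<inter> minkowski_comb l SH TH \<subseteq> {x. x \<bullet> k = l * c + (1 - l) * d}" by force
  then have neg: "negligible (minkowski_comb l SL TL \<inter> minkowski_comb l SH TH)"
    using negligible_standard_hyperplane[OF k] negligible_subset by blast
  have lm: "minkowski_comb l SL TL \<in> lmeasurable" "minkowski_comb l SH TH \<in> lmeasurable"
    by (intro lmeasurable_compact compact_comb cpt)+
  have sub: "minkowski_comb l SL TL \<union> minkowski_comb l SH TH \<subseteq> minkowski_comb l (\<Union>(K ` I)) (\<Union>(L ` J))"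
    by (intro Un_least comb_mono) (auto simp: SL_def SH_def TL_def TH_def IL_def IH'_def JL_def JH_def)
  have "m powr l * n powr (1 - l) = \<theta> * (m powr l * n powr (1 - l)) + (1 - \<theta>) * (m powr l * n powr (1 - l))"
    by (simp add: algebra_simps)
  also have "\<dots> \<le> vol (minkowski_comb l SL TL) + vol (minkowski_comb l SH TH)"
    using 1 2 e[of \<theta>] e[of "1 - \<theta>"] th by simp
  also have "\<dots> = vol (minkowski_comb l SL TL \<union> minkowski_comb l SH TH)"
    using measure_Un3[OF lm] neg by (simp add: negligible_imp_measure0)
  also have "\<dots> \<le> vol (minkowski_comb l (\<Union>(K ` I)) (\<Union>(L ` J)))"
    by (intro measure_mono_fmeasurable sub lmeasurable_compact compact_comb compact_boxes I J)
      (use lm in auto)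
  finally show ?thesis unfolding bm_ineq_def m_def n_def .
qed

text \<open>The combination contains the box whose side lengths are the combined side lengths; the
  weighted arithmetic-geometric mean inequality is applied to each side.\<close>

lemma bm_single:
  assumes l: "0 < l" "l < 1" and pos: "0 < lvol (cbox a b)" "0 < lvol (cbox c d)"
  shows "lvol (cbox a b) powr l * lvol (cbox c d) powr (1 - l) \<le> vol (minkowski_comb l (cbox a b) (cbox c d))"
proof -
  have lt: "\<And>k. k \<in> Basis \<Longrightarrow> a \<bullet> k < b \<bullet> k" "\<And>k. k \<in> Basis \<Longrightarrow> c \<bullet> k < d \<bullet> k"
    using pos by (auto simp: content_pos_lt_eq)
  define w where "w k = l * (b \<bullet> k - a \<bullet> k) + (1 - l) * (d \<bullet> k - c \<bullet> k)" for k
  have w: "w k > 0" if "k \<in> Basis" for k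
    unfolding w_def using lt[OF that] l by (intro add_pos_pos mult_pos_pos) auto
  have sub: "cbox (l *\<^sub>R a + (1 - l) *\<^sub>R c) (l *\<^sub>R b + (1 - l) *\<^sub>R d) \<subseteq> minkowski_comb l (cbox a b) (cbox c d)"
  proof
    fix z assume z: "z \<in> cbox (l *\<^sub>R a + (1 - l) *\<^sub>R c) (l *\<^sub>R b + (1 - l) *\<^sub>R d)"
    \<comment> \<open>The relative position of \<open>z\<close> within side \<open>k\<close>; the
      points at the same relative position in the two boxes combine to \<open>z\<close>.\<close>
    define r where "r k = (z \<bullet> k - l * (a \<bullet> k) - (1 - l) * (c \<bullet> k)) / w k" for k
    have r: "0 \<le> r k" "r k \<le> 1" "z \<bullet> k = l * (a \<bullet> k) + (1 - l) * (c \<bullet> k) + r k * w k" if "k \<in> Basis" for k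
    proof -
      have "l * (a \<bullet> k) + (1 - l) * (c \<bullet> k) \<le> z \<bullet> k" "z \<bullet> k \<le> l * (b \<bullet> k) + (1 - l) * (d \<bullet> k)"
        using z that by (auto simp: mem_box inner_add_left)
      then show "0 \<le> r k" "r k \<le> 1" "z \<bullet> k = l * (a \<bullet> k) + (1 - l) * (c \<bullet> k) + r k * w k"
        using w[OF that] unfolding r_def by (auto simp: field_simps) (auto simp: w_def algebra_simps)
    qed
    define x y where "x = (\<Sum>k\<in>Basis. (a \<bullet> k + r k * (b \<bullet> k - a \<bullet> k)) *\<^sub>R k)"
      and "y = (\<Sum>k\<in>Basis. (c \<bullet> k + r k * (d \<bullet> k - c \<bullet> k)) *\<^sub>R k)"
    have xk: "x \<bullet> k = a \<bullet> k + r k * (b \<bullet> k - a \<bullet> k)" and yk: "y \<bullet> k = c \<bullet> k + r k * (d \<bullet> k - c \<bullet> k)"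
      if "k \<in> Basis" for k using that by (simp_all add: x_def y_def inner_sum_left_Basis)
    have le: "u \<le> u + s * (v - u)" "u + s * (v - u) \<le> v" if "0 \<le> s" "s \<le> 1" "u < v" for u v s :: real
    proof -
      have 1: "s * (v - u) \<le> 1 * (v - u)" using that by (intro mult_right_mono) auto
      show "u \<le> u + s * (v - u)" using that by simp
      show "u + s * (v - u) \<le> v" using add_left_mono[OF 1, of u] by simp
    qed
    have "x \<in> cbox a b" "y \<in> cbox c d" using le r lt by (auto simp: mem_box xk yk less_imp_le)
    moreover have "z = l *\<^sub>R x + (1 - l) *\<^sub>R y"
      by (rule euclidean_eqI) (simp add: inner_add_left xk yk r(3) w_def algebra_simps)
    ultimately show "z \<in> minkowski_comb l (cbox a b) (cbox c d)" unfolding minkowski_comb_def by auto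
  qed
  have ne: "cbox (l *\<^sub>R a + (1 - l) *\<^sub>R c) (l *\<^sub>R b + (1 - l) *\<^sub>R d) \<noteq> {}"
    unfolding box_ne_empty using w by (auto simp: inner_add_left w_def algebra_simps intro: less_imp_le)
  have nes: "cbox a b \<noteq> {}" "cbox c d \<noteq> {}" unfolding box_ne_empty using lt by (auto intro: less_imp_le)
  have "lvol (cbox a b) powr l * lvol (cbox c d) powr (1 - l) =
     (\<Prod>k\<in>Basis. (b \<bullet> k - a \<bullet> k) powr l * (d \<bullet> k - c \<bullet> k) powr (1 - l))"
    using nes lt by (simp add: content_cbox_if prod.distrib prod_powr_distrib less_imp_le)
  also have "\<dots> \<le> (\<Prod>k\<in>Basis. w k)"
    unfolding w_def using lt l by (intro prod_mono conjI Youngs_inequality_0) (auto simp: algebra_simps)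
  also have "\<dots> = lvol (cbox (l *\<^sub>R a + (1 - l) *\<^sub>R c) (l *\<^sub>R b + (1 - l) *\<^sub>R d))"
    using ne by (simp add: content_cbox_if w_def inner_add_left algebra_simps)
  also have "\<dots> \<le> vol (minkowski_comb l (cbox a b) (cbox c d))"
    using measure_mono_fmeasurable[OF sub, of lebesgue] by (simp add: lmeasurable_compact compact_comb)
  finally show ?thesis .
qed

text \<open>The induction runs over the total number of boxes. If only the second family can be cut,
  the roles are exchanged, which replaces \<open>l\<close> by \<open>1 - l\<close>; therefore
  \<open>l\<close> is generalised and both families share one index type.\<close>

lemma bm_boxes:
  fixes K L :: "'i \<Rightarrow> 'a::euclidean_space set"
  assumes "boxes I K" "boxes J L" "0 < l" "l < 1"
  shows "bm_ineq l I K J L"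
  using assms
proof (induction "card I + card J" arbitrary: l I K J L rule: less_induct)
  case less
  have fin: "finite I" "finite J" "I \<noteq> {}" "J \<noteq> {}" using less.prems by (auto simp: boxes_def)
  consider "card I \<ge> 2" | "card J \<ge> 2" | "card I = 1" "card J = 1"
    using fin by (metis One_nat_def Suc_leI card_gt_0_iff le_antisym not_less_eq_eq numeral_2_eq_2)
  then show ?case
  proof cases
    case 1
    show ?thesis by (rule bm_step[OF less.prems 1]) (rule less.hyps, use less.prems in auto)
  next
    case 2
    have "bm_ineq (1 - l) J L I K"
      by (rule bm_step[OF less.prems(2,1) _ _ 2]) (use less.prems in auto, rule less.hyps, auto)
    then show ?thesis by (simp add: bm_swap)
  next
    case 3
    then obtain i j where ij: "I = {i}" "J = {j}" by (auto simp: card_1_singleton_iff)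
    then obtain a b c d where "K i = cbox a b" "L j = cbox c d" "0 < lvol (cbox a b)" "0 < lvol (cbox c d)"
      using less.prems unfolding boxes_def by auto
    then show ?thesis using bm_single less.prems(3,4) by (auto simp: bm_ineq_def ij)
  qed
qed

text \<open>An open set is a countable union of boxes. A finite subunion nearly exhausts its volume,
  and a common subdivision makes the boxes non-overlapping.\<close>

lemma open_inner_boxes:
  fixes U :: "'a::euclidean_space set"
  assumes U: "open U" "bounded U" and e: "0 \<le> e" "e < vol U"
  obtains I where "boxes I (\<lambda>K. K)" "\<Union>I \<subseteq> U" "e < (\<Sum>K\<in>I. lvol K)"
proof -
  obtain D where D: "countable D" "D \<subseteq> Pow U" "\<And>X. X \<in> D \<Longrightarrow> \<exists>a b. X = cbox a b" "\<Union>D = U"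
    using open_countable_Union_open_cbox[OF U(1)] by metis
  have lU: "U \<in> lmeasurable" using U by (simp add: lmeasurable_open)
  have lD: "X \<in> lmeasurable" if "X \<in> D" for X using D(3)[OF that] by auto
  obtain D' where D': "D' \<subseteq> D" "finite D'" "vol (\<Union>D) - (vol U - e) < vol (\<Union>D')"
  proof (rule measure_countable_Union_approachable[OF D(1), of "vol U - e" "vol U"])
    fix D' assume "D' \<subseteq> D" "finite D'"
    then show "vol (\<Union>D') \<le> vol U"
      using D(2) lD by (intro measure_mono_fmeasurable lU) (auto intro!: sets.finite_Union)
  qed (use e lD in auto)
  obtain p where p: "p division_of (\<Union>D')"
    using elementary_unions_intervals[OF D'(2)] D'(1) D(3) by blast
  have sum: "(\<Sum>K\<in>p. lvol K) = vol (\<Union>D')"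
  proof -
    have "(\<Sum>K\<in>p. lvol K) = (\<Sum>K\<in>p. vol K)"
    proof (rule sum.cong)
      fix K assume "K \<in> p"
      then obtain a b where "K = cbox a b" using division_ofD(4)[OF p] by blast
      then show "lvol K = vol K" by simp
    qed simp
    then show ?thesis using content_division[OF p] by simp
  qed
  define I where "I = {K\<in>p. 0 < lvol K}"
  have sI: "(\<Sum>K\<in>I. lvol K) = (\<Sum>K\<in>p. lvol K)" unfolding I_def
    by (rule sum.mono_neutral_left) (use division_ofD(1)[OF p] in \<open>auto simp: zero_less_measure_iff\<close>)
  have eI: "e < (\<Sum>K\<in>I. lvol K)" using D'(3) by (simp add: sI sum D(4))
  show thesis
  proof (rule that[OF _ _ eI])
    have "I \<noteq> {}" using eI e by auto
    then show "boxes I (\<lambda>K. K)" unfolding boxes_def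
      using division_ofD(1,4,5)[OF p] by (auto simp: I_def)
    show "\<Union>I \<subseteq> U" using division_ofD(6)[OF p] D'(1) D(2) unfolding I_def by blast
  qed
qed

text \<open>It is enough to lose a factor \<open>s < 1\<close>. Convexity makes the frontier
  negligible, so boxes inside the interiors capture more than the fraction \<open>s\<close> of each
  volume, and \<open>s powr l * s powr (1 - l) = s\<close> turns both losses into a single
  \<open>s\<close>.\<close>

theorem brunn_minkowski_log:
  fixes S T :: "'a::euclidean_space set"
  assumes S: "compact S" "convex S" and T: "compact T" "convex T" and l: "0 < l" "l < 1"
    and pos: "0 < vol S" "0 < vol T"
  shows "vol S powr l * vol T powr (1 - l) \<le> vol (minkowski_comb l S T)"
proof (rule field_le_mult_one_interval)
  fix s :: real assume s: "0 < s" "s < 1"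
  have mi: "vol (interior X) = vol X" if "compact X" "convex X" for X :: "'a set"
    using measure_interior compact_imp_bounded negligible_convex_frontier that by blast
  have *: "\<exists>I. boxes I (\<lambda>K. K) \<and> \<Union>I \<subseteq> X \<and> s * vol X < (\<Sum>K\<in>I. lvol K)"
    if "compact X" "convex X" "0 < vol X" for X :: "'a set"
  proof -
    obtain I where "boxes I (\<lambda>K. K)" "\<Union>I \<subseteq> interior X" "s * vol X < (\<Sum>K\<in>I. lvol K)"
    proof (rule open_inner_boxes[of "interior X" "s * vol X"])
      show "bounded (interior X)" using bounded_subset compact_imp_bounded interior_subset \<open>compact X\<close> by metis
      show "s * vol X < vol (interior X)" unfolding mi[OF \<open>compact X\<close> \<open>convex X\<close>]
        using \<open>0 < vol X\<close> s by simp
    qed (use s in auto)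
    moreover have "interior X \<subseteq> X" by (rule interior_subset)
    ultimately show ?thesis by (meson order_trans)
  qed
  obtain I where I: "boxes I (\<lambda>K. K)" "\<Union>I \<subseteq> S" "s * vol S < (\<Sum>K\<in>I. lvol K)"
    using *[OF S pos(1)] by blast
  obtain J where J: "boxes J (\<lambda>K. K)" "\<Union>J \<subseteq> T" "s * vol T < (\<Sum>K\<in>J. lvol K)"
    using *[OF T pos(2)] by blast
  have "s * (vol S powr l * vol T powr (1 - l)) =
     (s powr l * s powr (1 - l)) * (vol S powr l * vol T powr (1 - l))"
    using s by (simp add: powr_add[symmetric])
  also have "\<dots> = (s * vol S) powr l * (s * vol T) powr (1 - l)"
    using s by (simp add: powr_mult)
  also have "\<dots> \<le> (\<Sum>K\<in>I. lvol K) powr l * (\<Sum>K\<in>J. lvol K) powr (1 - l)"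
    using I(3) J(3) s l pos by (intro mult_mono powr_mono2) auto
  also have "\<dots> \<le> vol (minkowski_comb l (\<Union>I) (\<Union>J))"
    using bm_boxes[OF I(1) J(1) l] by (simp add: bm_ineq_def)
  also have "\<dots> \<le> vol (minkowski_comb l S T)"
  proof -
    have "compact (\<Union>I)" "compact (\<Union>J)" using compact_boxes[OF I(1)] compact_boxes[OF J(1)] by auto
    then show ?thesis
      by (intro measure_mono_fmeasurable comb_mono I J lmeasurable_compact compact_comb S T fmeasurableD)
  qed
  finally show "s * (vol S powr l * vol T powr (1 - l)) \<le> vol (minkowski_comb l S T)" .
qed

section \<open>Support functions and convex bodies\<close>

definition support_fun :: "'a::euclidean_space set \<Rightarrow> 'a \<Rightarrow> real" where
  "support_fun S u = (SUP z\<in>S. z \<bullet> u)"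

definition body :: "('a::euclidean_space \<Rightarrow> real) \<Rightarrow> 'a set" where
  "body H = {y. \<forall>u. y \<bullet> u \<le> H u}"

text \<open>These are the support functions of non-empty compact convex sets:
  \<open>sublin_supp\<close> gives one direction, \<open>body_nonempty\<close> and
  \<open>supp_body\<close> the other. The linear bound yields Lipschitz continuity and compact
  bodies.\<close>

definition sublin :: "('a::euclidean_space \<Rightarrow> real) \<Rightarrow> bool" where
  "sublin H \<longleftrightarrow> (\<forall>u v. H (u + v) \<le> H u + H v) \<and> (\<forall>c\<ge>0. \<forall>u. H (c *\<^sub>R u) = c * H u) \<and>
     (\<exists>C. \<forall>u. \<bar>H u\<bar> \<le> C * norm u)"

lemma bdd_above_inner: "bounded S \<Longrightarrow> bdd_above ((\<lambda>z. z \<bullet> u) ` S)"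
  by (rule bounded_imp_bdd_above, rule bounded_linear_image) (auto intro: bounded_linear_inner_left)

lemma supp_upper: "bounded S \<Longrightarrow> z \<in> S \<Longrightarrow> z \<bullet> u \<le> support_fun S u"
  unfolding support_fun_def by (rule cSUP_upper) (auto intro: bdd_above_inner)

lemma supp_least: "S \<noteq> {} \<Longrightarrow> (\<And>z. z \<in> S \<Longrightarrow> z \<bullet> u \<le> c) \<Longrightarrow> support_fun S u \<le> c"
  unfolding support_fun_def by (rule cSUP_least)

lemma supp_attained:
  assumes "compact S" "S \<noteq> {}" obtains z where "z \<in> S" "support_fun S u = z \<bullet> u"
proof -
  have "continuous_on S (\<lambda>z. z \<bullet> u)" by (intro continuous_intros)
  then obtain z where z: "z \<in> S" "\<And>y. y \<in> S \<Longrightarrow> y \<bullet> u \<le> z \<bullet> u"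
    using continuous_attains_sup[OF assms] by blast
  then have "support_fun S u = z \<bullet> u"
    using supp_upper[OF compact_imp_bounded[OF assms(1)]] supp_least[OF assms(2)] by (simp add: order_antisym)
  with z that show thesis by blast
qed

lemma sublin_supp:
  assumes S: "compact S" "S \<noteq> {}" shows "sublin (support_fun S)"
  unfolding sublin_def
proof (intro conjI allI impI)
  note up = supp_upper[OF compact_imp_bounded[OF S(1)]]
  fix u v show "support_fun S (u + v) \<le> support_fun S u + support_fun S v"
    by (rule supp_least[OF S(2)]) (auto simp: inner_add_right intro!: add_mono up)
next
  note up = supp_upper[OF compact_imp_bounded[OF S(1)]]
  fix c :: real and u :: 'a assume c: "c \<ge> 0"
  obtain z where z: "z \<in> S" "support_fun S u = z \<bullet> u" by (rule supp_attained[OF S])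
  have "support_fun S (c *\<^sub>R u) \<le> c * support_fun S u"
    using c by (intro supp_least[OF S(2)]) (auto intro!: mult_left_mono up)
  moreover have "c * support_fun S u \<le> support_fun S (c *\<^sub>R u)" using up[OF z(1), of "c *\<^sub>R u"] z by simp
  ultimately show "support_fun S (c *\<^sub>R u) = c * support_fun S u" by simp
next
  obtain B where B: "\<And>z. z \<in> S \<Longrightarrow> norm z \<le> B" using compact_imp_bounded[OF S(1)] by (auto simp: bounded_iff)
  have "\<bar>support_fun S u\<bar> \<le> B * norm u" for u
  proof -
    obtain z where z: "z \<in> S" "support_fun S u = z \<bullet> u" by (rule supp_attained[OF S])
    have "\<bar>z \<bullet> u\<bar> \<le> norm z * norm u" by (rule Cauchy_Schwarz_ineq2)
    also have "\<dots> \<le> B * norm u" using B[OF z(1)] by (intro mult_right_mono) auto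
    finally show ?thesis using z by simp
  qed
  then show "\<exists>C. \<forall>u. \<bar>support_fun S u\<bar> \<le> C * norm u" by blast
qed

lemma sublin_zero: "sublin (\<lambda>u. 0)"
  by (auto simp: sublin_def intro!: exI[of _ 0])

lemma sublin_add:
  assumes "sublin H" "sublin G" shows "sublin (\<lambda>u. H u + G u)"
proof -
  obtain C D where C: "\<And>u. \<bar>H u\<bar> \<le> C * norm u" and D: "\<And>u. \<bar>G u\<bar> \<le> D * norm u"
    using assms unfolding sublin_def by blast
  have "\<bar>H u + G u\<bar> \<le> (C + D) * norm u" for u
    using C[of u] D[of u] by (simp add: distrib_right)
  moreover have "H (u + v) + G (u + v) \<le> H u + G u + (H v + G v)" for u v
  proof -
    have "H (u + v) \<le> H u + H v" "G (u + v) \<le> G u + G v" using assms by (auto simp: sublin_def)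
    then show ?thesis by linarith
  qed
  moreover have "H (c *\<^sub>R u) + G (c *\<^sub>R u) = c * (H u + G u)" if "c \<ge> 0" for c u
    using assms that by (auto simp: sublin_def distrib_left)
  ultimately show ?thesis unfolding sublin_def by (intro conjI exI[of _ "C + D"] allI impI) auto
qed

lemma sublin_cmult:
  assumes "sublin H" "c \<ge> 0" shows "sublin (\<lambda>u. c * H u)"
proof -
  obtain C where C: "\<And>u. \<bar>H u\<bar> \<le> C * norm u" using assms unfolding sublin_def by blast
  have "\<bar>c * H u\<bar> \<le> (c * C) * norm u" for u
    using mult_left_mono[OF C assms(2), of u] assms(2) by (simp add: abs_mult mult_ac)
  moreover have "c * H (u + v) \<le> c * H u + c * H v" for u v
    using assms mult_left_mono[of "H (u + v)" "H u + H v" c] by (auto simp: sublin_def distrib_left)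
  moreover have "c * H (d *\<^sub>R u) = d * (c * H u)" if "d \<ge> 0" for d u
    using assms(1) that by (auto simp: sublin_def)
  ultimately show ?thesis unfolding sublin_def by (intro conjI exI[of _ "c * C"] allI impI) auto
qed

lemma sublin_sum: "(\<And>i. i \<in> I \<Longrightarrow> sublin (H i)) \<Longrightarrow> sublin (\<lambda>u. \<Sum>i\<in>I. H i u)"
  by (induction I rule: infinite_finite_induct) (auto intro: sublin_zero sublin_add)

lemma sublin_diff_le:
  assumes "sublin H" "\<And>u. \<bar>H u\<bar> \<le> C * norm u" shows "\<bar>H u - H v\<bar> \<le> C * norm (u - v)"
proof -
  have "H u \<le> H v + H (u - v)" "H v \<le> H u + H (v - u)"
    using assms(1) unfolding sublin_def by (metis add.commute diff_add_cancel)+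
  then show ?thesis using assms(2)[of "u - v"] assms(2)[of "v - u"] by (simp add: norm_minus_commute)
qed

lemma sublin_continuous: "sublin H \<Longrightarrow> continuous_on UNIV H"
proof -
  assume H: "sublin H"
  then obtain C where C: "\<And>u. \<bar>H u\<bar> \<le> C * norm u" unfolding sublin_def by blast
  have "\<bar>H u - H v\<bar> \<le> \<bar>C\<bar> * norm (u - v)" for u v
    by (rule order_trans[OF sublin_diff_le[OF H C] mult_right_mono]) auto
  then have "\<bar>C\<bar>-lipschitz_on UNIV H" by (intro lipschitz_onI) (auto simp: dist_norm)
  then show ?thesis by (rule lipschitz_on_continuous_on)
qed

section \<open>Convex bodies recovered from sublinear functions\<close>

lemma convex_body: "convex (body H)"
proof -
  have "body H = (\<Inter>u. {y. u \<bullet> y \<le> H u})" by (auto simp: body_def inner_commute)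
  then show ?thesis by (simp add: convex_INT convex_halfspace_le)
qed

lemma compact_body:
  assumes "\<And>u. H u \<le> C * norm u" shows "compact (body H)"
proof -
  have "body H = (\<Inter>u. {y. u \<bullet> y \<le> H u})" by (auto simp: body_def inner_commute)
  then have "closed (body H)" by (simp add: closed_INT closed_halfspace_le)
  moreover have "norm y \<le> C" if "y \<in> body H" "y \<noteq> 0" for y
  proof -
    have "norm y * norm y \<le> C * norm y" using that(1) assms[of y] unfolding body_def
      by (metis (mono_tags) mem_Collect_eq norm_eq_sqrt_inner order_trans real_sqrt_mult_self abs_of_nonneg inner_ge_zero)
    then show ?thesis using that(2) by simp
  qed
  then have "norm y \<le> \<bar>C\<bar>" if "y \<in> body H" for y using that by (cases "y = 0") force+
  then have "bounded (body H)" by (auto simp: bounded_iff)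
  ultimately show ?thesis by (simp add: compact_eq_bounded_closed)
qed

lemma sublin_compact_body: "sublin H \<Longrightarrow> compact (body H)"
  using compact_body unfolding sublin_def by (meson abs_le_D1)

text \<open>Separating the point \<open>(u, H u - e)\<close> from the epigraph of \<open>H\<close>.\<close>

lemma sublin_subgradient:
  assumes H: "sublin H" and e: "e > 0"
  obtains y where "y \<in> body H" "y \<bullet> u > H u - e"
proof -
  let ?E = "{p. H (fst p) \<le> snd p}"
  have hom: "\<And>c u. c \<ge> 0 \<Longrightarrow> H (c *\<^sub>R u) = c * H u" and sub: "\<And>u v. H (u + v) \<le> H u + H v"
    using H by (auto simp: sublin_def)
  have H0: "H 0 = 0" using hom[of 0 0] by simp
  have cont: "continuous_on UNIV (\<lambda>p::'a \<times> real. H (fst p))"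
    by (rule continuous_on_compose2[OF sublin_continuous[OF H]]) (auto intro: continuous_intros)
  have cl: "closed ?E" by (rule closed_Collect_le[OF cont]) (intro continuous_intros)
  have cv: "convex ?E"
  proof (rule convexI)
    fix p q :: "'a \<times> real" and s t :: real
    assume pq: "p \<in> ?E" "q \<in> ?E" and st: "0 \<le> s" "0 \<le> t" "s + t = 1"
    have "H (s *\<^sub>R fst p + t *\<^sub>R fst q) \<le> s * H (fst p) + t * H (fst q)"
      using sub[of "s *\<^sub>R fst p" "t *\<^sub>R fst q"] st by (simp add: hom)
    also have "\<dots> \<le> s * snd p + t * snd q" using pq st by (intro add_mono mult_left_mono) auto
    finally show "s *\<^sub>R p + t *\<^sub>R q \<in> ?E" by simp
  qed
  have "(u, H u - e) \<notin> ?E" using e by simp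
  from separating_hyperplane_closed_point[OF cv cl this]
  obtain a b where ab: "a \<bullet> (u, H u - e) < b" "\<And>p. p \<in> ?E \<Longrightarrow> a \<bullet> p > b"
    by blast
  obtain a1 a2 where a: "a = (a1, a2)" by (cases a)
  have b: "b < 0" using ab(2)[of "(0, 0)"] H0 by (simp add: a)
  \<comment> \<open>The epigraph is a cone: a negative value could be rescaled to exactly
    \<open>b\<close>, which is strictly below all values on the epigraph.\<close>
  have pos: "a1 \<bullet> v + a2 * t \<ge> 0" if "H v \<le> t" for v t
  proof (rule ccontr)
    assume neg: "\<not> a1 \<bullet> v + a2 * t \<ge> 0"
    define c where "c = b / (a1 \<bullet> v + a2 * t)"
    have "c \<ge> 0" unfolding c_def using neg b by (auto intro: divide_nonpos_nonpos)
    then have "(c *\<^sub>R v, c * t) \<in> ?E" using that by (simp add: hom mult_left_mono)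
    from ab(2)[OF this] have "b < c * (a1 \<bullet> v + a2 * t)" by (simp add: a algebra_simps)
    then show False using neg by (simp add: c_def)
  qed
  have lt: "a1 \<bullet> u + a2 * (H u - e) < 0" using ab(1) b by (simp add: a)
  moreover have "a1 \<bullet> u + a2 * H u \<ge> 0" by (rule pos) simp
  ultimately have "a2 * e > 0" by (simp add: algebra_simps)
  then have a2: "a2 > 0" using e by (simp add: zero_less_mult_iff)
  show thesis
  proof (rule that[of "- (1 / a2) *\<^sub>R a1"])
    show "- (1 / a2) *\<^sub>R a1 \<in> body H" unfolding body_def
    proof (intro CollectI allI)
      fix v
      have "a1 \<bullet> v + a2 * H v \<ge> 0" by (rule pos) simp
      then show "- (1 / a2) *\<^sub>R a1 \<bullet> v \<le> H v" using a2 by (simp add: field_simps)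
    qed
    show "H u - e < - (1 / a2) *\<^sub>R a1 \<bullet> u" using lt a2 by (simp add: field_simps)
  qed
qed

lemma body_nonempty: "sublin H \<Longrightarrow> body H \<noteq> {}"
  using sublin_subgradient[of H 1] by (metis empty_iff zero_less_one)

lemma supp_body:
  assumes H: "sublin H" shows "support_fun (body H) u = H u"
proof (rule antisym)
  note b = compact_imp_bounded[OF sublin_compact_body[OF H]]
  show "support_fun (body H) u \<le> H u"
    by (rule supp_least[OF body_nonempty[OF H]]) (simp add: body_def)
  show "H u \<le> support_fun (body H) u"
  proof (rule field_le_epsilon)
    fix e :: real assume "e > 0"
    then obtain y where "y \<in> body H" "y \<bullet> u > H u - e" using sublin_subgradient[OF H] by blast
    then show "H u \<le> support_fun (body H) u + e" using supp_upper[OF b, of y u] by linarith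
  qed
qed

text \<open>The decisive direction is the unit vector from the nearest point \<open>p\<close>
  towards \<open>y\<close>: in that direction \<open>S\<close> does not extend beyond
  \<open>p\<close>, so the excess of \<open>y\<close> over the support function is the whole
  distance.\<close>

lemma infdist_le_supp:
  assumes S: "compact S" "convex S" "S \<noteq> {}" and s: "s \<ge> 0"
    and le: "\<And>u. norm u = 1 \<Longrightarrow> y \<bullet> u \<le> support_fun S u + s"
  shows "infdist y S \<le> s"
proof (cases "y \<in> S")
  case False
  define p where "p = closest_point S y"
  have p: "p \<in> S" "\<And>z. z \<in> S \<Longrightarrow> (y - p) \<bullet> (z - p) \<le> 0"
    unfolding p_def using closest_point_in_set[OF compact_imp_closed] closest_point_dot[OF S(2) compact_imp_closed] S by auto
  have ne: "norm (y - p) > 0" using False p(1) by auto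
  define u where "u = (1 / norm (y - p)) *\<^sub>R (y - p)"
  have u: "norm u = 1" using ne by (simp add: u_def)
  have "support_fun S u \<le> p \<bullet> u"
  proof (rule supp_least[OF S(3)])
    fix z assume "z \<in> S"
    then have "u \<bullet> (z - p) \<le> 0" using p(2)[of z] ne by (simp add: u_def divide_le_0_iff)
    then show "z \<bullet> u \<le> p \<bullet> u" by (simp add: inner_diff_right inner_commute)
  qed
  moreover have "(y - p) \<bullet> u = norm (y - p)" using ne by (simp add: u_def dot_square_norm power2_eq_square)
  ultimately have "norm (y - p) \<le> s" using le[OF u] by (simp add: inner_diff_left)
  then show ?thesis using infdist_le[OF p(1), of y] by (simp add: dist_norm)
qed (use s in simp)

section \<open>Hausdorff distance and uniform distance of support functions\<close>

lemma bdd_above_infdist: "compact S \<Longrightarrow> bdd_above ((\<lambda>x. infdist x T) ` S)"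
  by (intro bounded_imp_bdd_above compact_imp_bounded compact_continuous_image continuous_intros)

lemma hausdorff_dist_upper:
  assumes "compact S" "compact T" 
  shows "x \<in> S \<Longrightarrow> infdist x T \<le> hausdorff_dist S T" "x \<in> T \<Longrightarrow> infdist x S \<le> hausdorff_dist S T"
  unfolding hausdorff_dist_def
  using cSUP_upper[OF _ bdd_above_infdist[OF assms(1)], of x T] cSUP_upper[OF _ bdd_above_infdist[OF assms(2)], of x S]
  by (auto simp: le_max_iff_disj)

lemma hausdorff_dist_least:
  assumes "S \<noteq> {}" "T \<noteq> {}" "\<And>x. x \<in> S \<Longrightarrow> infdist x T \<le> e" "\<And>x. x \<in> T \<Longrightarrow> infdist x S \<le> e"
  shows "hausdorff_dist S T \<le> e"
  unfolding hausdorff_dist_def using assms by (auto intro: cSUP_least)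

lemma hausdorff_dist_commute: "hausdorff_dist S T = hausdorff_dist T S"
  by (simp add: hausdorff_dist_def max.commute)

lemma supp_le_hausdorff:
  assumes S: "compact S" "S \<noteq> {}" and T: "compact T" "T \<noteq> {}"
  shows "support_fun S u \<le> support_fun T u + hausdorff_dist S T * norm u"
proof (rule supp_least[OF S(2)])
  fix x assume x: "x \<in> S"
  obtain y where y: "y \<in> T" "infdist x T = dist x y"
    using infdist_attains_inf[OF compact_imp_closed[OF T(1)] T(2)] by metis
  have "x \<bullet> u = y \<bullet> u + (x - y) \<bullet> u" by (simp add: inner_diff_left)
  also have "(x - y) \<bullet> u \<le> norm (x - y) * norm u" by (rule norm_cauchy_schwarz)
  also have "\<dots> \<le> hausdorff_dist S T * norm u"
    using hausdorff_dist_upper(1)[OF S(1) T(1) x] y by (intro mult_right_mono) (auto simp: dist_norm)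
  finally show "x \<bullet> u \<le> support_fun T u + hausdorff_dist S T * norm u"
    using supp_upper[OF compact_imp_bounded[OF T(1)] y(1), of u] by linarith
qed

lemma hausdorff_dist_le_supp:
  assumes S: "compact S" "convex S" "S \<noteq> {}" and T: "compact T" "convex T" "T \<noteq> {}" and e: "e \<ge> 0"
    and le: "\<And>u. norm u = 1 \<Longrightarrow> \<bar>support_fun S u - support_fun T u\<bar> \<le> e"
  shows "hausdorff_dist S T \<le> e"
proof (rule hausdorff_dist_least[OF S(3) T(3)])
  fix x assume "x \<in> S"
  then have "x \<bullet> u \<le> support_fun T u + e" if "norm u = 1" for u
    using supp_upper[OF compact_imp_bounded[OF S(1)], of x u] le[OF that] by linarith
  then show "infdist x T \<le> e" by (rule infdist_le_supp[OF T e])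
next
  fix x assume "x \<in> T"
  then have "x \<bullet> u \<le> support_fun S u + e" if "norm u = 1" for u
    using supp_upper[OF compact_imp_bounded[OF T(1)], of x u] le[OF that] by linarith
  then show "infdist x S \<le> e" by (rule infdist_le_supp[OF S e])
qed

text \<open>Two Hausdorff limits of common approximants coincide; the approximants will be Riemann
  sums, so this decides the definite description of the Minkowski integral.\<close>

lemma hausdorff_limit_unique:
  fixes K L :: "'a::euclidean_space set"
  assumes K: "compact K" "K \<noteq> {}" and L: "compact L" "L \<noteq> {}"
    and R: "\<And>e. e > 0 \<Longrightarrow> \<exists>R. compact R \<and> R \<noteq> {} \<and> hausdorff_dist R K < e \<and> hausdorff_dist R L < e"
  shows "K \<subseteq> L"
proof
  fix x assume x: "x \<in> K"
  have "infdist x L \<le> 0 + e" if e: "e > 0" for e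
  proof -
    obtain R where R: "compact R" "R \<noteq> {}" "hausdorff_dist R K < e/2" "hausdorff_dist R L < e/2"
      using R[of "e/2"] e by auto
    obtain y where y: "y \<in> R" "infdist x R = dist x y"
      using infdist_attains_inf[OF compact_imp_closed[OF R(1)] R(2)] by metis
    have "infdist x L \<le> infdist y L + dist x y" by (rule infdist_triangle)
    then show ?thesis
      using hausdorff_dist_upper(2)[OF R(1) K(1) x] hausdorff_dist_upper(1)[OF R(1) L(1) y(1)] y(2) R(3,4) by linarith
  qed
  then have "infdist x L \<le> 0" by (rule field_le_epsilon)
  then show "x \<in> L" using in_closed_iff_infdist_zero[OF compact_imp_closed[OF L(1)] L(2)] infdist_nonneg[of x L] by simp
qed

text \<open>The hypothesis on \<open>p\<close> and \<open>r\<close> says that \<open>body H\<close>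
  contains the ball of radius \<open>r\<close> about \<open>p\<close>. Measured from
  \<open>p\<close>, the error \<open>s * norm u\<close> is thus at most \<open>s / r\<close> times
  the support function, and a dilation about \<open>p\<close> by \<open>1 + s / r\<close> absorbs
  it.\<close>

lemma body_scaled_subset:
  assumes r: "r > 0" "\<And>u. p \<bullet> u + r * norm u \<le> H u" and s: "s \<ge> 0" "\<And>u. G u \<le> H u + s * norm u"
  shows "body G \<subseteq> (\<lambda>x. (1 - (1 + s / r)) *\<^sub>R p + (1 + s / r) *\<^sub>R x) ` body H"
proof
  fix y assume y: "y \<in> body G"
  define c where "c = 1 + s / r"
  have c: "c > 0" using r(1) s(1) by (auto simp: c_def intro: add_pos_nonneg)
  define x where "x = (1 / c) *\<^sub>R (y - (1 - c) *\<^sub>R p)"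
  have "x \<in> body H" unfolding body_def
  proof (intro CollectI allI)
    fix u
    have "y \<bullet> u \<le> H u + s * norm u" using y s(2)[of u] by (auto simp: body_def intro: order_trans)
    also have "s * norm u = (s / r) * (r * norm u)" using r by simp
    also have "\<dots> \<le> (s / r) * (H u - p \<bullet> u)"
    proof (rule mult_left_mono)
      show "r * norm u \<le> H u - p \<bullet> u" using r(2)[of u] by linarith
    qed (use r(1) s(1) in auto)
    finally have "y \<bullet> u - (1 - c) * (p \<bullet> u) \<le> c * H u" by (simp add: c_def algebra_simps)
    moreover have "x \<bullet> u = (1 / c) * (y \<bullet> u - (1 - c) * (p \<bullet> u))"
      unfolding x_def by (simp only: inner_scaleR_left inner_diff_left)
    ultimately show "x \<bullet> u \<le> H u" using c by (simp add: divide_le_eq mult.commute)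
  qed
  moreover have "y = (1 - c) *\<^sub>R p + c *\<^sub>R x" using c by (simp add: x_def)
  ultimately show "y \<in> (\<lambda>x. (1 - (1 + s / r)) *\<^sub>R p + (1 + s / r) *\<^sub>R x) ` body H"
    unfolding c_def by blast
qed

lemma measure_body_le:
  fixes H G :: "'a::euclidean_space \<Rightarrow> real"
  assumes "sublin H" "sublin G"
    and r: "r > 0" "\<And>u. p \<bullet> u + r * norm u \<le> H u" and s: "s \<ge> 0" "\<And>u. G u \<le> H u + s * norm u"
  shows "vol (body G) \<le> (1 + s / r) ^ DIM('a) * vol (body H)"
proof -
  let ?f = "\<lambda>x. (1 - (1 + s / r)) *\<^sub>R p + (1 + s / r) *\<^sub>R x"
  have "compact (?f ` body H)"
    by (intro compact_continuous_image sublin_compact_body assms(1) continuous_intros)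
  then have "vol (body G) \<le> vol (?f ` body H)"
    by (intro measure_mono_fmeasurable body_scaled_subset[OF r s] lmeasurable_compact fmeasurableD sublin_compact_body assms(2))
  also have "\<dots> = \<bar>1 + s / r\<bar> ^ DIM('a) * vol (body H)"
    using measure_lebesgue_affine[of "1 + s / r" "(1 - (1 + s / r)) *\<^sub>R p" "body H"] by (simp add: add.commute)
  finally show ?thesis using r s by simp
qed

text \<open>The estimate is linear in \<open>s\<close> with a constant depending only on the
  dimension and the inner radius, so a change of the support function by o(t^2) raises the logarithm
  of the volume by at most o(t^2).\<close>

lemma ln_measure_body_le:
  fixes H G :: "'a::euclidean_space \<Rightarrow> real"
  assumes HG: "sublin H" "sublin G" and pos: "0 < vol (body H)" "0 < vol (body G)"
    and r: "r > 0" "\<And>u. p \<bullet> u + r * norm u \<le> H u" and s: "s \<ge> 0" "\<And>u. G u \<le> H u + s * norm u"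
  shows "ln (vol (body G)) \<le> ln (vol (body H)) + DIM('a) * (s / r)"
proof -
  have p: "1 + s / r > 0" using r s by (auto intro: add_pos_nonneg)
  have "ln (vol (body G)) \<le> ln ((1 + s / r) ^ DIM('a) * vol (body H))"
    using measure_body_le[OF HG r s] pos p by simp
  also have "\<dots> = DIM('a) * ln (1 + s / r) + ln (vol (body H))"
    using pos p by (simp add: ln_mult_pos ln_realpow)
  also have "ln (1 + s / r) \<le> s / r" using r s by (intro ln_add_one_self_le_self) auto
  finally show ?thesis by (simp add: mult_left_mono)
qed

text \<open>An inner ball stated through \<open>H\<close> survives small perturbations of
  \<open>H\<close> with a slightly smaller radius.\<close>

lemma body_inner_ball:
  assumes H: "sublin H" and pos: "0 < vol (body H)"
  obtains p r where "r > 0" "\<And>u. p \<bullet> u + r * norm u \<le> H u"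
proof -
  have "interior (body H) \<noteq> {}"
    using pos negligible_convex_interior[OF convex_body, of H] negligible_imp_measure0 by force
  then obtain p where "p \<in> interior (body H)" by blast
  then obtain r where r: "r > 0" "cball p r \<subseteq> body H" unfolding mem_interior_cball by blast
  show thesis
  proof (rule that[OF r(1)])
    fix u show "p \<bullet> u + r * norm u \<le> H u"
    proof (cases "u = 0")
      case True
      have "p \<in> body H" using r by auto
      then have "p \<bullet> u \<le> H u" unfolding body_def by blast
      then show ?thesis using True by simp
    next
      case False
      have "p + (r / norm u) *\<^sub>R u \<in> body H" using r False by (intro subsetD[OF r(2)]) (auto simp: dist_norm)
      then have "(p + (r / norm u) *\<^sub>R u) \<bullet> u \<le> H u" unfolding body_def by blast
      then show ?thesis using False by (simp add: inner_add_left dot_square_norm power2_eq_square)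
    qed
  qed
qed

lemma measure_body_pos:
  assumes H: "sublin H" and r: "r > 0" "\<And>u. p \<bullet> u + r * norm u \<le> H u"
  shows "0 < vol (body H)"
proof -
  have "cball p r \<subseteq> body H"
  proof
    fix y assume "y \<in> cball p r"
    then have y: "norm (y - p) \<le> r" by (simp add: dist_norm norm_minus_commute)
    show "y \<in> body H" unfolding body_def
    proof (intro CollectI allI)
      fix u
      have "y \<bullet> u = p \<bullet> u + (y - p) \<bullet> u" by (simp add: inner_diff_left)
      also have "(y - p) \<bullet> u \<le> norm (y - p) * norm u" by (rule norm_cauchy_schwarz)
      also have "\<dots> \<le> r * norm u" using y by (intro mult_right_mono) auto
      finally show "y \<bullet> u \<le> H u" using r(2)[of u] by simp
    qed
  qed
  then have "interior (body H) \<noteq> {}"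
    using r(1) interior_mono[of "cball p r" "body H"] by (metis centre_in_ball empty_iff interior_cball subsetD)
  then have "\<not> negligible (body H)" using negligible_convex_interior[OF convex_body] by blast
  then show ?thesis
    using negligible_iff_measure[of "body H"] lmeasurable_compact[OF sublin_compact_body[OF H]]
    by (metis zero_less_measure_iff)
qed

text \<open>The Minkowski combination lies in the body of the combined support function; since the
  claim bounds that body's volume from below, inclusion suffices.\<close>

lemma brunn_minkowski_body:
  assumes HG: "sublin H" "sublin G" and pos: "0 < vol (body H)" "0 < vol (body G)"
    and l: "0 < l" "l < 1"
  shows "0 < vol (body (\<lambda>u. l * H u + (1 - l) * G u))"
    and "l * ln (vol (body H)) + (1 - l) * ln (vol (body G))
     \<le> ln (vol (body (\<lambda>u. l * H u + (1 - l) * G u)))"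
proof -
  have sub: "minkowski_comb l (body H) (body G) \<subseteq> body (\<lambda>u. l * H u + (1 - l) * G u)"
    unfolding minkowski_comb_def body_def using l by (auto simp: inner_add_left intro!: add_mono mult_left_mono)
  have "sublin (\<lambda>u. l * H u + (1 - l) * G u)" using l by (intro sublin_add sublin_cmult HG) auto
  then have "vol (minkowski_comb l (body H) (body G)) \<le> vol (body (\<lambda>u. l * H u + (1 - l) * G u))"
    by (intro measure_mono_fmeasurable sub lmeasurable_compact fmeasurableD compact_comb sublin_compact_body HG)
  with brunn_minkowski_log[OF sublin_compact_body[OF HG(1)] convex_body sublin_compact_body[OF HG(2)] convex_body l pos]
  have le: "vol (body H) powr l * vol (body G) powr (1 - l)
     \<le> vol (body (\<lambda>u. l * H u + (1 - l) * G u))" by linarith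
  have p: "0 < vol (body H) powr l * vol (body G) powr (1 - l)" using pos by simp
  then show "0 < vol (body (\<lambda>u. l * H u + (1 - l) * G u))" using le by linarith
  have "ln (vol (body H) powr l * vol (body G) powr (1 - l))
     \<le> ln (vol (body (\<lambda>u. l * H u + (1 - l) * G u)))"
    using le p by simp
  then show "l * ln (vol (body H)) + (1 - l) * ln (vol (body G))
     \<le> ln (vol (body (\<lambda>u. l * H u + (1 - l) * G u)))"
    using pos by (simp add: ln_mult_pos ln_powr)
qed

lemma brunn_minkowski_body_sum:
  assumes I: "finite I" "I \<noteq> {}" and H: "\<And>i. i \<in> I \<Longrightarrow> sublin (H i)"
    and pos: "\<And>i. i \<in> I \<Longrightarrow> 0 < vol (body (H i))"
    and l: "\<And>i. i \<in> I \<Longrightarrow> 0 < l i" "sum l I = 1"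
  shows "0 < vol (body (\<lambda>u. \<Sum>i\<in>I. l i * H i u)) \<and>
    (\<Sum>i\<in>I. l i * ln (vol (body (H i)))) \<le> ln (vol (body (\<lambda>u. \<Sum>i\<in>I. l i * H i u)))"
  using I H pos l
proof (induction I arbitrary: l rule: finite_ne_induct)
  case (singleton x)
  then show ?case by simp
next
  case (insert x I)
  \<comment> \<open>The weights on \<open>I\<close> are renormalised by \<open>t\<close> to sum to
    1, which reduces the step to two bodies with weights \<open>t\<close> and \<open>1 - t\<close>.
    Positivity of the combined volume is part of the induction since the two-body inequality
    presupposes it.\<close>
  define t where "t = sum l I"
  have lx: "l x = 1 - t" using insert.prems insert.hyps by (simp add: t_def)
  have t: "0 < t" unfolding t_def using insert by (intro sum_pos) auto
  have t1: "t < 1" using insert.prems(3)[of x] lx by simp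
  define k where "k i = l i / t" for i
  have IH: "0 < vol (body (\<lambda>u. \<Sum>i\<in>I. k i * H i u)) \<and>
    (\<Sum>i\<in>I. k i * ln (vol (body (H i)))) \<le> ln (vol (body (\<lambda>u. \<Sum>i\<in>I. k i * H i u)))"
    by (rule insert.IH) (use insert t in \<open>auto simp: k_def sum_divide_distrib[symmetric] t_def\<close>)
  have sl: "sublin (\<lambda>u. \<Sum>i\<in>I. k i * H i u)"
    using insert t by (intro sublin_sum sublin_cmult) (auto simp: k_def less_imp_le)
  have eq: "(\<lambda>u. \<Sum>i\<in>insert x I. l i * H i u) = (\<lambda>u. t * (\<Sum>i\<in>I. k i * H i u) + (1 - t) * H x u)"
    using insert.hyps t by (auto simp: lx k_def sum_distrib_left)
  have "(\<Sum>i\<in>insert x I. l i * ln (vol (body (H i)))) =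
     t * (\<Sum>i\<in>I. k i * ln (vol (body (H i)))) + (1 - t) * ln (vol (body (H x)))"
    using insert.hyps t by (auto simp: lx k_def sum_distrib_left)
  also have "\<dots> \<le> t * ln (vol (body (\<lambda>u. \<Sum>i\<in>I. k i * H i u))) + (1 - t) * ln (vol (body (H x)))"
    using IH t by (intro add_right_mono mult_left_mono) auto
  also have "\<dots> \<le> ln (vol (body (\<lambda>u. \<Sum>i\<in>insert x I. l i * H i u)))"
    unfolding eq by (rule brunn_minkowski_body(2)) (use sl IH insert t t1 in auto)
  finally show ?case
    unfolding eq using brunn_minkowski_body(1)[OF sl _ _ _ t t1, of "H x"] IH insert by auto
qed

section \<open>Minkowski integrals against harmonic measure\<close>

lemma compact_set_plus:
  fixes S T :: "'a::euclidean_space set"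
  assumes "compact S" "compact T" shows "compact (S + T)"
proof -
  have "S + T = {x + y | x y. x \<in> S \<and> y \<in> T}" by (auto simp: set_plus_def)
  then show ?thesis using compact_sums[OF assms] by simp
qed

lemma supp_set_plus:
  fixes S T :: "'a::euclidean_space set"
  assumes S: "compact S" "S \<noteq> {}" and T: "compact T" "T \<noteq> {}"
  shows "support_fun (S + T) u = support_fun S u + support_fun T u"
proof (rule antisym)
  note up = supp_upper[OF compact_imp_bounded[OF compact_set_plus[OF S(1) T(1)]]]
  have "S + T \<noteq> {}" using S T by (auto simp: set_plus_def)
  then show "support_fun (S + T) u \<le> support_fun S u + support_fun T u"
    by (rule supp_least) (auto simp: inner_add_left elim!: set_plus_elim
        intro!: add_mono supp_upper compact_imp_bounded S T)
  obtain a where "a \<in> S" "support_fun S u = a \<bullet> u" by (rule supp_attained[OF S])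
  moreover obtain b where "b \<in> T" "support_fun T u = b \<bullet> u" by (rule supp_attained[OF T])
  ultimately show "support_fun S u + support_fun T u \<le> support_fun (S + T) u"
    using up[of "a + b" u] by (auto simp: inner_add_left)
qed

lemma minkowski_sum_props:
  fixes S :: "'i \<Rightarrow> 'a::euclidean_space set"
  assumes "finite P" "\<And>E. E \<in> P \<Longrightarrow> compact (S E) \<and> convex (S E) \<and> S E \<noteq> {}"
  shows "compact (\<Sum>E\<in>P. S E) \<and> convex (\<Sum>E\<in>P. S E) \<and> (\<Sum>E\<in>P. S E) \<noteq> {} \<and>
    (\<forall>u. support_fun (\<Sum>E\<in>P. S E) u = (\<Sum>E\<in>P. support_fun (S E) u))"
  using assms
proof (induction P rule: finite_induct)
  case empty
  have "support_fun {0::'a} u = 0" for u by (simp add: support_fun_def)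
  then show ?case by (simp add: set_zero)
next
  case (insert E P)
  then have E: "compact (S E)" "convex (S E)" "S E \<noteq> {}"
    and P: "compact (sum S P)" "convex (sum S P)" "sum S P \<noteq> {}" "\<And>u. support_fun (sum S P) u = (\<Sum>E\<in>P. support_fun (S E) u)"
    by auto
  have "S E + sum S P \<noteq> {}" using E(3) P(3) by (auto simp: set_plus_def)
  then show ?case
    using insert.hyps compact_set_plus[OF E(1) P(1)] convex_set_plus[OF E(2) P(2)] supp_set_plus[OF E(1,3) P(1,3)] P(4)
    by simp
qed

lemma supp_scaleR:
  fixes S :: "'a::euclidean_space set"
  assumes "compact S" "S \<noteq> {}" "c \<ge> 0" shows "support_fun ((\<lambda>y. c *\<^sub>R y) ` S) u = c * support_fun S u"
proof -
  have "support_fun ((\<lambda>y. c *\<^sub>R y) ` S) u = support_fun S (c *\<^sub>R u)" by (simp add: support_fun_def image_image)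
  also have "\<dots> = c * support_fun S u" using sublin_supp[OF assms(1,2)] assms(3) by (auto simp: sublin_def)
  finally show ?thesis .
qed

text \<open>Turns a cover by small measurable sets into a partition. Empty pieces are discarded
  because every piece must contain its tag.\<close>

lemma finite_disjoint_refinement:
  assumes "finite B" "B \<subseteq> sets M"
  shows "\<exists>P. finite P \<and> P \<subseteq> sets M \<and> disjoint P \<and> \<Union>P = \<Union>B \<and> (\<forall>E\<in>P. E \<noteq> {} \<and> (\<exists>X\<in>B. E \<subseteq> X))"
  using assms
proof (induction B rule: finite_induct)
  case empty
  show ?case by (rule exI[of _ "{}"]) auto
next
  case (insert X B)
  then obtain P where P: "finite P" "P \<subseteq> sets M" "disjoint P" "\<Union>P = \<Union>B" "\<forall>E\<in>P. E \<noteq> {} \<and> (\<exists>X\<in>B. E \<subseteq> X)" by auto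
  have m: "X - \<Union>P \<in> sets M" using P(1,2) insert.prems by (intro sets.Diff sets.finite_Union) auto
  show ?case
  proof (cases "X - \<Union>P = {}")
    case True
    then show ?thesis using P by (intro exI[of _ P]) auto
  next
    case False
    have "disjoint (insert (X - \<Union>P) P)"
      using P(3) by (auto simp: pairwise_insert disjnt_def)
    then show ?thesis using P False m by (intro exI[of _ "insert (X - \<Union>P) P"]) auto
  qed
qed

locale interp_setting =
  fixes \<Omega> :: "(real^'n) set"
    and A :: "real^'n \<Rightarrow> (real^'m) set"
    and \<omega> :: "real^'n \<Rightarrow> (real^'n) measure"
  assumes op: "open \<Omega>" and bd: "bounded \<Omega>"
    and A: "\<And>\<tau>. \<tau> \<in> frontier \<Omega> \<Longrightarrow> A \<tau> \<noteq> {} \<and> compact (A \<tau>) \<and> convex (A \<tau>)"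
    and A_cont: "\<And>\<tau>. \<tau> \<in> frontier \<Omega> \<Longrightarrow>
           ((\<lambda>\<sigma>. hausdorff_dist (A \<sigma>) (A \<tau>)) \<longlongrightarrow> 0) (at \<tau> within frontier \<Omega>)"
    and hm: "harmonic_measure \<Omega> \<omega>"
begin

abbreviation "\<Gamma> \<equiv> frontier \<Omega>"

definition h :: "real^'n \<Rightarrow> real^'m \<Rightarrow> real" where "h \<tau> u = support_fun (A \<tau>) u"

definition H :: "real^'n \<Rightarrow> real^'m \<Rightarrow> real" where "H x u = (\<integral>\<tau>. h \<tau> u \<partial>\<omega> x)"

section \<open>Support functions of the boundary sets\<close>

lemma compact_frontier: "compact \<Gamma>"
  using bd by (simp add: compact_frontier_bounded)

lemma prob: "x \<in> \<Omega> \<Longrightarrow> prob_space (\<omega> x)"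
  and sets_\<omega>: "x \<in> \<Omega> \<Longrightarrow> sets (\<omega> x) = sets (restrict_space borel \<Gamma>)"
  using hm by (auto simp: harmonic_measure_def)

lemma space_\<omega>: "x \<in> \<Omega> \<Longrightarrow> space (\<omega> x) = \<Gamma>"
  using sets_eq_imp_space_eq[OF sets_\<omega>] by (simp add: space_restrict_space)

lemma sublin_h: "\<tau> \<in> \<Gamma> \<Longrightarrow> sublin (h \<tau>)"
  unfolding h_def using A by (auto intro: sublin_supp)

lemma hausdorff_h:
  assumes "\<sigma> \<in> \<Gamma>" "\<tau> \<in> \<Gamma>"
  shows "\<bar>h \<sigma> u - h \<tau> u\<bar> \<le> hausdorff_dist (A \<sigma>) (A \<tau>) * norm u"
  using supp_le_hausdorff[of "A \<sigma>" "A \<tau>" u] supp_le_hausdorff[of "A \<tau>" "A \<sigma>" u] A[OF assms(1)] A[OF assms(2)]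
  unfolding h_def by (auto simp: hausdorff_dist_commute[of "A \<tau>" "A \<sigma>"] abs_le_iff)

text \<open>Hausdorff continuity is given point by point; compactness of the boundary makes it
  uniform. The error is proportional to \<open>norm u\<close>, so a single \<open>d\<close> serves
  all directions.\<close>

lemma h_uniform:
  assumes e: "e > 0"
  obtains d where "d > 0" "\<And>\<sigma> \<tau> u. \<sigma> \<in> \<Gamma> \<Longrightarrow> \<tau> \<in> \<Gamma> \<Longrightarrow> dist \<sigma> \<tau> < d \<Longrightarrow> \<bar>h \<sigma> u - h \<tau> u\<bar> \<le> e * norm u"
proof -
  have "\<exists>d>0. \<forall>\<sigma>\<in>\<Gamma>. dist \<sigma> \<tau> < d \<longrightarrow> (\<forall>u. \<bar>h \<sigma> u - h \<tau> u\<bar> \<le> e / 2 * norm u)" if \<tau>: "\<tau> \<in> \<Gamma>" for \<tau>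
  proof -
    from tendstoD[OF A_cont[OF \<tau>], of "e/2"] e
    obtain d where d: "d > 0" "\<And>\<sigma>. \<sigma> \<in> \<Gamma> \<Longrightarrow> \<sigma> \<noteq> \<tau> \<Longrightarrow> dist \<sigma> \<tau> < d \<Longrightarrow> \<bar>hausdorff_dist (A \<sigma>) (A \<tau>)\<bar> < e/2"
      unfolding eventually_at by (auto simp: dist_real_def)
    have "\<bar>h \<sigma> u - h \<tau> u\<bar> \<le> e / 2 * norm u" if "\<sigma> \<in> \<Gamma>" "dist \<sigma> \<tau> < d" for \<sigma> u
    proof (cases "\<sigma> = \<tau>")
      case False
      have "\<bar>h \<sigma> u - h \<tau> u\<bar> \<le> hausdorff_dist (A \<sigma>) (A \<tau>) * norm u" by (rule hausdorff_h[OF that(1) \<tau>])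
      also have "\<dots> \<le> e / 2 * norm u" using d(2)[OF that(1) False that(2)] by (intro mult_right_mono) auto
      finally show ?thesis .
    qed (use e in auto)
    with d(1) show ?thesis by blast
  qed
  then obtain D where D: "\<And>\<tau>. \<tau> \<in> \<Gamma> \<Longrightarrow> D \<tau> > 0"
    "\<And>\<tau> \<sigma> u. \<tau> \<in> \<Gamma> \<Longrightarrow> \<sigma> \<in> \<Gamma> \<Longrightarrow> dist \<sigma> \<tau> < D \<tau> \<Longrightarrow> \<bar>h \<sigma> u - h \<tau> u\<bar> \<le> e / 2 * norm u"
    by metis
  have "\<Gamma> \<subseteq> \<Union>((\<lambda>\<tau>. ball \<tau> (D \<tau>)) ` \<Gamma>)" using D(1) by force
  \<comment> \<open>A Lebesgue number of the cover: points at distance less than \<open>d\<close>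
    share a ball about some \<open>\<rho>\<close>, and each is compared with \<open>\<rho>\<close>
    at cost \<open>e / 2\<close>.\<close>
  from Heine_Borel_lemma[OF compact_frontier this]
  obtain d where d: "d > 0" "\<And>\<sigma>. \<sigma> \<in> \<Gamma> \<Longrightarrow> \<exists>G\<in>(\<lambda>\<tau>. ball \<tau> (D \<tau>)) ` \<Gamma>. ball \<sigma> d \<subseteq> G" by blast
  show thesis
  proof (rule that[OF d(1)])
    fix \<sigma> \<tau> u assume st: "\<sigma> \<in> \<Gamma>" "\<tau> \<in> \<Gamma>" "dist \<sigma> \<tau> < d"
    obtain \<rho> where \<rho>: "\<rho> \<in> \<Gamma>" "ball \<sigma> d \<subseteq> ball \<rho> (D \<rho>)" using d(2)[OF st(1)] by blast
    have "\<sigma> \<in> ball \<rho> (D \<rho>)" "\<tau> \<in> ball \<rho> (D \<rho>)" using \<rho>(2) st(3) d(1) by (auto simp: subset_iff)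
    then have "\<bar>h \<sigma> u - h \<rho> u\<bar> \<le> e / 2 * norm u" "\<bar>h \<tau> u - h \<rho> u\<bar> \<le> e / 2 * norm u"
      using D(2) \<rho>(1) st by (auto simp: dist_commute)
    moreover have "e / 2 * norm u + e / 2 * norm u = e * norm u" by (simp add: field_simps)
    ultimately show "\<bar>h \<sigma> u - h \<tau> u\<bar> \<le> e * norm u" by linarith
  qed
qed

lemma h_continuous: "continuous_on \<Gamma> (\<lambda>\<tau>. h \<tau> u)"
  unfolding continuous_on_iff
proof (intro ballI allI impI)
  fix \<tau> and e :: real assume \<tau>: "\<tau> \<in> \<Gamma>" and e: "e > 0"
  have p: "norm u + 1 > 0" by (simp add: add_nonneg_pos)
  then have "e / (norm u + 1) > 0" using e by simp
  then obtain d where d: "d > 0" "\<And>\<sigma> \<tau> v. \<sigma> \<in> \<Gamma> \<Longrightarrow> \<tau> \<in> \<Gamma> \<Longrightarrow> dist \<sigma> \<tau> < d \<Longrightarrow> \<bar>h \<sigma> v - h \<tau> v\<bar> \<le> e / (norm u + 1) * norm v"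
    using h_uniform by metis
  have "e / (norm u + 1) * norm u < e" using e p by (simp add: field_simps)
  then show "\<exists>d>0. \<forall>\<sigma>\<in>\<Gamma>. dist \<sigma> \<tau> < d \<longrightarrow> dist (h \<sigma> u) (h \<tau> u) < e"
    using d \<tau> by (intro exI[of _ d]) (auto simp: dist_real_def intro: le_less_trans)
qed

lemma frontier_net:
  assumes "d > 0" obtains T where "finite T" "T \<subseteq> \<Gamma>" "\<And>\<tau>. \<tau> \<in> \<Gamma> \<Longrightarrow> \<exists>t\<in>T. dist \<tau> t < d"
proof -
  have "\<Gamma> \<subseteq> (\<Union>t\<in>\<Gamma>. ball t d)" using assms by auto
  then obtain T where "T \<subseteq> \<Gamma>" "finite T" "\<Gamma> \<subseteq> (\<Union>t\<in>T. ball t d)"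
    using compactE_image[OF compact_frontier, of \<Gamma> "\<lambda>t. ball t d"] by auto
  with that show thesis by (auto simp: dist_commute subset_iff)
qed

lemma h_bound: obtains C where "C \<ge> 0" "\<And>\<tau> u. \<tau> \<in> \<Gamma> \<Longrightarrow> \<bar>h \<tau> u\<bar> \<le> C * norm u"
proof -
  obtain d where d: "d > 0" "\<And>\<sigma> \<tau> u. \<sigma> \<in> \<Gamma> \<Longrightarrow> \<tau> \<in> \<Gamma> \<Longrightarrow> dist \<sigma> \<tau> < d \<Longrightarrow> \<bar>h \<sigma> u - h \<tau> u\<bar> \<le> 1 * norm u"
    using h_uniform[of 1] by auto
  obtain T where T: "finite T" "T \<subseteq> \<Gamma>" "\<And>\<tau>. \<tau> \<in> \<Gamma> \<Longrightarrow> \<exists>t\<in>T. dist \<tau> t < d" using frontier_net[OF d(1)] by metis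
  have "\<forall>t\<in>T. \<exists>C. \<forall>u. \<bar>h t u\<bar> \<le> C * norm u" using sublin_h T(2) unfolding sublin_def by blast
  then obtain C where C: "\<And>t u. t \<in> T \<Longrightarrow> \<bar>h t u\<bar> \<le> C t * norm u" by metis
  show thesis
  proof (rule that[of "(\<Sum>t\<in>T. \<bar>C t\<bar>) + 1"])
    show "(\<Sum>t\<in>T. \<bar>C t\<bar>) + 1 \<ge> 0" by (intro add_nonneg_nonneg sum_nonneg) auto
    fix \<tau> and u :: "real^'m" assume \<tau>: "\<tau> \<in> \<Gamma>"
    then obtain t where t: "t \<in> T" "dist \<tau> t < d" using T(3) by blast
    have "C t \<le> \<bar>C t\<bar>" by simp
    also have "\<dots> \<le> (\<Sum>t\<in>T. \<bar>C t\<bar>)" using t(1) T(1) by (intro member_le_sum) auto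
    finally have "C t * norm u \<le> (\<Sum>t\<in>T. \<bar>C t\<bar>) * norm u" by (intro mult_right_mono) auto
    moreover have "\<bar>h \<tau> u - h t u\<bar> \<le> 1 * norm u" using d(2) \<tau> t T(2) by blast
    ultimately show "\<bar>h \<tau> u\<bar> \<le> ((\<Sum>t\<in>T. \<bar>C t\<bar>) + 1) * norm u"
      using C[OF t(1), of u] by (simp add: distrib_right)
  qed
qed

section \<open>Integration against harmonic measure\<close>

lemma measurable_cont:
  fixes g :: "real^'n \<Rightarrow> real"
  assumes "x \<in> \<Omega>" "continuous_on \<Gamma> g" shows "g \<in> borel_measurable (\<omega> x)"
  using borel_measurable_continuous_on_restrict[OF assms(2)] measurable_cong_sets[OF sets_\<omega>[OF assms(1)] refl] by blast

lemma integrable_cont: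
  fixes g :: "real^'n \<Rightarrow> real"
  assumes x: "x \<in> \<Omega>" and g: "continuous_on \<Gamma> g" shows "integrable (\<omega> x) g"
proof -
  interpret prob_space "\<omega> x" by (rule prob[OF x])
  obtain B where "\<And>\<tau>. \<tau> \<in> \<Gamma> \<Longrightarrow> norm (g \<tau>) \<le> B"
    using compact_imp_bounded[OF compact_continuous_image[OF g compact_frontier]] by (auto simp: bounded_iff)
  then show ?thesis
    by (intro integrable_const_bound[of _ B] measurable_cont x g) (auto simp: space_\<omega>[OF x])
qed

lemma integral_abs_bound_le:
  fixes g :: "real^'n \<Rightarrow> real"
  assumes x: "x \<in> \<Omega>" and g: "integrable (\<omega> x) g" and b: "\<And>\<tau>. \<tau> \<in> \<Gamma> \<Longrightarrow> \<bar>g \<tau>\<bar> \<le> B"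
  shows "\<bar>\<integral>\<tau>. g \<tau> \<partial>\<omega> x\<bar> \<le> B"
proof -
  interpret prob_space "\<omega> x" by (rule prob[OF x])
  have "\<bar>\<integral>\<tau>. g \<tau> \<partial>\<omega> x\<bar> \<le> (\<integral>\<tau>. \<bar>g \<tau>\<bar> \<partial>\<omega> x)" by (rule integral_abs_bound)
  also have "\<dots> \<le> (\<integral>\<tau>. B \<partial>\<omega> x)" by (rule integral_mono) (use g b in \<open>auto simp: space_\<omega>[OF x]\<close>)
  finally show ?thesis by (simp add: prob_space)
qed

lemma integrable_h: "x \<in> \<Omega> \<Longrightarrow> integrable (\<omega> x) (\<lambda>\<tau>. h \<tau> u)"
  by (intro integrable_cont h_continuous)

lemma H_bound: obtains C where "C \<ge> 0" "\<And>x u. x \<in> \<Omega> \<Longrightarrow> \<bar>H x u\<bar> \<le> C * norm u"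
  using h_bound integral_abs_bound_le[OF _ integrable_h] unfolding H_def by metis

lemma sublin_H:
  assumes x: "x \<in> \<Omega>" shows "sublin (H x)"
  unfolding sublin_def
proof (intro conjI allI impI)
  fix u v
  have "(\<integral>\<tau>. h \<tau> (u + v) \<partial>\<omega> x) \<le> (\<integral>\<tau>. h \<tau> u + h \<tau> v \<partial>\<omega> x)"
    using sublin_h by (intro integral_mono integrable_h x Bochner_Integration.integrable_add)
      (auto simp: space_\<omega>[OF x] sublin_def)
  then show "H x (u + v) \<le> H x u + H x v" by (simp add: H_def integrable_h[OF x])
next
  fix c :: real and u assume "c \<ge> 0"
  then have "(\<integral>\<tau>. h \<tau> (c *\<^sub>R u) \<partial>\<omega> x) = (\<integral>\<tau>. c * h \<tau> u \<partial>\<omega> x)"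
    using sublin_h by (intro Bochner_Integration.integral_cong) (auto simp: space_\<omega>[OF x] sublin_def)
  then show "H x (c *\<^sub>R u) = c * H x u" by (simp add: H_def)
next
  show "\<exists>C. \<forall>u. \<bar>H x u\<bar> \<le> C * norm u" using H_bound x by metis
qed

text \<open>Serves both the indicators of a tagged partition and a continuous partition of unity. As
  the weights sum to 1 they can be inserted into the integral for \<open>H\<close>, and
  \<open>h (t i)\<close> is compared with \<open>h \<tau>\<close> only where the weight is
  nonzero.\<close>

lemma weighted_h_approx:
  assumes x: "x \<in> \<Omega>" and I: "finite I" and t: "\<And>i. i \<in> I \<Longrightarrow> t i \<in> \<Gamma>"
    and w: "\<And>i. i \<in> I \<Longrightarrow> integrable (\<omega> x) (w i)" "\<And>i \<tau>. i \<in> I \<Longrightarrow> \<tau> \<in> \<Gamma> \<Longrightarrow> 0 \<le> w i \<tau>"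
      "\<And>\<tau>. \<tau> \<in> \<Gamma> \<Longrightarrow> (\<Sum>i\<in>I. w i \<tau>) = 1"
      "\<And>i \<tau>. i \<in> I \<Longrightarrow> \<tau> \<in> \<Gamma> \<Longrightarrow> w i \<tau> \<noteq> 0 \<Longrightarrow> \<bar>h (t i) u - h \<tau> u\<bar> \<le> e"
    and wh: "\<And>i. i \<in> I \<Longrightarrow> integrable (\<omega> x) (\<lambda>\<tau>. w i \<tau> * h \<tau> u)"
  shows "\<bar>(\<Sum>i\<in>I. (\<integral>\<tau>. w i \<tau> \<partial>\<omega> x) * h (t i) u) - H x u\<bar> \<le> e"
proof -
  have int: "integrable (\<omega> x) (\<lambda>\<tau>. \<Sum>i\<in>I. w i \<tau> * (h (t i) u - h \<tau> u))"
    using w(1) wh by (auto simp: right_diff_distrib)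
  have "H x u = (\<integral>\<tau>. (\<Sum>i\<in>I. w i \<tau> * h \<tau> u) \<partial>\<omega> x)"
    unfolding H_def by (rule Bochner_Integration.integral_cong)
      (auto simp: space_\<omega>[OF x] w(3) sum_distrib_right[symmetric])
  also have "\<dots> = (\<Sum>i\<in>I. \<integral>\<tau>. w i \<tau> * h \<tau> u \<partial>\<omega> x)" using wh by (rule Bochner_Integration.integral_sum)
  finally have "(\<Sum>i\<in>I. (\<integral>\<tau>. w i \<tau> \<partial>\<omega> x) * h (t i) u) - H x u =
     (\<Sum>i\<in>I. \<integral>\<tau>. w i \<tau> * (h (t i) u - h \<tau> u) \<partial>\<omega> x)"
    using w(1) wh by (simp add: right_diff_distrib sum_subtractf)
  also have "\<dots> = (\<integral>\<tau>. (\<Sum>i\<in>I. w i \<tau> * (h (t i) u - h \<tau> u)) \<partial>\<omega> x)"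
    using w(1) wh by (intro Bochner_Integration.integral_sum[symmetric]) (auto simp: right_diff_distrib)
  finally have eq: "(\<Sum>i\<in>I. (\<integral>\<tau>. w i \<tau> \<partial>\<omega> x) * h (t i) u) - H x u =
     (\<integral>\<tau>. (\<Sum>i\<in>I. w i \<tau> * (h (t i) u - h \<tau> u)) \<partial>\<omega> x)" .
  show ?thesis unfolding eq
  proof (rule integral_abs_bound_le[OF x int])
    fix \<tau> assume \<tau>: "\<tau> \<in> \<Gamma>"
    have "\<bar>\<Sum>i\<in>I. w i \<tau> * (h (t i) u - h \<tau> u)\<bar> \<le> (\<Sum>i\<in>I. w i \<tau> * e)"
    proof (rule order_trans[OF sum_abs sum_mono])
      fix i assume i: "i \<in> I"
      show "\<bar>w i \<tau> * (h (t i) u - h \<tau> u)\<bar> \<le> w i \<tau> * e"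
        using w(2)[OF i \<tau>] w(4)[OF i \<tau>] by (cases "w i \<tau> = 0") (auto simp: abs_mult intro: mult_left_mono)
    qed
    also have "\<dots> = e" using w(3)[OF \<tau>] by (simp add: sum_distrib_right[symmetric])
    finally show "\<bar>\<Sum>i\<in>I. w i \<tau> * (h (t i) u - h \<tau> u)\<bar> \<le> e" .
  qed
qed

lemma riemann_sum_props:
  assumes x: "x \<in> \<Omega>" and P: "tagged_partition (\<omega> x) d P t"
  shows "compact (riemann_sum (\<omega> x) A P t) \<and> convex (riemann_sum (\<omega> x) A P t) \<and> riemann_sum (\<omega> x) A P t \<noteq> {} \<and>
    (\<forall>u. support_fun (riemann_sum (\<omega> x) A P t) u = (\<Sum>E\<in>P. measure (\<omega> x) E * h (t E) u))"
proof -
  have t: "t E \<in> \<Gamma>" if "E \<in> P" for E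
  proof -
    have "E \<in> sets (\<omega> x)" "t E \<in> E" using P that by (auto simp: tagged_partition_def)
    then show "t E \<in> \<Gamma>" using sets.sets_into_space[of E "\<omega> x"] by (auto simp: space_\<omega>[OF x])
  qed
  have f: "finite P" using P by (auto simp: tagged_partition_def)
  let ?S = "\<lambda>E. (\<lambda>y. measure (\<omega> x) E *\<^sub>R y) ` A (t E)"
  have "compact (?S E) \<and> convex (?S E) \<and> ?S E \<noteq> {}" if "E \<in> P" for E
    using A[OF t[OF that]] by (auto intro: compact_scaling convex_scaling)
  from minkowski_sum_props[OF f this]
  show ?thesis unfolding riemann_sum_def using A t by (auto simp: supp_scaleR h_def intro!: sum.cong)
qed

lemma riemann_sum_approx:
  assumes x: "x \<in> \<Omega>" and e: "e > 0"
  obtains d where "d > 0" "\<And>P t. tagged_partition (\<omega> x) d P t \<Longrightarrow>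
     hausdorff_dist (riemann_sum (\<omega> x) A P t) (body (H x)) \<le> e"
proof -
  obtain d where d: "d > 0" "\<And>\<sigma> \<tau> u. \<sigma> \<in> \<Gamma> \<Longrightarrow> \<tau> \<in> \<Gamma> \<Longrightarrow> dist \<sigma> \<tau> < d \<Longrightarrow> \<bar>h \<sigma> u - h \<tau> u\<bar> \<le> e * norm u"
    using h_uniform[OF e] by blast
  interpret prob_space "\<omega> x" by (rule prob[OF x])
  show thesis
  proof (rule that[OF d(1)])
    fix P t assume P: "tagged_partition (\<omega> x) d P t"
    then have P': "finite P" "P \<subseteq> sets (\<omega> x)" "disjoint P" "\<Union>P = \<Gamma>" "\<And>E. E \<in> P \<Longrightarrow> t E \<in> E"
      "\<And>E. E \<in> P \<Longrightarrow> diameter E < d"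
      by (auto simp: tagged_partition_def space_\<omega>[OF x])
    note R = riemann_sum_props[OF x P]
    show "hausdorff_dist (riemann_sum (\<omega> x) A P t) (body (H x)) \<le> e"
    proof (rule hausdorff_dist_le_supp)
      fix u :: "real^'m" assume u: "norm u = 1"
      have "\<bar>(\<Sum>E\<in>P. (\<integral>\<tau>. indicator E \<tau> \<partial>\<omega> x) * h (t E) u) - H x u\<bar> \<le> e"
      proof (rule weighted_h_approx[OF x P'(1)])
        show "t E \<in> \<Gamma>" if "E \<in> P" for E using that P' by auto
        show "integrable (\<omega> x) (indicator E :: _ \<Rightarrow> real)" if "E \<in> P" for E
          using that P'(2) by (auto intro: integrable_real_indicator simp: emeasure_eq_measure)
        show "integrable (\<omega> x) (\<lambda>\<tau>. indicator E \<tau> * h \<tau> u)" if "E \<in> P" for E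
          using integrable_mult_indicator[OF _ integrable_h[OF x], of E u] that P'(2) by auto
        show "(\<Sum>E\<in>P. indicator E \<tau>) = (1::real)" if \<tau>: "\<tau> \<in> \<Gamma>" for \<tau>
        proof -
          obtain E where E: "E \<in> P" "\<tau> \<in> E" using P'(4) \<tau> by blast
          have "(\<Sum>F\<in>P. indicator F \<tau>) = (\<Sum>F\<in>P. if F = E then (1::real) else 0)"
            using P'(3) E by (intro sum.cong) (auto simp: indicator_def disjoint_def)
          then show ?thesis using E P'(1) by simp
        qed
        fix E \<tau> assume E: "E \<in> P" and \<tau>: "\<tau> \<in> \<Gamma>"
        show "0 \<le> (indicator E \<tau> :: real)" by simp
        assume "indicator E \<tau> \<noteq> (0::real)"
        then have "\<tau> \<in> E" by (auto simp: indicator_def split: if_splits)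
        moreover have "bounded E" using E P'(4) compact_imp_bounded[OF compact_frontier] by (metis Union_upper bounded_subset)
        ultimately have "dist (t E) \<tau> \<le> diameter E" using P'(5)[OF E] by (intro diameter_bounded_bound)
        then have "dist (t E) \<tau> < d" using P'(6)[OF E] by simp
        then show "\<bar>h (t E) u - h \<tau> u\<bar> \<le> e" using d(2)[of "t E" \<tau> u] P' E \<tau> u by auto
      qed
      then show "\<bar>support_fun (riemann_sum (\<omega> x) A P t) u - support_fun (body (H x)) u\<bar> \<le> e"
        using R P'(2) by (simp add: supp_body[OF sublin_H[OF x]] subset_iff cong: sum.cong)
    qed (use R e sublin_compact_body[OF sublin_H[OF x]] convex_body body_nonempty[OF sublin_H[OF x]] in auto)
  qed
qed

text \<open>Without arbitrarily fine partitions the limit condition of the Minkowski integral would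
  be vacuous and could not determine its value.\<close>

lemma tagged_partition_exists:
  assumes x: "x \<in> \<Omega>" and d: "d > 0"
  shows "\<exists>P t. tagged_partition (\<omega> x) d P t"
proof -
  \<comment> \<open>Radius \<open>d/3\<close> bounds diameters by \<open>2 * (d/3)\<close>, strictly
    less than \<open>d\<close> as a tagged partition demands.\<close>
  obtain T where T: "finite T" "T \<subseteq> \<Gamma>" "\<And>\<tau>. \<tau> \<in> \<Gamma> \<Longrightarrow> \<exists>t\<in>T. dist \<tau> t < d/3"
    using frontier_net[of "d/3"] d by auto
  define B where "B = (\<lambda>t. ball t (d/3) \<inter> \<Gamma>) ` T"
  have B: "finite B" "B \<subseteq> sets (\<omega> x)" unfolding B_def sets_\<omega>[OF x] sets_restrict_space using T by auto
  have UB: "\<Union>B = \<Gamma>" unfolding B_def using T by (auto simp: dist_commute)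
  obtain P where P: "finite P" "P \<subseteq> sets (\<omega> x)" "disjoint P" "\<Union>P = \<Union>B" "\<forall>E\<in>P. E \<noteq> {} \<and> (\<exists>X\<in>B. E \<subseteq> X)"
    using finite_disjoint_refinement[OF B] by blast
  have "diameter E < d" if E: "E \<in> P" for E
  proof -
    obtain t where t: "E \<subseteq> ball t (d/3)" using P(5) E unfolding B_def by blast
    have "diameter E \<le> diameter (ball t (d/3))" by (rule diameter_subset[OF t]) simp
    also have "\<dots> = 2 * (d/3)" using d by (simp add: diameter_ball)
    finally show ?thesis using d by simp
  qed
  then have "tagged_partition (\<omega> x) d P (\<lambda>E. SOME \<tau>. \<tau> \<in> E)"
    unfolding tagged_partition_def using P UB by (auto simp: space_\<omega>[OF x] some_in_eq)
  then show ?thesis by blast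
qed

theorem harmonic_interpolation_eq_body:
  assumes x: "x \<in> \<Omega>" shows "harmonic_interpolation \<omega> A x = body (H x)"
  unfolding harmonic_interpolation_def minkowski_integral_def
proof (rule the_equality)
  let ?K = "body (H x)"
  have K: "compact ?K" "?K \<noteq> {}" using sublin_compact_body[OF sublin_H[OF x]] body_nonempty[OF sublin_H[OF x]] by auto
  show hK: "has_minkowski_integral (\<omega> x) A ?K"
    unfolding has_minkowski_integral_def
  proof (intro conjI K allI impI)
    fix e :: real assume "e > 0"
    then obtain d where "d > 0" "\<And>P t. tagged_partition (\<omega> x) d P t \<Longrightarrow>
       hausdorff_dist (riemann_sum (\<omega> x) A P t) (body (H x)) \<le> e/2" using riemann_sum_approx[OF x, of "e/2"] by auto
    with \<open>e > 0\<close> show "\<exists>d>0. \<forall>P t. tagged_partition (\<omega> x) d P t \<longrightarrow> hausdorff_dist (riemann_sum (\<omega> x) A P t) ?K < e"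
      by (intro exI[of _ d]) force
  qed
  fix L assume L: "has_minkowski_integral (\<omega> x) A L"
  have R: "\<exists>R. compact R \<and> R \<noteq> {} \<and> hausdorff_dist R ?K < e \<and> hausdorff_dist R L < e" if e: "e > 0" for e
  proof -
    obtain d1 where d1: "d1 > 0" "\<And>P t. tagged_partition (\<omega> x) d1 P t \<Longrightarrow> hausdorff_dist (riemann_sum (\<omega> x) A P t) ?K < e"
      using hK e unfolding has_minkowski_integral_def by blast
    obtain d2 where d2: "d2 > 0" "\<And>P t. tagged_partition (\<omega> x) d2 P t \<Longrightarrow> hausdorff_dist (riemann_sum (\<omega> x) A P t) L < e"
      using L e unfolding has_minkowski_integral_def by blast
    obtain P t where P: "tagged_partition (\<omega> x) (min d1 d2) P t"
      using tagged_partition_exists[OF x, of "min d1 d2"] d1 d2 by auto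
    then have "tagged_partition (\<omega> x) d1 P t" "tagged_partition (\<omega> x) d2 P t" by (auto simp: tagged_partition_def)
    then show ?thesis using riemann_sum_props[OF x P] d1(2) d2(2) by blast
  qed
  have "compact L" "L \<noteq> {}" using L by (auto simp: has_minkowski_integral_def)
  then show "L = ?K"
    using hausdorff_limit_unique[OF K, of L] hausdorff_limit_unique[OF _ _ K, of L] R by (metis subset_antisym)
qed

lemma harmonic_integral:
  assumes "continuous_on \<Gamma> g"
  shows "harmonic_on \<Omega> (\<lambda>x. \<integral>\<tau>. g \<tau> \<partial>\<omega> x)"
    and "\<tau> \<in> \<Gamma> \<Longrightarrow> ((\<lambda>x. \<integral>\<sigma>. g \<sigma> \<partial>\<omega> x) \<longlongrightarrow> g \<tau>) (at \<tau> within \<Omega>)"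
  using hm assms by (auto simp: harmonic_measure_def)

section \<open>Approximation by finitely many harmonic coefficients\<close>

lemma partition_of_unity:
  assumes d: "d > 0"
  obtains T \<psi> where "finite T" "T \<subseteq> \<Gamma>" "\<And>t. t \<in> T \<Longrightarrow> continuous_on \<Gamma> (\<psi> t)"
    "\<And>t \<tau>. t \<in> T \<Longrightarrow> \<tau> \<in> \<Gamma> \<Longrightarrow> (0::real) \<le> \<psi> t \<tau>" "\<And>\<tau>. \<tau> \<in> \<Gamma> \<Longrightarrow> (\<Sum>t\<in>T. \<psi> t \<tau>) = 1"
    "\<And>t \<tau>. t \<in> T \<Longrightarrow> \<tau> \<in> \<Gamma> \<Longrightarrow> \<psi> t \<tau> \<noteq> 0 \<Longrightarrow> dist \<tau> t < d"
proof -
  obtain T where T: "finite T" "T \<subseteq> \<Gamma>" "\<And>\<tau>. \<tau> \<in> \<Gamma> \<Longrightarrow> \<exists>t\<in>T. dist \<tau> t < d" using frontier_net[OF d] by metis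
  define f where "f t \<tau> = max 0 (d - dist \<tau> t)" for t \<tau> :: "real^'n"
  have pos: "(\<Sum>t\<in>T. f t \<tau>) > 0" if \<tau>: "\<tau> \<in> \<Gamma>" for \<tau>
  proof -
    obtain t where "t \<in> T" "dist \<tau> t < d" using T(3)[OF \<tau>] by blast
    then show ?thesis by (intro sum_pos2[OF T(1)]) (auto simp: f_def)
  qed
  show thesis
  proof (rule that[OF T(1,2), of "\<lambda>t \<tau>. f t \<tau> / (\<Sum>t\<in>T. f t \<tau>)"])
    show "continuous_on \<Gamma> (\<lambda>\<tau>. f t \<tau> / (\<Sum>t\<in>T. f t \<tau>))" for t
      unfolding f_def using pos[unfolded f_def] by (intro continuous_intros) force
    show "0 \<le> f t \<tau> / (\<Sum>t\<in>T. f t \<tau>)" if "\<tau> \<in> \<Gamma>" for t \<tau>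
      using pos[OF that] by (simp add: f_def)
    show "(\<Sum>t\<in>T. f t \<tau> / (\<Sum>t\<in>T. f t \<tau>)) = 1" if "\<tau> \<in> \<Gamma>" for \<tau>
      using pos[OF that] by (simp add: sum_divide_distrib[symmetric])
    show "dist \<tau> t < d" if "f t \<tau> / (\<Sum>t\<in>T. f t \<tau>) \<noteq> 0" for t \<tau>
      using that by (auto simp: f_def max_def split: if_splits)
  qed
qed

text \<open>The partition does not depend on \<open>x\<close>: the integrals of the
  \<open>\<psi> t\<close> are harmonic in \<open>x\<close>, so \<open>H\<close> is approximated on
  all of \<open>\<Omega>\<close> at once by finite sums with harmonic coefficients.\<close>

lemma fine_partition:
  assumes e: "e > 0"
  shows "\<exists>T \<psi>. finite T \<and> T \<subseteq> \<Gamma> \<and> (\<forall>t\<in>T. continuous_on \<Gamma> (\<psi> t)) \<and> (\<forall>t\<in>T. \<forall>\<tau>\<in>\<Gamma>. (0::real) \<le> \<psi> t \<tau>) \<and>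
    (\<forall>\<tau>\<in>\<Gamma>. (\<Sum>t\<in>T. \<psi> t \<tau>) = 1) \<and>
    (\<forall>t\<in>T. \<forall>\<tau>\<in>\<Gamma>. \<psi> t \<tau> \<noteq> 0 \<longrightarrow> (\<forall>u. \<bar>h t u - h \<tau> u\<bar> \<le> e * norm u)) \<and>
    (\<forall>x\<in>\<Omega>. \<forall>u. \<bar>(\<Sum>t\<in>T. (\<integral>\<tau>. \<psi> t \<tau> \<partial>\<omega> x) * h t u) - H x u\<bar> \<le> e * norm u)"
proof -
  obtain d where d: "d > 0" "\<And>\<sigma> \<tau> u. \<sigma> \<in> \<Gamma> \<Longrightarrow> \<tau> \<in> \<Gamma> \<Longrightarrow> dist \<sigma> \<tau> < d \<Longrightarrow> \<bar>h \<sigma> u - h \<tau> u\<bar> \<le> e * norm u"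
    using h_uniform[OF e] by blast
  obtain T \<psi> where T: "finite T" "T \<subseteq> \<Gamma>" and \<psi>: "\<And>t. t \<in> T \<Longrightarrow> continuous_on \<Gamma> (\<psi> t)"
    "\<And>t \<tau>. t \<in> T \<Longrightarrow> \<tau> \<in> \<Gamma> \<Longrightarrow> (0::real) \<le> \<psi> t \<tau>" "\<And>\<tau>. \<tau> \<in> \<Gamma> \<Longrightarrow> (\<Sum>t\<in>T. \<psi> t \<tau>) = 1"
    "\<And>t \<tau>. t \<in> T \<Longrightarrow> \<tau> \<in> \<Gamma> \<Longrightarrow> \<psi> t \<tau> \<noteq> 0 \<Longrightarrow> dist \<tau> t < d"
    using partition_of_unity[OF d(1)] by metis
  have near: "\<bar>h t u - h \<tau> u\<bar> \<le> e * norm u" if "t \<in> T" "\<tau> \<in> \<Gamma>" "\<psi> t \<tau> \<noteq> 0" for t \<tau> u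
    using d(2)[of t \<tau> u] \<psi>(4)[OF that] that T(2) by (auto simp: dist_commute)
  show ?thesis
  proof (intro exI[of _ T] exI[of _ \<psi>] conjI ballI allI impI T \<psi>(1-3) near)
    show "\<bar>(\<Sum>t\<in>T. (\<integral>\<tau>. \<psi> t \<tau> \<partial>\<omega> x) * h t u) - H x u\<bar> \<le> e * norm u" if x: "x \<in> \<Omega>" for x u
      by (rule weighted_h_approx[OF x T(1) _ _ _ _ near])
        (use T(2) \<psi> in \<open>auto intro!: integrable_cont[OF x] continuous_intros h_continuous\<close>)
  qed
qed

end

section \<open>Competitors for the interpolation\<close>

definition join :: "real^'n \<Rightarrow> real^'m \<Rightarrow> real^('n::finite + 'm::finite)" where
  "join v w = (\<chi> k. case k of Inl i \<Rightarrow> v $ i | Inr j \<Rightarrow> w $ j)"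

lemma join_simps [simp]: "join v w $ Inl i = v $ i" "join v w $ Inr j = w $ j"
  "vec_left (join v w) = v" "vec_right (join v w) = w"
  by (simp_all add: join_def vec_left_def vec_right_def vec_eq_iff)

lemma sum_UNIV_Plus:
  "(\<Sum>k\<in>(UNIV::('n::finite + 'm::finite) set). f k) = (\<Sum>i\<in>UNIV. f (Inl i)) + (\<Sum>j\<in>UNIV. f (Inr j))"
  by (simp add: UNIV_Plus_UNIV[symmetric] sum.Plus del: UNIV_Plus_UNIV)

lemma inner_join: "join v w \<bullet> z = v \<bullet> vec_left z + w \<bullet> vec_right z"
  by (simp add: inner_vec_def sum_UNIV_Plus vec_left_def vec_right_def)

lemma linear_vec_left: "linear vec_left" and linear_vec_right: "linear vec_right"
  by (auto intro!: linearI simp: vec_left_def vec_right_def vec_eq_iff)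

lemma continuous_vec_left: "continuous_on S vec_left" and continuous_vec_right: "continuous_on S vec_right"
  using linear_vec_left linear_vec_right by (auto intro!: linear_continuous_on simp: linear_linear[symmetric])

lemma Sym2_nth: "A \<in> Sym2 \<Longrightarrow> A $ i $ j = A $ j $ i"
  unfolding Sym2_def transpose_def by (metis (mono_tags, lifting) mem_Collect_eq vec_lambda_beta)

lemma matrix_join:
  assumes A: "A \<in> Sym2"
  shows "vec_left (A *v join v w) = blockB A *v v + blockC A *v w"
    and "vec_right (A *v join v w) = transpose (blockC A) *v v + blockD A *v w"
proof -
  show "vec_left (A *v join v w) = blockB A *v v + blockC A *v w"
    by (simp add: vec_eq_iff matrix_vector_mult_def sum_UNIV_Plus vec_left_def blockB_def blockC_def)
  show "vec_right (A *v join v w) = transpose (blockC A) *v v + blockD A *v w"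
    using Sym2_nth[OF A, of "Inr _" "Inl _"]
    by (simp add: vec_eq_iff matrix_vector_mult_def sum_UNIV_Plus vec_right_def blockD_def blockC_def transpose_def
        del: transpose_matrix_vector)
qed

lemma inner_transpose': "v \<bullet> (transpose M *v w) = (M *v v) \<bullet> w" for M :: "real^'a^'b"
  by (metis dot_lmul_matrix inner_commute transpose_matrix_vector)

text \<open>The pullback is the quadratic form of \<open>A\<close> restricted to the graph of the
  linear map \<open>\<Gamma>\<close>.\<close>

lemma inner_pullback:
  assumes A: "A \<in> Sym2"
  shows "v \<bullet> (pullback \<Gamma> A *v v) = join v (\<Gamma> *v v) \<bullet> (A *v join v (\<Gamma> *v v))"
  by (simp add: pullback_def inner_join matrix_join[OF A] matrix_vector_mult_add_rdistrib
      matrix_vector_mul_assoc[symmetric] inner_add_right inner_transpose' del: transpose_matrix_vector)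

lemma trace_eq_sum_inner: "trace M = (\<Sum>i\<in>UNIV. axis i 1 \<bullet> (M *v axis i 1))" for M :: "real^'N^'N"
  by (simp add: trace_def inner_axis' matrix_vector_mult_basis column_def)

lemma transpose_add: "transpose (A + B) = transpose A + transpose B"
  by (simp add: transpose_def vec_eq_iff)

lemma pullback_Sym2:
  assumes A: "A \<in> Sym2" shows "pullback \<Gamma> A \<in> Sym2" "blockD A \<in> Sym2"
proof -
  have B: "transpose (blockB A) = blockB A"
    using Sym2_nth[OF A] by (simp add: blockB_def transpose_def vec_eq_iff)
  have D: "transpose (blockD A) = blockD A"
    using Sym2_nth[OF A] by (simp add: blockD_def transpose_def vec_eq_iff)
  show "blockD A \<in> Sym2" using D by (simp add: Sym2_def)
  show "pullback \<Gamma> A \<in> Sym2"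
    by (simp add: Sym2_def pullback_def transpose_add matrix_transpose_mul B D matrix_mul_assoc add_ac)
qed

text \<open>The trace of the pullback becomes a sum over graph vectors, into which the quadratic
  form of a jet can be substituted directly.\<close>

lemma star_P_F_subD:
  assumes "A \<in> star_P F_sub"
  shows "0 \<le> (\<Sum>i\<in>UNIV. join (axis i 1) (\<Gamma> *v axis i 1) \<bullet> (A *v join (axis i 1) (\<Gamma> *v axis i 1)))"
proof -
  have A: "A \<in> Sym2" and p: "0 \<le> trace (pullback \<Gamma> A)" using assms by (auto simp: star_P_def F_sub_def)
  show ?thesis using p by (simp add: trace_eq_sum_inner inner_pullback[OF A])
qed

lemma star_P_F_subI:
  assumes A: "A \<in> Sym2" and D: "\<And>w. 0 \<le> join 0 w \<bullet> (A *v join 0 w)"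
    and p: "\<And>\<Gamma>. 0 \<le> (\<Sum>i\<in>UNIV. join (axis i 1) (\<Gamma> *v axis i 1) \<bullet> (A *v join (axis i 1) (\<Gamma> *v axis i 1)))"
  shows "A \<in> star_P F_sub"
proof -
  have "0 \<le> w \<bullet> (blockD A *v w)" for w using D[of w] by (simp add: inner_join matrix_join[OF A])
  then have "blockD A \<in> PSD" using pullback_Sym2[OF A] by (simp add: PSD_def)
  moreover have "pullback \<Gamma> A \<in> F_sub" for \<Gamma>
    using p[of \<Gamma>] pullback_Sym2[OF A] by (simp add: F_sub_def trace_eq_sum_inner inner_pullback[OF A])
  ultimately show ?thesis using A by (simp add: star_P_def)
qed

section \<open>Upper semicontinuous functions\<close>

lemma USC_attains_sup:
  fixes f :: "'a::topological_space \<Rightarrow> ereal"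
  assumes N: "compact N" "N \<noteq> {}" and f: "f \<in> USC N"
  obtains z where "z \<in> N" "\<And>w. w \<in> N \<Longrightarrow> f w \<le> f z"
proof -
  define S where "S = (SUP z\<in>N. f z)"
  have "\<exists>z\<in>N. f z = S"
  proof (rule ccontr)
    assume "\<not> (\<exists>z\<in>N. f z = S)"
    then have lt: "f z < S" if "z \<in> N" for z
      using that SUP_upper[of z N f] unfolding S_def by (metis order_le_imp_less_or_eq)
    have "\<exists>c U. c < S \<and> open U \<and> z \<in> U \<and> (\<forall>w\<in>N \<inter> U. f w < c)" if z: "z \<in> N" for z
    proof -
      obtain c where c: "f z < c" "c < S" using dense[OF lt[OF z]] by blast
      have "\<forall>\<^sub>F w in at z within N. f w < c" using f z c by (auto simp: USC_def)
      then obtain U where U: "open U" "z \<in> U" "\<And>w. w \<in> U \<Longrightarrow> w \<noteq> z \<Longrightarrow> w \<in> N \<Longrightarrow> f w < c"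
        unfolding eventually_at_topological by blast
      show ?thesis by (intro exI[of _ c] exI[of _ U]) (use U c in blast)
    qed
    then obtain c U where cU: "\<And>z. z \<in> N \<Longrightarrow> c z < S" "\<And>z. z \<in> N \<Longrightarrow> open (U z)" "\<And>z. z \<in> N \<Longrightarrow> z \<in> U z"
      "\<And>z w. z \<in> N \<Longrightarrow> w \<in> N \<Longrightarrow> w \<in> U z \<Longrightarrow> f w < c z" by (metis IntI)
    have "N \<subseteq> (\<Union>z\<in>N. U z)" using cU(3) by blast
    then obtain T where T: "T \<subseteq> N" "finite T" "N \<subseteq> (\<Union>z\<in>T. U z)"
      using compactE_image[OF N(1), of N U] cU(2) by metis
    have T0: "T \<noteq> {}" using T(3) N(2) by auto
    have "S \<le> Max (c ` T)" unfolding S_def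
    proof (rule SUP_least)
      fix w assume w: "w \<in> N"
      then obtain z where z: "z \<in> T" "w \<in> U z" using T(3) by blast
      have "f w \<le> c z" using cU(4)[of z w] z w T(1) by auto
      also have "\<dots> \<le> Max (c ` T)" using z T(2) by auto
      finally show "f w \<le> Max (c ` T)" .
    qed
    moreover have "Max (c ` T) < S" using T T0 cU(1) by (subst Max_less_iff) auto
    ultimately show False by simp
  qed
  then obtain z where z: "z \<in> N" "f z = S" by blast
  show thesis by (rule that[OF z(1)]) (auto simp: z(2) S_def intro: SUP_upper)
qed

lemma USC_subset: "f \<in> USC Z \<Longrightarrow> N \<subseteq> Z \<Longrightarrow> f \<in> USC N"
  unfolding USC_def using filter_leD[OF at_le] by blast

lemma USC_add_continuous:
  assumes f: "f \<in> USC Z" and r: "continuous_on Z r"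
  shows "(\<lambda>z. f z + ereal (r z)) \<in> USC Z"
  unfolding USC_def
proof (intro CollectI ballI conjI allI impI)
  fix z assume z: "z \<in> Z"
  have fz: "f w \<noteq> \<infinity>" if "w \<in> Z" for w using f that by (auto simp: USC_def)
  show "f z + ereal (r z) \<noteq> \<infinity>" using fz[OF z] by auto
  fix c assume c: "f z + ereal (r z) < c"
  have inZ: "\<forall>\<^sub>F w in at z within Z. w \<in> Z" by (auto simp: eventually_at_filter)
  show "\<forall>\<^sub>F w in at z within Z. f w + ereal (r w) < c"
  proof (cases c)
    case PInf
    from inZ show ?thesis by eventually_elim (use fz in \<open>auto simp: PInf less_top[symmetric]\<close>)
  next
    case MInf
    then show ?thesis using c by simp
  next
    case (real c')
    then have "f z < ereal (c' - r z)" using c by (cases "f z") auto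
    then obtain e where e: "f z < ereal e" "ereal e < ereal (c' - r z)" using ereal_dense2 by blast
    have "\<forall>\<^sub>F w in at z within Z. f w < ereal e" using f z e(1) by (auto simp: USC_def)
    moreover have "(r \<longlongrightarrow> r z) (at z within Z)" using r z by (simp add: continuous_on)
    then have "\<forall>\<^sub>F w in at z within Z. r w < c' - e" using e(2) by (intro order_tendstoD(2)) auto
    ultimately show ?thesis
    proof eventually_elim
      case (elim w)
      then show ?case by (cases "f w") (auto simp: real)
    qed
  qed
qed

lemma USC_ereal_continuous: "continuous_on Z r \<Longrightarrow> (\<lambda>z. ereal (r z)) \<in> USC Z"
proof -
  assume r: "continuous_on Z r"
  have "(\<lambda>z. 0) \<in> USC Z" by (auto simp: USC_def)
  from USC_add_continuous[OF this r] show ?thesis by simp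
qed

lemma harmonic_jet:
  assumes "open U" "harmonic_on U f" "x \<in> U"
  shows "jet2 f x (frechet_derivative f (at x)) (\<lambda>h. h \<bullet> (Hess f x *v h))"
    and "(\<Sum>i\<in>UNIV. axis i 1 \<bullet> (Hess f x *v axis i 1)) = 0"
  using C2_jet[OF assms(1) _ assms(3)] assms by (auto simp: harmonic_on_def trace_eq_sum_inner[symmetric])

lemma harmonic_continuous:
  assumes "open U" "harmonic_on U f" shows "continuous_on U f"
proof -
  have "f differentiable (at x)" if "x \<in> U" for x
    using assms that by (simp add: harmonic_on_def numeral_2_eq_2)
  then show ?thesis by (meson continuous_at_imp_continuous_on differentiable_imp_continuous_within)
qed

context interp_setting
begin

section \<open>Harmonic extension up to the boundary\<close>

definition ext :: "(real^'n \<Rightarrow> real) \<Rightarrow> real^'n \<Rightarrow> real" where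
  "ext g x = (if x \<in> \<Omega> then (\<integral>\<tau>. g \<tau> \<partial>\<omega> x) else g x)"

lemma frontier_disjoint: "x \<in> \<Omega> \<Longrightarrow> x \<notin> \<Gamma>"
  using op by (auto simp: frontier_def interior_open)

lemma closure_eq: "closure \<Omega> = \<Omega> \<union> \<Gamma>"
  using closure_subset op by (auto simp: frontier_def interior_open)

text \<open>At a boundary point the approach splits in two: from inside \<open>\<Omega>\<close> the
  limit is part of the definition of harmonic measure, along the boundary it is continuity of
  \<open>g\<close>.\<close>

lemma ext_continuous:
  assumes g: "continuous_on \<Gamma> g" shows "continuous_on (closure \<Omega>) (ext g)"
  unfolding continuous_on
proof
  fix x assume "x \<in> closure \<Omega>"
  then consider "x \<in> \<Omega>" | "x \<in> \<Gamma>" by (auto simp: closure_eq)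
  then show "(ext g \<longlongrightarrow> ext g x) (at x within closure \<Omega>)"
  proof cases
    case 1
    have "isCont (\<lambda>x. \<integral>\<tau>. g \<tau> \<partial>\<omega> x) x"
      using harmonic_continuous[OF op harmonic_integral(1)[OF g]] 1 op continuous_on_eq_continuous_at by blast
    then have "((\<lambda>x. \<integral>\<tau>. g \<tau> \<partial>\<omega> x) \<longlongrightarrow> ext g x) (at x)" using 1 by (simp add: ext_def isCont_def)
    moreover have "\<forall>\<^sub>F y in at x. (\<integral>\<tau>. g \<tau> \<partial>\<omega> y) = ext g y"
      using eventually_at_in_open'[OF op 1] by eventually_elim (simp add: ext_def)
    ultimately have "(ext g \<longlongrightarrow> ext g x) (at x)" using tendsto_cong by force
    then show ?thesis by (rule tendsto_within_subset) simp
  next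
    case 2
    then have nx: "x \<notin> \<Omega>" using frontier_disjoint by blast
    have "(ext g \<longlongrightarrow> ext g x) (at x within \<Omega>)"
    proof (rule Lim_transform_eventually)
      show "((\<lambda>y. \<integral>\<tau>. g \<tau> \<partial>\<omega> y) \<longlongrightarrow> ext g x) (at x within \<Omega>)"
        using harmonic_integral(2)[OF g 2] nx by (simp add: ext_def)
    qed (auto simp: ext_def eventually_at_filter)
    moreover have "(ext g \<longlongrightarrow> ext g x) (at x within \<Gamma>)"
    proof -
      have "(g \<longlongrightarrow> g x) (at x within \<Gamma>)" using g 2 by (simp add: continuous_on)
      moreover have "\<forall>\<^sub>F y in at x within \<Gamma>. g y = ext g y"
        using frontier_disjoint by (auto simp: ext_def eventually_at_filter)
      ultimately have "(ext g \<longlongrightarrow> g x) (at x within \<Gamma>)" by (rule Lim_transform_eventually)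
      then show ?thesis using nx by (simp add: ext_def[of g x])
    qed
    ultimately show ?thesis unfolding closure_eq at_within_union[of x] Lim_within_Un by (simp add: filterlim_sup)
  qed
qed

lemma open_cylinder: "open {z :: real^('n + 'm). vec_left z \<in> \<Omega>}"
  using continuous_open_preimage[OF continuous_vec_left open_UNIV op] by (simp add: vimage_def)

lemma H_eq_ext: "x \<in> \<Omega> \<Longrightarrow> H x u = ext (\<lambda>\<tau>. h \<tau> u) x"
  by (simp add: ext_def H_def)

text \<open>On the boundary \<open>y \<bullet> u - h \<tau> u\<close> is at most the distance from
  \<open>y\<close> to \<open>A \<tau>\<close>, and \<open>t \<le> exp t - 1\<close> shows that
  \<open>k = 1\<close> already admits this function.\<close>

lemma linear_competitor:
  assumes u: "norm u = 1"
  shows "(\<lambda>(x, y). ereal (y \<bullet> u - ext (\<lambda>\<tau>. h \<tau> u) x)) \<in> interp_competitors F_sub \<Omega> A 1"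
proof -
  let ?e = "ext (\<lambda>\<tau>. h \<tau> u)"
  let ?\<phi> = "\<lambda>z :: real^('n + 'm). vec_right z \<bullet> u - ?e (vec_left z)"
  have ce: "continuous_on (closure \<Omega>) ?e" by (rule ext_continuous[OF h_continuous])
  have "continuous_on (closure \<Omega> \<times> UNIV) (\<lambda>p. snd p \<bullet> u - ?e (fst p))"
    by (intro continuous_intros continuous_on_compose2[OF ce]) auto
  from USC_ereal_continuous[OF this]
  have 1: "(\<lambda>(x, y). ereal (y \<bullet> u - ?e x)) \<in> USC (closure \<Omega> \<times> UNIV)" by (simp add: case_prod_unfold)
  have "continuous_on {z. vec_left z \<in> \<Omega>} ?\<phi>"
    by (intro continuous_intros continuous_on_compose2[OF ce] continuous_vec_left continuous_vec_right)
      (auto simp: closure_eq)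
  from USC_ereal_continuous[OF this]
  have 2: "(\<lambda>z. ereal (?\<phi> z)) \<in> USC {z. vec_left z \<in> \<Omega>}" .
  have 3: "Hess g z \<in> star_P F_sub"
    if z: "z \<in> {z. vec_left z \<in> \<Omega>}" and U: "open U" "z \<in> U" "U \<subseteq> {z. vec_left z \<in> \<Omega>}" "smooth_on U g"
      and le: "\<forall>w\<in>U. ereal (?\<phi> w) \<le> ereal (g w)" and eq: "ereal (?\<phi> z) = ereal (g z)" for z U g
  proof -
    let ?H = "\<lambda>x. H x u"
    have x: "vec_left z \<in> \<Omega>" using z by simp
    have har: "harmonic_on \<Omega> ?H" unfolding H_def by (rule harmonic_integral(1)[OF h_continuous])
    note jH = harmonic_jet[OF op har x]
    let ?Q = "\<lambda>k. k \<bullet> (Hess ?H (vec_left z) *v k)"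
    have lr: "linear (\<lambda>z :: real^('n + 'm). vec_right z \<bullet> u)"
      using linear_compose[OF linear_vec_right bounded_linear.linear[OF bounded_linear_inner_left]] by (simp add: o_def)
    obtain L where "jet2 (\<lambda>w. vec_right w \<bullet> u + - 1 * ?H (vec_left w)) z L (\<lambda>k. 0 + - 1 * ?Q (vec_left k))"
      using jet2_add[OF jet2_linear[OF lr] jet2_cmult[OF jet2_comp[OF jH(1) linear_vec_left]], of "- 1"] by blast
    note jphi = this
    have jg: "jet2 g z (frechet_derivative g (at z)) (\<lambda>k. k \<bullet> (Hess g z *v k))" "Hess g z \<in> Sym2"
      using jet2_smooth[OF U(1,4,2)] by auto
    obtain L' where j: "jet2 (\<lambda>w. g w + - 1 * (vec_right w \<bullet> u + - 1 * ?H (vec_left w))) z L'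
       (\<lambda>k. k \<bullet> (Hess g z *v k) + - 1 * (0 + - 1 * ?Q (vec_left k)))"
      using jet2_add[OF jg(1) jet2_cmult[OF jphi], of "- 1"] by blast
    have "\<forall>\<^sub>F w in nhds z. w \<in> U" using U by (intro eventually_nhds_in_open) auto
    then have ev: "\<forall>\<^sub>F w in nhds z. g z + - 1 * (vec_right z \<bullet> u + - 1 * ?H (vec_left z)) \<le>
       g w + - 1 * (vec_right w \<bullet> u + - 1 * ?H (vec_left w))"
    proof eventually_elim
      case (elim w)
      then have "vec_left w \<in> \<Omega>" using U(3) by blast
      moreover have "?\<phi> w \<le> g w" "?\<phi> z = g z" using le eq elim by auto
      ultimately show ?case using x by (simp add: H_eq_ext)
    qed
    \<comment> \<open>The Hessian of the test function dominates that of the competitor, which sees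
      only the left component. On vertical vectors the lower bound is 0; on graph vectors it is
      independent of the slope and sums to 0 by harmonicity.\<close>
    have ge: "- ?Q (vec_left k) \<le> k \<bullet> (Hess g z *v k)" for k
      using jet2_local_min[OF j ev, of k] by simp
    show ?thesis
    proof (rule star_P_F_subI[OF jg(2)])
      show "0 \<le> join 0 w \<bullet> (Hess g z *v join 0 w)" for w using ge[of "join 0 w"] by simp
      fix G :: "real^'n^'m"
      have "0 = (\<Sum>i\<in>UNIV. - ?Q (axis i 1))" using jH(2) by (simp add: sum_negf)
      also have "\<dots> \<le> (\<Sum>i\<in>UNIV. join (axis i 1) (G *v axis i 1) \<bullet> (Hess g z *v join (axis i 1) (G *v axis i 1)))"
      proof (rule sum_mono)
        fix i :: 'n
        show "- ?Q (axis i 1) \<le> join (axis i 1) (G *v axis i 1) \<bullet> (Hess g z *v join (axis i 1) (G *v axis i 1))"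
          using ge[of "join (axis i 1) (G *v axis i 1)"] by simp
      qed
      finally show "0 \<le> (\<Sum>i\<in>UNIV. join (axis i 1) (G *v axis i 1) \<bullet> (Hess g z *v join (axis i 1) (G *v axis i 1)))" .
    qed
  qed
  have 4: "ereal (y \<bullet> u - ?e \<tau>) \<le> ereal (exp (real 1 * infdist y (A \<tau>)) - 1)" if \<tau>: "\<tau> \<in> \<Gamma>" for \<tau> y
  proof -
    have AA: "compact (A \<tau>)" "A \<tau> \<noteq> {}" using A[OF \<tau>] by auto
    obtain a where a: "a \<in> A \<tau>" "infdist y (A \<tau>) = dist y a"
      using infdist_attains_inf[OF compact_imp_closed[OF AA(1)] AA(2)] by metis
    have "(y - a) \<bullet> u \<le> norm (y - a) * norm u" by (rule norm_cauchy_schwarz)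
    moreover have "a \<bullet> u \<le> h \<tau> u" unfolding h_def by (rule supp_upper[OF compact_imp_bounded[OF AA(1)] a(1)])
    ultimately have "y \<bullet> u - h \<tau> u \<le> infdist y (A \<tau>)"
      using u a(2) by (simp add: inner_diff_left dist_norm)
    also have "\<dots> \<le> exp (infdist y (A \<tau>)) - 1" using exp_ge_add_one_self[of "infdist y (A \<tau>)"] by linarith
    finally show ?thesis using \<tau> frontier_disjoint by (auto simp: ext_def)
  qed
  show ?thesis
    unfolding interp_competitors_def G_subharmonic_def using 1 2 3 4 by auto
qed

end

section \<open>The maximum principle along harmonic maps\<close>

context interp_setting
begin

definition harmonic_map :: "('m \<Rightarrow> real^'n \<Rightarrow> real) \<Rightarrow> real^'n \<Rightarrow> real^'m" where
  "harmonic_map g x = (\<chi> j. ext (g j) x)"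

lemma harmonic_map_continuous:
  "(\<And>j. continuous_on \<Gamma> (g j)) \<Longrightarrow> continuous_on (closure \<Omega>) (harmonic_map g)"
  unfolding harmonic_map_def by (intro continuous_on_vec_lambda ext_continuous)

text \<open>The graph of a harmonic map is tangent to a direction \<open>G\<close> along which the quadratic penalty
  \<open>K |y - f x|\<^sup>2\<close> has vanishing trace, so the term \<open>- d |x|\<^sup>2\<close> decides the sign.\<close>

lemma no_interior_touching:
  fixes z :: "real^('n + 'm)"
  assumes g: "\<And>j. continuous_on \<Gamma> (g j)"
    and sub: "G_subharmonic (star_P F_sub) {z. vec_left z \<in> \<Omega>} f" and z: "vec_left z \<in> \<Omega>" and d: "d > 0"
    and le: "\<forall>\<^sub>F w in nhds z. f w \<le> ereal (c - d * (norm (vec_left w))\<^sup>2 + K * (norm (vec_right w - harmonic_map g (vec_left w)))\<^sup>2)"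
    and eq: "f z = ereal (c - d * (norm (vec_left z))\<^sup>2 + K * (norm (vec_right z - harmonic_map g (vec_left z)))\<^sup>2)"
  shows False
proof -
  let ?x = "vec_left z"
  define F where "F j x = (\<integral>\<tau>. g j \<tau> \<partial>\<omega> x)" for j x
  define L where "L j = frechet_derivative (F j) (at ?x)" for j
  define Q where "Q j k = k \<bullet> (Hess (F j) ?x *v k)" for j k
  have jF: "jet2 (F j) ?x (L j) (Q j)" and trQ: "(\<Sum>i\<in>UNIV. Q j (axis i 1)) = 0" for j
    using harmonic_jet[OF op harmonic_integral(1)[OF g] z, of j] unfolding F_def L_def Q_def by auto
  define q where "q j w = w $ Inr j + - 1 * F j (vec_left w)" for j and w :: "real^('n + 'm)"
  have lin: "linear (\<lambda>w :: real^('n + 'm). w $ Inr j)" for j by (auto intro!: linearI)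
  have jq: "jet2 (q j) z (\<lambda>k. k $ Inr j + - 1 * L j (vec_left k)) (\<lambda>k. 0 + - 1 * Q j (vec_left k))" for j
    unfolding q_def by (rule jet2_add[OF jet2_linear[OF lin] jet2_cmult[OF jet2_comp[OF jF linear_vec_left]]])
  define \<phi> where "\<phi> w = c + (- d * (norm (vec_left w - 0))\<^sup>2 + K * (\<Sum>j\<in>UNIV. (q j w)\<^sup>2))" for w
  \<comment> \<open>Left in exactly the shape that the composed jet rules produce, so that they
    unify without rewriting.\<close>
  define P where "P k = 0 + (- d * (2 * (norm (vec_left k))\<^sup>2) +
     K * (\<Sum>j\<in>UNIV. 2 * q j z * (0 + - 1 * Q j (vec_left k)) + 2 * (k $ Inr j + - 1 * L j (vec_left k))\<^sup>2))" for k
  have "\<exists>M. jet2 \<phi> z M P"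
    unfolding \<phi>_def P_def
    by (rule exI, rule jet2_add[OF jet2_const jet2_add[OF
        jet2_cmult[OF jet2_comp[OF jet2_norm_square linear_vec_left]]
        jet2_cmult[OF jet2_sum[OF finite jet2_square[OF jq]]]]])
  then obtain M where j\<phi>: "jet2 \<phi> z M P" by blast
  have val: "\<phi> w = c - d * (norm (vec_left w))\<^sup>2 + K * (norm (vec_right w - harmonic_map g (vec_left w)))\<^sup>2"
    if "vec_left w \<in> \<Omega>" for w
    using that unfolding \<phi>_def q_def harmonic_map_def F_def
    by (simp add: ext_def vec_right_def power2_norm_eq_inner[of "_ - _"] inner_vec_def power2_eq_square[symmetric])
  have "\<forall>\<^sub>F w in nhds z. w \<in> {w. vec_left w \<in> \<Omega>}"
    using open_cylinder z by (intro eventually_nhds_in_open) auto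
  with le have le': "\<forall>\<^sub>F w in nhds z. f w \<le> ereal (\<phi> w)"
    by eventually_elim (simp add: val)
  have eq': "f z = ereal (\<phi> z)" using eq by (simp add: val[OF z])
  \<comment> \<open>The Jacobian of the map at the contact point: on its graph vectors the
    first-order parts of all \<open>q j\<close> vanish, and with them the squares in
    \<open>P\<close>. The remaining penalty terms contain only \<open>Q j\<close>, whose traces are
    0.\<close>
  define G :: "real^'n^'m" where "G = (\<chi> j i. L j (axis i 1))"
  have G: "(G *v axis i 1) $ j = L j (axis i 1)" for i j
    by (simp add: G_def matrix_vector_mult_basis column_def)
  define e where "e i = join (axis i 1) (G *v axis i 1)" for i
  define S where "S = (\<Sum>i\<in>UNIV. (norm (e i))\<^sup>2)"
  have S: "S \<ge> 0" unfolding S_def by (intro sum_nonneg) auto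
  \<comment> \<open>The widening of the paraboloid contributes \<open>\<eta> * S\<close> to the
    trace; it is kept below \<open>d\<close>, while the term in \<open>d\<close> contributes at
    least \<open>2 * d\<close> with the opposite sign.\<close>
  define \<eta> where "\<eta> = d / (S + 1)"
  have \<eta>: "\<eta> > 0" "\<eta> * S < d" using d S by (auto simp: \<eta>_def field_simps)
  obtain X where X: "X \<in> star_P F_sub" "\<And>k. k \<bullet> (X *v k) = P k + \<eta> * (norm k)\<^sup>2"
    using G_subharmonic_jet[OF sub open_cylinder _ j\<phi> le' eq' \<eta>(1)] z by blast
  have "0 \<le> (\<Sum>i\<in>UNIV. e i \<bullet> (X *v e i))" using star_P_F_subD[OF X(1), of G] by (simp add: e_def)
  also have "\<dots> = (\<Sum>i\<in>UNIV. P (e i)) + \<eta> * S"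
    by (simp add: X(2) sum.distrib S_def sum_distrib_left)
  also have "(\<Sum>i\<in>UNIV. P (e i)) = (\<Sum>i\<in>UNIV. - 2 * d - 2 * K * (\<Sum>j\<in>UNIV. q j z * Q j (axis i 1)))"
    unfolding P_def e_def by (rule sum.cong) (simp_all add: G sum_negf sum_distrib_left mult_ac)
  also have "\<dots> = - 2 * d * CARD('n) - 2 * K * (\<Sum>i\<in>(UNIV::'n set). \<Sum>j\<in>UNIV. q j z * Q j (axis i 1))"
    by (simp add: sum_subtractf sum_distrib_left)
  also have "(\<Sum>i\<in>(UNIV::'n set). \<Sum>j\<in>UNIV. q j z * Q j (axis i 1)) = (\<Sum>j\<in>UNIV. q j z * (\<Sum>i\<in>UNIV. Q j (axis i 1)))"
    by (subst sum.swap) (simp add: sum_distrib_left)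
  also have "\<dots> = 0" by (simp add: trQ)
  finally have "2 * d * CARD('n) \<le> \<eta> * S" by simp
  moreover have "2 * d * 1 \<le> 2 * d * real CARD('n)" using d by (intro mult_left_mono) (auto simp: Suc_le_eq)
  ultimately show False using \<eta>(2) d by linarith
qed

lemma compact_tube:
  assumes g: "\<And>j. continuous_on \<Gamma> (g j)"
  shows "compact {p. fst p \<in> closure \<Omega> \<and> norm (snd p - harmonic_map g (fst p)) \<le> 1}"
proof -
  have "{p. fst p \<in> closure \<Omega> \<and> norm (snd p - harmonic_map g (fst p)) \<le> 1} =
    (\<lambda>q. (fst q, harmonic_map g (fst q) + snd q)) ` (closure \<Omega> \<times> cball 0 1)" (is "?L = ?R")
  proof
    show "?L \<subseteq> ?R"
    proof
      fix p assume "p \<in> ?L"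
      then show "p \<in> ?R"
        by (intro image_eqI[of _ _ "(fst p, snd p - harmonic_map g (fst p))"]) (auto simp: mem_Times_iff)
    qed
  qed auto
  moreover have "compact ?R"
    by (intro compact_continuous_image compact_Times compact_cball continuous_intros
        continuous_on_compose2[OF harmonic_map_continuous[OF g]])
      (use bd in \<open>auto simp: compact_closure\<close>)
  ultimately show ?thesis by simp
qed

text \<open>The gap \<open>c - \<beta>\<close> between the supposed value and the boundary bound is
  spent in quarters: one on the strictly subharmonic term with \<open>d\<close>, one on leaving the
  graph by \<open>r\<close> at the boundary. What remains keeps the maximum off the boundary, where
  \<open>no_interior_touching\<close> excludes it.\<close>

lemma competitor_bound:
  assumes g: "\<And>j. continuous_on \<Gamma> (g j)" and s: "\<And>\<tau>. \<tau> \<in> \<Gamma> \<Longrightarrow> infdist (\<chi> j. g j \<tau>) (A \<tau>) \<le> s"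
    and \<zeta>: "\<zeta> \<in> interp_competitors F_sub \<Omega> A k" and x: "x \<in> \<Omega>"
  shows "\<zeta> (x, harmonic_map g x) \<le> ereal (exp (real k * s) - 1)"
proof (rule ccontr)
  let ?f = "harmonic_map g"
  define \<beta> where "\<beta> = exp (real k * s) - 1"
  assume "\<not> ?thesis"
  then have gt: "ereal \<beta> < \<zeta> (x, ?f x)" by (simp add: \<beta>_def)
  have usc: "\<zeta> \<in> USC (closure \<Omega> \<times> UNIV)"
    and sub: "G_subharmonic (star_P F_sub) {z. vec_left z \<in> \<Omega>} (\<lambda>z. \<zeta> (vec_left z, vec_right z))"
    and bdry: "\<And>\<tau> y. \<tau> \<in> \<Gamma> \<Longrightarrow> \<zeta> (\<tau>, y) \<le> ereal (exp (real k * infdist y (A \<tau>)) - 1)"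
    using \<zeta> by (auto simp: interp_competitors_def)
  have xc: "x \<in> closure \<Omega>" using x by (simp add: closure_eq)
  have "\<zeta> (x, ?f x) \<noteq> \<infinity>" using usc xc by (auto simp: USC_def)
  then obtain c where c: "\<zeta> (x, ?f x) = ereal c" using gt by (cases "\<zeta> (x, ?f x)") auto
  have cb: "\<beta> < c" using gt c by simp
  obtain R where R: "R > 0" "\<And>z. z \<in> closure \<Omega> \<Longrightarrow> (norm z)\<^sup>2 \<le> R"
  proof -
    obtain r where "r > 0" "\<And>z. z \<in> closure \<Omega> \<Longrightarrow> norm z \<le> r"
      using bounded_closure[OF bd] unfolding bounded_pos by blast
    then show thesis by (intro that[of "r\<^sup>2"]) (auto intro: power_mono)
  qed
  define d where "d = (c - \<beta>) / (4 * R)"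
  have d: "d > 0" using cb R by (simp add: d_def)
  have dR: "d * (norm z)\<^sup>2 \<le> (c - \<beta>) / 4" if "z \<in> closure \<Omega>" for z
  proof -
    have "d * (norm z)\<^sup>2 \<le> d * R" using R(2)[OF that] d by (intro mult_left_mono) auto
    then show ?thesis using R by (simp add: d_def)
  qed
  \<comment> \<open>No growth bound on \<open>\<zeta>\<close> in the second variable is given; on a
    compact tube around the graph semicontinuity provides the bound \<open>M\<close>.\<close>
  define N where "N = {p. fst p \<in> closure \<Omega> \<and> norm (snd p - ?f (fst p)) \<le> 1}"
  have N: "compact N" unfolding N_def by (rule compact_tube[OF g])
  have xN: "(x, ?f x) \<in> N" using xc by (simp add: N_def)
  have Nsub: "N \<subseteq> closure \<Omega> \<times> UNIV" by (auto simp: N_def)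
  obtain M where M: "\<And>p. p \<in> N \<Longrightarrow> \<zeta> p \<le> ereal M"
  proof -
    obtain p where p: "p \<in> N" "\<And>q. q \<in> N \<Longrightarrow> \<zeta> q \<le> \<zeta> p"
      using USC_attains_sup[OF N _ USC_subset[OF usc Nsub]] xN by blast
    have "\<zeta> p \<noteq> \<infinity>" using usc p(1) Nsub by (auto simp: USC_def)
    then obtain M where "\<zeta> p \<le> ereal M" by (cases "\<zeta> p") auto
    then show thesis using p(2) that by (meson order_trans)
  qed
  have "((\<lambda>t. exp (real k * (t + s)) - 1) \<longlongrightarrow> exp (real k * (0 + s)) - 1) (at_right 0)"
    by (intro tendsto_intros)
  then have "\<forall>\<^sub>F t in at_right 0. exp (real k * (t + s)) - 1 < \<beta> + (c - \<beta>) / 4"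
    by (rule order_tendstoD(2)) (use cb in \<open>simp add: \<beta>_def\<close>)
  then obtain b where b: "b > 0" "\<And>t. 0 < t \<Longrightarrow> t < b \<Longrightarrow> exp (real k * (t + s)) - 1 < \<beta> + (c - \<beta>) / 4"
    unfolding eventually_at_right_field by auto
  \<comment> \<open>Less than 1, so a maximum within \<open>r\<close> of the graph is interior to
    the tube; less than \<open>b\<close>, so the boundary bound grows by less than a quarter of the
    gap.\<close>
  define r where "r = min (b / 2) (1 / 2)"
  have r: "r > 0" "r < 1" "exp (real k * (r + s)) - 1 < \<beta> + (c - \<beta>) / 4"
    using b by (auto simp: r_def)
  \<comment> \<open>At distance at least \<open>r\<close> from the graph the penalty outweighs the
    bound \<open>M\<close> and leaves a value below \<open>c\<close>, so the maximum cannot occur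
    there.\<close>
  define K where "K = (\<bar>M\<bar> + \<bar>c\<bar> + (c - \<beta>)) / r\<^sup>2"
  have K: "K \<ge> 0" "K * r\<^sup>2 = \<bar>M\<bar> + \<bar>c\<bar> + (c - \<beta>)" using r cb by (auto simp: K_def)
  define \<rho> where "\<rho> p = d * (norm (fst p))\<^sup>2 - K * (norm (snd p - ?f (fst p)))\<^sup>2" for p
  have "continuous_on (closure \<Omega> \<times> UNIV) \<rho>"
    unfolding \<rho>_def
    by (intro continuous_intros continuous_on_compose2[OF harmonic_map_continuous[OF g]]) auto
  from USC_add_continuous[OF usc this]
  obtain p where p: "p \<in> N" "\<And>q. q \<in> N \<Longrightarrow> \<zeta> q + ereal (\<rho> q) \<le> \<zeta> p + ereal (\<rho> p)"
    using USC_attains_sup[OF N _ USC_subset[OF _ Nsub]] xN by blast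
  have "\<zeta> p \<noteq> \<infinity>" using usc p(1) Nsub by (auto simp: USC_def)
  moreover have "ereal c \<le> \<zeta> p + ereal (\<rho> p)"
  proof -
    have "ereal c \<le> \<zeta> (x, ?f x) + ereal (\<rho> (x, ?f x))" using d by (simp add: c \<rho>_def)
    then show ?thesis using p(2)[OF xN] by (rule order_trans)
  qed
  ultimately obtain v where v: "\<zeta> p = ereal v" "c \<le> v + \<rho> p" by (cases "\<zeta> p") auto
  obtain x0 y0 where pp: "p = (x0, y0)" by (cases p)
  have x0: "x0 \<in> closure \<Omega>" and y0: "norm (y0 - ?f x0) \<le> 1" using p(1) by (auto simp: N_def pp)
  have small: "norm (y0 - ?f x0) < r"
  proof (rule ccontr)
    assume "\<not> norm (y0 - ?f x0) < r"
    then have "K * r\<^sup>2 \<le> K * (norm (y0 - ?f x0))\<^sup>2" using r K by (intro mult_left_mono power_mono) auto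
    then have "\<rho> p \<le> (c - \<beta>) / 4 - (\<bar>M\<bar> + \<bar>c\<bar> + (c - \<beta>))" using dR[OF x0] K(2)
      unfolding \<rho>_def pp fst_conv snd_conv by linarith
    moreover have "v \<le> M" using M[OF p(1)] v(1) by simp
    ultimately show False using v(2) cb abs_ge_self[of M] abs_ge_minus_self[of c] by argo
  qed
  have "x0 \<notin> \<Gamma>"
  proof
    assume \<tau>: "x0 \<in> \<Gamma>"
    have "x0 \<notin> \<Omega>" using \<tau> frontier_disjoint by blast
    then have f0: "?f x0 = (\<chi> j. g j x0)" by (simp add: harmonic_map_def ext_def)
    have "infdist y0 (A x0) \<le> infdist (?f x0) (A x0) + dist y0 (?f x0)" by (rule infdist_triangle)
    then have "infdist y0 (A x0) \<le> r + s" using s[OF \<tau>] small by (simp add: f0 dist_norm)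
    then have "exp (real k * infdist y0 (A x0)) - 1 \<le> exp (real k * (r + s)) - 1"
      by (simp add: mult_left_mono)
    moreover have "v \<le> exp (real k * infdist y0 (A x0)) - 1" using bdry[OF \<tau>, of y0] v(1) by (simp add: pp)
    moreover have "\<rho> p \<le> (c - \<beta>) / 4" using dR[OF x0] mult_nonneg_nonneg[OF K(1) zero_le_power2]
      unfolding \<rho>_def pp fst_conv snd_conv by (smt (verit))
    ultimately show False using v(2) r(3) cb by argo
  qed
  then have x0\<Omega>: "x0 \<in> \<Omega>" using x0 by (simp add: closure_eq)
  define z where "z = join x0 y0"
  define c' where "c' = v + \<rho> p"
  let ?U = "{w. vec_left w \<in> \<Omega>} \<inter> {w :: real^('n + 'm). norm (vec_right w - ?f (vec_left w)) < 1}"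
  have "continuous_on {w. vec_left w \<in> \<Omega>} (\<lambda>w :: real^('n + 'm). norm (vec_right w - ?f (vec_left w)))"
    by (intro continuous_intros continuous_on_compose2[OF harmonic_map_continuous[OF g]] continuous_vec_left continuous_vec_right)
      (auto simp: closure_eq)
  from continuous_open_preimage[OF this open_cylinder open_lessThan, of 1]
  have "open ?U" by (simp add: vimage_def lessThan_def)
  then have ev: "\<forall>\<^sub>F w in nhds z. w \<in> ?U"
    using x0\<Omega> small r(2) by (intro eventually_nhds_in_open) (auto simp: z_def)
  have "\<forall>\<^sub>F w in nhds z. \<zeta> (vec_left w, vec_right w) \<le>
     ereal (c' - d * (norm (vec_left w))\<^sup>2 + K * (norm (vec_right w - ?f (vec_left w)))\<^sup>2)"
    using ev
  proof eventually_elim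
    case (elim w)
    then have "(vec_left w, vec_right w) \<in> N" by (auto simp: N_def closure_eq)
    from p(2)[OF this] show ?case
      by (cases "\<zeta> (vec_left w, vec_right w)") (auto simp: v(1) c'_def \<rho>_def)
  qed
  moreover have "\<zeta> (vec_left z, vec_right z) =
     ereal (c' - d * (norm (vec_left z))\<^sup>2 + K * (norm (vec_right z - ?f (vec_left z)))\<^sup>2)"
    using v(1) by (simp add: z_def c'_def \<rho>_def pp)
  ultimately show False
    using no_interior_touching[where g = g, OF g sub _ d, of z c' K] x0\<Omega> by (simp add: z_def)
qed

text \<open>\<open>y\<close> is within \<open>s\<close> of a combination of points
  \<open>a t\<close> of finitely many boundary sets, with the integrals of the
  \<open>\<psi> t\<close> as coefficients. Blending these points by the \<open>\<psi> t\<close>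
  gives a boundary map whose extension has that combination as its value at
  \<open>x\<close>.\<close>

lemma approximate_selection:
  assumes x: "x \<in> \<Omega>" and y: "y \<in> body (H x)" and s: "s > 0"
  obtains g where "\<And>j. continuous_on \<Gamma> (g j)" "\<And>\<tau>. \<tau> \<in> \<Gamma> \<Longrightarrow> infdist (\<chi> j. g j \<tau>) (A \<tau>) \<le> 2 * s"
    "harmonic_map g x = y"
proof -
  interpret prob_space "\<omega> x" by (rule prob[OF x])
  obtain T \<psi> where T: "finite T" "T \<subseteq> \<Gamma>" and \<psi>: "\<forall>t\<in>T. continuous_on \<Gamma> (\<psi> t)"
    "\<forall>t\<in>T. \<forall>\<tau>\<in>\<Gamma>. (0::real) \<le> \<psi> t \<tau>" "\<forall>\<tau>\<in>\<Gamma>. (\<Sum>t\<in>T. \<psi> t \<tau>) = 1"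
    and near: "\<forall>t\<in>T. \<forall>\<tau>\<in>\<Gamma>. \<psi> t \<tau> \<noteq> 0 \<longrightarrow> (\<forall>u. \<bar>h t u - h \<tau> u\<bar> \<le> s * norm u)"
    and approx: "\<forall>x\<in>\<Omega>. \<forall>u. \<bar>(\<Sum>t\<in>T. (\<integral>\<tau>. \<psi> t \<tau> \<partial>\<omega> x) * h t u) - H x u\<bar> \<le> s * norm u"
    using fine_partition[OF s] by (elim exE conjE) (rule that)
  note \<psi> = \<psi>[rule_format] and near = near[rule_format] and approx = approx[rule_format]
  define c where "c t = (\<integral>\<tau>. \<psi> t \<tau> \<partial>\<omega> x)" for t
  have c: "c t \<ge> 0" if "t \<in> T" for t
    unfolding c_def using \<psi>(2) that by (intro integral_nonneg_AE AE_I2) (auto simp: space_\<omega>[OF x])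
  let ?S = "\<lambda>t. (\<lambda>y. c t *\<^sub>R y) ` A t"
  have S: "compact (sum ?S T) \<and> convex (sum ?S T) \<and> sum ?S T \<noteq> {} \<and>
     (\<forall>u. support_fun (sum ?S T) u = (\<Sum>t\<in>T. support_fun (?S t) u))"
    by (rule minkowski_sum_props[OF T(1)]) (use A T(2) in \<open>auto intro: compact_scaling convex_scaling\<close>)
  have suppS: "support_fun (sum ?S T) u = (\<Sum>t\<in>T. c t * h t u)" for u
  proof -
    have "support_fun (?S t) u = c t * h t u" if "t \<in> T" for t
      using A T(2) that c by (auto simp: supp_scaleR h_def)
    then show ?thesis using S by simp
  qed
  have "infdist y (sum ?S T) \<le> s"
  proof (rule infdist_le_supp)
    fix u :: "real^'m" assume u: "norm u = 1"
    have "\<bar>(\<Sum>t\<in>T. (\<integral>\<tau>. \<psi> t \<tau> \<partial>\<omega> x) * h t u) - H x u\<bar> \<le> s"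
      using approx[OF x, of u] u by simp
    moreover have "y \<bullet> u \<le> H x u" using y by (simp add: body_def)
    ultimately show "y \<bullet> u \<le> support_fun (sum ?S T) u + s" unfolding suppS unfolding c_def by linarith
  qed (use S s in auto)
  moreover obtain y' where y': "y' \<in> sum ?S T" "infdist y (sum ?S T) = dist y y'"
    using infdist_attains_inf[OF compact_imp_closed[OF S[THEN conjunct1]] S[THEN conjunct2, THEN conjunct2, THEN conjunct1]]
    by blast
  ultimately have yy: "norm (y - y') \<le> s" by (simp add: dist_norm)
  have "\<exists>b. (\<forall>t\<in>T. b t \<in> ?S t) \<and> y' = sum b T" using y'(1) unfolding set_sum_alt[OF T(1)] by auto
  then obtain b where b: "\<And>t. t \<in> T \<Longrightarrow> b t \<in> ?S t" "y' = sum b T" by blast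
  then have "\<forall>t\<in>T. \<exists>a. a \<in> A t \<and> b t = c t *\<^sub>R a" by blast
  then obtain a where a: "\<And>t. t \<in> T \<Longrightarrow> a t \<in> A t" "\<And>t. t \<in> T \<Longrightarrow> b t = c t *\<^sub>R a t" by metis
  \<comment> \<open>The constant shift makes the value at \<open>x\<close> exactly \<open>y\<close>.
    It costs at most \<open>s\<close>, and the blended points cost another \<open>s\<close>, whence
    \<open>2 * s\<close>.\<close>
  define g where "g j \<tau> = (\<Sum>t\<in>T. \<psi> t \<tau> * a t $ j) + (y - y') $ j" for j \<tau>
  show thesis
  proof (rule that)
    show "continuous_on \<Gamma> (g j)" for j unfolding g_def using \<psi>(1) by (intro continuous_intros) auto
    show "infdist (\<chi> j. g j \<tau>) (A \<tau>) \<le> 2 * s" if \<tau>: "\<tau> \<in> \<Gamma>" for \<tau>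
    proof -
      define p where "p = (\<Sum>t\<in>T. \<psi> t \<tau> *\<^sub>R a t)"
      have gp: "(\<chi> j. g j \<tau>) = p + (y - y')" by (simp add: vec_eq_iff g_def p_def)
      have "infdist p (A \<tau>) \<le> s"
      proof (rule infdist_le_supp)
        fix u :: "real^'m" assume u: "norm u = 1"
        have "p \<bullet> u = (\<Sum>t\<in>T. \<psi> t \<tau> * (a t \<bullet> u))" by (simp add: p_def inner_sum_left)
        also have "\<dots> \<le> (\<Sum>t\<in>T. \<psi> t \<tau> * (h \<tau> u + s))"
        proof (rule sum_mono)
          fix t assume t: "t \<in> T"
          show "\<psi> t \<tau> * (a t \<bullet> u) \<le> \<psi> t \<tau> * (h \<tau> u + s)"
          proof (cases "\<psi> t \<tau> = 0")
            case False
            have "t \<in> \<Gamma>" using t T(2) by blast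
            have "a t \<bullet> u \<le> h t u" unfolding h_def
              using A[OF \<open>t \<in> \<Gamma>\<close>] by (intro supp_upper a(1)[OF t] compact_imp_bounded) auto
            also have "\<dots> \<le> h \<tau> u + s" using near[OF t \<tau> False, of u] u by (simp add: abs_le_iff)
            finally show ?thesis using \<psi>(2)[OF t \<tau>] by (rule mult_left_mono)
          qed simp
        qed
        also have "\<dots> = h \<tau> u + s" using \<psi>(3)[OF \<tau>] by (simp add: sum_distrib_right[symmetric])
        finally show "p \<bullet> u \<le> support_fun (A \<tau>) u + s" by (simp add: h_def)
      qed (use A[OF \<tau>] s in auto)
      moreover have "infdist (p + (y - y')) (A \<tau>) \<le> infdist p (A \<tau>) + dist (p + (y - y')) p" by (rule infdist_triangle)
      ultimately show ?thesis using yy by (simp add: gp dist_norm)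
    qed
    show "harmonic_map g x = y"
    proof -
      have "ext (g j) x = y $ j" for j
      proof -
        have "ext (g j) x = (\<integral>\<tau>. (\<Sum>t\<in>T. \<psi> t \<tau> * a t $ j) + (y - y') $ j \<partial>\<omega> x)" using x by (simp add: ext_def g_def[abs_def])
        also have "\<dots> = (\<Sum>t\<in>T. c t * a t $ j) + (y - y') $ j"
          using \<psi>(1) integrable_cont[OF x] by (simp add: c_def prob_space)
        also have "(\<Sum>t\<in>T. c t * a t $ j) = y' $ j" by (simp add: b(2) a(2))
        finally show ?thesis by simp
      qed
      then show ?thesis by (simp add: harmonic_map_def vec_eq_iff)
    qed
  qed
qed

theorem F_interpolation_eq_body:
  assumes x: "x \<in> \<Omega>" shows "F_interpolation F_sub \<Omega> A x = body (H x)"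
proof
  show "F_interpolation F_sub \<Omega> A x \<subseteq> body (H x)"
  proof (rule ccontr)
    assume "\<not> ?thesis"
    then obtain y where y: "interp_fun F_sub \<Omega> A (x, y) \<le> 0" "y \<notin> body (H x)" by (auto simp: F_interpolation_def)
    then obtain v where v: "H x v < y \<bullet> v" by (auto simp: body_def not_le)
    \<comment> \<open>Excludes \<open>v = 0\<close>, so the separating direction can be normalised
      as the linear competitor requires.\<close>
    have H0: "H x 0 = 0" using sublin_H[OF x] unfolding sublin_def by (metis mult_zero_left order_refl scale_zero_left)
    then have "v \<noteq> 0" using v by auto
    define u where "u = (1 / norm v) *\<^sub>R v"
    have u: "norm u = 1" using \<open>v \<noteq> 0\<close> by (simp add: u_def)
    have "H x u = (1 / norm v) * H x v" using sublin_H[OF x] unfolding sublin_def u_def by auto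
    then have lt: "H x u < y \<bullet> u" using v \<open>v \<noteq> 0\<close> by (simp add: u_def divide_strict_right_mono)
    have "ereal (y \<bullet> u - ext (\<lambda>\<tau>. h \<tau> u) x) \<le> interp_fun F_sub \<Omega> A (x, y)"
    proof -
      have "ereal (y \<bullet> u - ext (\<lambda>\<tau>. h \<tau> u) x) \<le> (SUP \<zeta>\<in>interp_competitors F_sub \<Omega> A 1. \<zeta> (x, y))"
        using SUP_upper[OF linear_competitor[OF u], of "\<lambda>\<zeta>. \<zeta> (x, y)"] by simp
      also have "\<dots> \<le> interp_fun F_sub \<Omega> A (x, y)"
        unfolding interp_fun_def by (rule SUP_upper) simp
      finally show ?thesis .
    qed
    with y(1) have "ereal (y \<bullet> u - ext (\<lambda>\<tau>. h \<tau> u) x) \<le> 0" by (rule order_trans[rotated])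
    then show False using lt x by (simp add: H_eq_ext)
  qed
  show "body (H x) \<subseteq> F_interpolation F_sub \<Omega> A x"
  proof
    fix y assume y: "y \<in> body (H x)"
    have "\<zeta> (x, y) \<le> 0" if \<zeta>: "\<zeta> \<in> interp_competitors F_sub \<Omega> A k" for \<zeta> k
    proof (rule ccontr)
      assume "\<not> ?thesis"
      then have "0 < \<zeta> (x, y)" by (simp add: not_le)
      then obtain c where c: "0 < ereal c" "ereal c < \<zeta> (x, y)" using ereal_dense2 by blast
      \<comment> \<open>\<open>k\<close> is fixed before the accuracy is chosen, so the supremum
        over all \<open>k\<close> still stays at most 0.\<close>
      have "((\<lambda>s. exp (real k * (2 * s)) - 1) \<longlongrightarrow> exp (real k * (2 * 0)) - 1) (at_right 0)"
        by (intro tendsto_intros)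
      then have "\<forall>\<^sub>F s in at_right 0. exp (real k * (2 * s)) - 1 < c"
        by (rule order_tendstoD(2)) (use c in simp)
      then obtain b where b: "b > 0" "\<And>s. 0 < s \<Longrightarrow> s < b \<Longrightarrow> exp (real k * (2 * s)) - 1 < c"
        unfolding eventually_at_right_field by auto
      have b2: "b / 2 > 0" using b by simp
      obtain g where g: "\<And>j. continuous_on \<Gamma> (g j)" "\<And>\<tau>. \<tau> \<in> \<Gamma> \<Longrightarrow> infdist (\<chi> j. g j \<tau>) (A \<tau>) \<le> 2 * (b / 2)"
        "harmonic_map g x = y"
        using approximate_selection[OF x y b2] by blast
      have "\<zeta> (x, y) \<le> ereal (exp (real k * (2 * (b / 2))) - 1)"
        using competitor_bound[OF g(1,2) \<zeta> x] g(3) by simp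
      also have "\<dots> < ereal c" using b(2)[of "b / 2"] b(1) by simp
      finally show False using c(2) by simp
    qed
    then show "y \<in> F_interpolation F_sub \<Omega> A x"
      by (auto simp: F_interpolation_def interp_fun_def SUP_le_iff)
  qed
qed

end

section \<open>Subharmonicity of the volume functional\<close>

text \<open>A ball of radius \<open>r\<close> in the body at \<open>x\<close> persists with radius
  \<open>r / 2\<close> in nearby bodies, so the volume comparison applies in both directions with
  one constant.\<close>

lemma continuous_on_ln_measure_body:
  fixes G :: "'x::topological_space \<Rightarrow> 'a::euclidean_space \<Rightarrow> real"
  assumes sl: "\<And>x. x \<in> S \<Longrightarrow> sublin (G x)" and pos: "\<And>x. x \<in> S \<Longrightarrow> 0 < vol (body (G x))"
    and near: "\<And>x e. x \<in> S \<Longrightarrow> e > 0 \<Longrightarrow> \<forall>\<^sub>F y in at x within S. \<forall>u. \<bar>G y u - G x u\<bar> \<le> e * norm u"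
  shows "continuous_on S (\<lambda>x. ln (vol (body (G x))))"
  unfolding continuous_on
proof (intro ballI tendstoI)
  fix x and e :: real assume x: "x \<in> S" and e: "e > 0"
  obtain p r where r: "r > 0" "\<And>u. p \<bullet> u + r * norm u \<le> G x u" using body_inner_ball[OF sl[OF x] pos[OF x]] by metis
  \<comment> \<open>The first bound preserves the half ball; the second makes the change of the
    logarithm at most \<open>e / 2\<close>.\<close>
  define s where "s = min (r / 2) (e * r / (4 * DIM('a)))"
  have s: "s > 0" "s \<le> r / 2" "s \<le> e * r / (4 * DIM('a))" using r(1) e by (auto simp: s_def)
  have "DIM('a) * s \<le> e * r / 4" using s(3) by (simp add: field_simps)
  then have "(DIM('a) * s) * (2 / r) \<le> (e * r / 4) * (2 / r)" using r(1) by (intro mult_right_mono) auto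
  moreover have "(e * r / 4) * (2 / r) = e / 2" using r(1) by simp
  moreover have "DIM('a) * (s / (r / 2)) = (DIM('a) * s) * (2 / r)" by simp
  ultimately have m1: "DIM('a) * (s / (r / 2)) < e" using e by linarith
  have "\<forall>\<^sub>F y in at x within S. y \<in> S" by (auto simp: eventually_at_filter)
  with near[OF x s(1)]
  show "\<forall>\<^sub>F y in at x within S. dist (ln (vol (body (G y)))) (ln (vol (body (G x)))) < e"
  proof eventually_elim
    case (elim y)
    have c: "G y u \<le> G x u + s * norm u" "G x u \<le> G y u + s * norm u" for u
      using elim(1)[rule_format, of u] by (auto simp: abs_le_iff)
    have "p \<bullet> u + r / 2 * norm u \<le> G y u" for u
    proof -
      have "s * norm u \<le> r / 2 * norm u" using s(2) by (intro mult_right_mono) auto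
      moreover have "r * norm u = r / 2 * norm u + r / 2 * norm u" by simp
      ultimately show ?thesis using c(2)[of u] r(2)[of u] by linarith
    qed
    then have 1: "ln (vol (body (G x))) \<le> ln (vol (body (G y))) + DIM('a) * (s / (r / 2))"
      using r(1) s(1) c(2) by (intro ln_measure_body_le[where p = p] sl pos x elim(2)) auto
    have "p \<bullet> u + r / 2 * norm u \<le> G x u" for u
    proof -
      have "r / 2 * norm u \<ge> 0" "r * norm u = r / 2 * norm u + r / 2 * norm u" using r(1) by simp_all
      then show ?thesis using r(2)[of u] by linarith
    qed
    then have 2: "ln (vol (body (G y))) \<le> ln (vol (body (G x))) + DIM('a) * (s / (r / 2))"
      using r(1) s(1) c(1) by (intro ln_measure_body_le[where p = p] sl pos x elim(2)) auto
    show ?case using 1 2 m1 by (simp add: dist_real_def abs_less_iff)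
  qed
qed

lemma finite_combination_near:
  fixes h :: "'t \<Rightarrow> 'a::euclidean_space \<Rightarrow> real"
  assumes T: "finite T" and c: "\<And>t. t \<in> T \<Longrightarrow> continuous_on S (c t)"
    and h: "\<And>t u. t \<in> T \<Longrightarrow> \<bar>h t u\<bar> \<le> C * norm u" and x: "x \<in> S" and e: "e > 0"
  shows "\<forall>\<^sub>F y in at x within S. \<forall>u. \<bar>(\<Sum>t\<in>T. c t y * h t u) - (\<Sum>t\<in>T. c t x * h t u)\<bar> \<le> e * norm u"
proof -
  have "((\<lambda>y. \<Sum>t\<in>T. \<bar>c t y - c t x\<bar> * C) \<longlongrightarrow> (\<Sum>t\<in>T. \<bar>c t x - c t x\<bar> * C)) (at x within S)"
    using c x by (intro tendsto_intros) (auto simp: continuous_on)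
  then have "\<forall>\<^sub>F y in at x within S. (\<Sum>t\<in>T. \<bar>c t y - c t x\<bar> * C) < e"
    by (rule order_tendstoD(2)) (use e in simp)
  then show ?thesis
  proof eventually_elim
    case (elim y)
    show ?case
    proof
      fix u
      have "\<bar>(\<Sum>t\<in>T. c t y * h t u) - (\<Sum>t\<in>T. c t x * h t u)\<bar> = \<bar>\<Sum>t\<in>T. (c t y - c t x) * h t u\<bar>"
        by (simp add: sum_subtractf left_diff_distrib)
      also have "\<dots> \<le> (\<Sum>t\<in>T. \<bar>c t y - c t x\<bar> * (C * norm u))"
        by (rule order_trans[OF sum_abs sum_mono]) (auto simp: abs_mult intro!: mult_left_mono h)
      also have "\<dots> = (\<Sum>t\<in>T. \<bar>c t y - c t x\<bar> * C) * norm u"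
        by (simp add: sum_distrib_right mult.assoc)
      also have "\<dots> \<le> e * norm u" using elim by (intro mult_right_mono) auto
      finally show "\<bar>(\<Sum>t\<in>T. c t y * h t u) - (\<Sum>t\<in>T. c t x * h t u)\<bar> \<le> e * norm u" .
    qed
  qed
qed

lemma Ck_on_subset: "Ck_on k S f \<Longrightarrow> T \<subseteq> S \<Longrightarrow> Ck_on k T f"
proof (induction k arbitrary: f)
  case 0
  then show ?case by (auto intro: continuous_on_subset)
next
  case (Suc k)
  have "Ck_on k T (\<lambda>x. frechet_derivative f (at x) v)" for v
    using Suc.prems by (intro Suc.IH) auto
  then show ?case using Suc.prems by (auto simp: subset_iff)
qed

lemma harmonic_on_subset: "harmonic_on S f \<Longrightarrow> T \<subseteq> S \<Longrightarrow> harmonic_on T f"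
  using Ck_on_subset unfolding harmonic_on_def by blast

lemma sum_UNIV_bool_prod: "(\<Sum>p\<in>(UNIV :: ('n::finite \<times> bool) set). f p) = (\<Sum>i\<in>UNIV. f (i, True) + f (i, False))"
proof -
  have "(\<Sum>p\<in>UNIV. f p) = (\<Sum>i\<in>UNIV. \<Sum>b\<in>UNIV. f (i, b))"
    by (simp add: sum.cartesian_product)
  then show ?thesis by (simp add: UNIV_bool add.commute)
qed

lemma jet2_laplacian_difference:
  fixes f :: "real^'n \<Rightarrow> real"
  assumes "jet2 f x L Q"
  shows "((\<lambda>t. (\<Sum>i\<in>UNIV. f (x + t *\<^sub>R axis i 1) + f (x - t *\<^sub>R axis i 1) - 2 * f x) / t\<^sup>2) \<longlongrightarrow> (\<Sum>i\<in>UNIV. Q (axis i 1))) (at 0)"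
  unfolding sum_divide_distrib by (intro tendsto_sum jet2_second_difference[OF assms])

text \<open>The weighted average of the bodies at the \<open>2n\<close> points \<open>x \<plusminus> t e\<^sub>i\<close> differs from the body at
  \<open>x\<close> by \<open>o(t\<^sup>2)\<close> since the coefficients are harmonic, and Brunn-Minkowski compares volumes.\<close>

lemma combination_touching:
  fixes c :: "'t \<Rightarrow> real^'n \<Rightarrow> real" and h :: "'t \<Rightarrow> 'a::euclidean_space \<Rightarrow> real" and x :: "real^'n" and T :: "'t set"
  defines "G \<equiv> \<lambda>y u. \<Sum>t\<in>T. c t y * h t u"
  assumes T: "finite T" and U: "open U" "x \<in> U"
    and c: "\<And>t. t \<in> T \<Longrightarrow> harmonic_on U (c t)" "\<And>t y. t \<in> T \<Longrightarrow> y \<in> U \<Longrightarrow> 0 \<le> c t y"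
    and h: "\<And>t. t \<in> T \<Longrightarrow> sublin (h t)" "\<And>t u. t \<in> T \<Longrightarrow> \<bar>h t u\<bar> \<le> C * norm u"
    and r: "r > 0" "\<And>y u. y \<in> U \<Longrightarrow> p \<bullet> u + r * norm u \<le> G y u"
    and j: "jet2 g x L Q"
    and touch: "\<And>y. y \<in> U \<Longrightarrow> - ln (vol (body (G y))) - g y \<le> - ln (vol (body (G x))) - g x"
  shows "0 \<le> (\<Sum>i\<in>UNIV. Q (axis i 1))"
proof -
  define v where "v y = ln (vol (body (G y)))" for y
  define n where "n = real CARD('n)"
  have n: "n > 0" by (simp add: n_def)
  \<comment> \<open>Equal weights on the \<open>2 * n\<close> points, which are indexed below by
    pairs of a coordinate and a sign.\<close>
  define w where "w = 1 / (2 * n)"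
  have w: "w > 0" using n by (simp add: w_def)
  define \<Delta> where "\<Delta> f t = (\<Sum>i\<in>UNIV. f (x + t *\<^sub>R axis i 1) + f (x - t *\<^sub>R axis i 1) - 2 * f x)"
    for f :: "real^'n \<Rightarrow> real" and t :: real
  have slG: "sublin (G y)" if "y \<in> U" for y
    unfolding G_def using that by (intro sublin_sum sublin_cmult h c)
  have pos: "0 < vol (body (G y))" if "y \<in> U" for y
    by (rule measure_body_pos[OF slG[OF that] r(1) r(2)[OF that]])
  \<comment> \<open>Bounds the increase of the support function under averaging, uniformly over unit
    directions.\<close>
  define s where "s t = (\<Sum>\<tau>\<in>T. \<bar>\<Delta> (c \<tau>) t\<bar> * \<bar>C\<bar>) / (2 * n)" for t
  have key: "- (DIM('a) / r) * s t \<le> \<Delta> g t / (2 * n)"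
    if tU: "\<And>i. x + t *\<^sub>R axis i 1 \<in> U" "\<And>i. x - t *\<^sub>R axis i 1 \<in> U" for t
  proof -
    define pt where "pt = (\<lambda>(i, b). if b then x + t *\<^sub>R axis i 1 else x - t *\<^sub>R axis i (1::real))"
    have ptU: "pt q \<in> U" for q using tU by (auto simp: pt_def split: prod.split)
    have avg: "(\<Sum>q\<in>UNIV. w * f (pt q)) = f x + \<Delta> f t / (2 * n)" for f :: "real^'n \<Rightarrow> real"
      using n unfolding sum_distrib_left[symmetric] sum_UNIV_bool_prod
      by (simp add: w_def \<Delta>_def pt_def sum_subtractf sum.distrib n_def[symmetric] field_simps)
    define Ga where "Ga = (\<lambda>u. \<Sum>q\<in>UNIV. w * G (pt q) u)"
    have BM: "(\<Sum>q\<in>UNIV. w * v (pt q)) \<le> ln (vol (body Ga))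
       \<and> 0 < vol (body Ga)"
      using brunn_minkowski_body_sum[of UNIV "\<lambda>q. G (pt q)" "\<lambda>q. w"] slG pos ptU w
      by (auto simp: v_def Ga_def w_def n_def)
    have eqG: "Ga u = (\<Sum>\<tau>\<in>T. (c \<tau> x + \<Delta> (c \<tau>) t / (2 * n)) * h \<tau> u)" for u
    proof -
      have "Ga u = (\<Sum>q\<in>UNIV. \<Sum>\<tau>\<in>T. (w * c \<tau> (pt q)) * h \<tau> u)"
        unfolding Ga_def G_def by (simp add: sum_distrib_left mult.assoc)
      also have "\<dots> = (\<Sum>\<tau>\<in>T. \<Sum>q\<in>UNIV. (w * c \<tau> (pt q)) * h \<tau> u)" by (rule sum.swap)
      also have "\<dots> = (\<Sum>\<tau>\<in>T. (\<Sum>q\<in>UNIV. w * c \<tau> (pt q)) * h \<tau> u)" by (simp add: sum_distrib_right)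
      finally show ?thesis by (simp only: avg)
    qed
    have le: "Ga u \<le> G x u + s t * norm u" for u
    proof -
      have "Ga u = (\<Sum>\<tau>\<in>T. (c \<tau> x + \<Delta> (c \<tau>) t / (2 * n)) * h \<tau> u)"
        by (rule eqG)
      also have "\<dots> = G x u + (\<Sum>\<tau>\<in>T. \<Delta> (c \<tau>) t * h \<tau> u) / (2 * n)"
        unfolding G_def by (simp add: distrib_right sum.distrib sum_divide_distrib)
      also have "(\<Sum>\<tau>\<in>T. \<Delta> (c \<tau>) t * h \<tau> u) \<le> (\<Sum>\<tau>\<in>T. \<bar>\<Delta> (c \<tau>) t\<bar> * (\<bar>C\<bar> * norm u))"
      proof (rule sum_mono)
        fix \<tau> assume "\<tau> \<in> T"
        have "\<Delta> (c \<tau>) t * h \<tau> u \<le> \<bar>\<Delta> (c \<tau>) t\<bar> * \<bar>h \<tau> u\<bar>" by (metis abs_ge_self abs_mult)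
        also have "\<bar>h \<tau> u\<bar> \<le> \<bar>C\<bar> * norm u"
          using h(2)[OF \<open>\<tau> \<in> T\<close>, of u] mult_right_mono[OF abs_ge_self, of "norm u" C] by simp
        finally show "\<Delta> (c \<tau>) t * h \<tau> u \<le> \<bar>\<Delta> (c \<tau>) t\<bar> * (\<bar>C\<bar> * norm u)" by (simp add: mult_left_mono)
      qed
      finally show ?thesis using n
        by (simp add: s_def divide_right_mono sum_distrib_right mult.assoc)
    qed
    have s0: "s t \<ge> 0" unfolding s_def using n by (intro divide_nonneg_nonneg sum_nonneg) auto
    have slA: "sublin Ga"
      unfolding Ga_def using w by (intro sublin_sum sublin_cmult slG ptU) auto
    have "ln (vol (body Ga)) \<le> v x + DIM('a) * (s t / r)"
      unfolding v_def using BM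
      by (intro ln_measure_body_le[OF slG[OF U(2)] slA pos[OF U(2)] _ r(1) r(2)[OF U(2)] s0 le]) auto
    then have 1: "(\<Sum>q\<in>UNIV. w * v (pt q)) \<le> v x + DIM('a) * (s t / r)" using BM by linarith
    \<comment> \<open>Touching means that \<open>v + g\<close> is smallest at \<open>x\<close>.
      Averaging this, against the Brunn-Minkowski upper bound for the average of \<open>v\<close>,
      bounds the second difference of \<open>g\<close> from below.\<close>
    have "(\<Sum>q\<in>(UNIV :: ('n \<times> bool) set). w * (v x + g x)) \<le> (\<Sum>q\<in>UNIV. w * (v (pt q) + g (pt q)))"
    proof (intro sum_mono mult_left_mono)
      fix q show "v x + g x \<le> v (pt q) + g (pt q)" using touch[OF ptU[of q]] by (simp add: v_def)
    qed (use w in auto)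
    also have "\<dots> = (\<Sum>q\<in>UNIV. w * v (pt q)) + (\<Sum>q\<in>UNIV. w * g (pt q))"
      by (simp only: distrib_left sum.distrib)
    finally have "v x + g x \<le> (\<Sum>q\<in>UNIV. w * v (pt q)) + (g x + \<Delta> g t / (2 * n))"
      using n unfolding avg by (simp add: w_def n_def)
    then show ?thesis using 1 by simp
  qed
  \<comment> \<open>Harmonicity of the coefficients enters here: the limit of the quotient is the
    trace of the Hessian.\<close>
  have "(\<lambda>t. \<Delta> (c \<tau>) t / t\<^sup>2) \<midarrow>0\<rightarrow> 0" if "\<tau> \<in> T" for \<tau>
    using jet2_laplacian_difference[OF harmonic_jet(1)[OF U(1) c(1)[OF that] U(2)]]
    unfolding harmonic_jet(2)[OF U(1) c(1)[OF that] U(2)] \<Delta>_def .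
  then have "(\<lambda>t. (\<Sum>\<tau>\<in>T. \<bar>\<Delta> (c \<tau>) t / t\<^sup>2\<bar> * \<bar>C\<bar>) / (2 * n)) \<midarrow>0\<rightarrow> (\<Sum>\<tau>\<in>T. \<bar>0\<bar> * \<bar>C\<bar>) / (2 * n)"
    using n by (intro tendsto_intros) auto
  then have st: "(\<lambda>t. s t / t\<^sup>2) \<midarrow>0\<rightarrow> 0"
    by (simp add: s_def sum_divide_distrib abs_divide divide_simps mult_ac)
  have lim1: "(\<lambda>t. - (DIM('a) / r) * (s t / t\<^sup>2)) \<midarrow>0\<rightarrow> - (DIM('a) / r) * 0"
    by (intro tendsto_intros st)
  have lim2: "(\<lambda>t. (\<Delta> g t / t\<^sup>2) / (2 * n)) \<midarrow>0\<rightarrow> (\<Sum>i\<in>UNIV. Q (axis i 1)) / (2 * n)"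
    using jet2_laplacian_difference[OF j] n unfolding \<Delta>_def by (intro tendsto_divide tendsto_const) auto
  have evU: "\<forall>\<^sub>F y in nhds x. y \<in> U" using U by (intro eventually_nhds_in_open)
  have "\<forall>\<^sub>F t in at 0. \<forall>i. x + t *\<^sub>R axis i 1 \<in> U" "\<forall>\<^sub>F t in at 0. \<forall>i. x - t *\<^sub>R axis i 1 \<in> U"
    using filterlim_iff[THEN iffD1, OF tendsto_add_scaleR_at_0(1), rule_format, OF evU]
      filterlim_iff[THEN iffD1, OF tendsto_add_scaleR_at_0(2), rule_format, OF evU]
    by (auto intro!: eventually_all_finite)
  then have "\<forall>\<^sub>F t in at 0. - (DIM('a) / r) * (s t / t\<^sup>2) \<le> (\<Delta> g t / t\<^sup>2) / (2 * n)"
  proof eventually_elim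
    case (elim t)
    have "(- (DIM('a) / r) * s t) / t\<^sup>2 \<le> (\<Delta> g t / (2 * n)) / t\<^sup>2"
      by (rule divide_right_mono[OF key]) (use elim in auto)
    then show ?case by (simp add: mult_ac)
  qed
  from tendsto_le[OF _ lim2 lim1 this] have "0 \<le> (\<Sum>i\<in>UNIV. Q (axis i 1)) / (2 * n)" by simp
  then show ?thesis using n by (simp add: zero_le_divide_iff)
qed

section \<open>Passage to the limit for the volume\<close>

context interp_setting
begin

text \<open>Nonnegative coefficients keep the finite sums sublinear, hence support functions of
  bodies to which Brunn-Minkowski applies.\<close>

lemma H_finite_approx:
  assumes e: "e > 0"
  shows "\<exists>T c. finite T \<and> T \<subseteq> \<Gamma> \<and> (\<forall>t\<in>T. harmonic_on \<Omega> (c t) \<and> (\<forall>x\<in>\<Omega>. 0 \<le> c t x)) \<and>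
    (\<forall>x\<in>\<Omega>. \<forall>u. \<bar>(\<Sum>t\<in>T. c t x * h t u) - H x u\<bar> \<le> e * norm u)"
proof -
  obtain T \<psi> where T: "finite T" "T \<subseteq> \<Gamma>" and \<psi>: "\<forall>t\<in>T. continuous_on \<Gamma> (\<psi> t)"
    "\<forall>t\<in>T. \<forall>\<tau>\<in>\<Gamma>. (0::real) \<le> \<psi> t \<tau>"
    and approx: "\<forall>x\<in>\<Omega>. \<forall>u. \<bar>(\<Sum>t\<in>T. (\<integral>\<tau>. \<psi> t \<tau> \<partial>\<omega> x) * h t u) - H x u\<bar> \<le> e * norm u"
    using fine_partition[OF e] by (elim exE conjE) (rule that)
  note \<psi> = \<psi>[rule_format] and approx = approx[rule_format]
  show ?thesis
  proof (intro exI[of _ T] exI[of _ "\<lambda>t x. \<integral>\<tau>. \<psi> t \<tau> \<partial>\<omega> x"] conjI ballI allI T)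
    show "harmonic_on \<Omega> (\<lambda>x. \<integral>\<tau>. \<psi> t \<tau> \<partial>\<omega> x)" if "t \<in> T" for t by (rule harmonic_integral(1)[OF \<psi>(1)[OF that]])
    show "0 \<le> (\<integral>\<tau>. \<psi> t \<tau> \<partial>\<omega> x)" if "t \<in> T" "x \<in> \<Omega>" for t x
      using \<psi>(2) that by (intro integral_nonneg_AE AE_I2) (auto simp: space_\<omega>)
  qed (rule approx)
qed

lemma H_near:
  assumes x: "x \<in> \<Omega>" and e: "e > 0"
  shows "\<forall>\<^sub>F y in at x within \<Omega>. \<forall>u. \<bar>H y u - H x u\<bar> \<le> e * norm u"
proof -
  have e3: "e / 3 > 0" using e by simp
  obtain T c where T: "finite T" "T \<subseteq> \<Gamma>" and c': "\<forall>t\<in>T. harmonic_on \<Omega> (c t) \<and> (\<forall>x\<in>\<Omega>. 0 \<le> c t x)"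
    and ap': "\<forall>x\<in>\<Omega>. \<forall>u. \<bar>(\<Sum>t\<in>T. c t x * h t u) - H x u\<bar> \<le> e / 3 * norm u"
    using H_finite_approx[OF e3] by (elim exE conjE) (rule that)
  have c: "harmonic_on \<Omega> (c t)" "x \<in> \<Omega> \<Longrightarrow> 0 \<le> c t x" if "t \<in> T" for t x
    using c' that by blast+
  have ap: "\<bar>(\<Sum>t\<in>T. c t x * h t u) - H x u\<bar> \<le> e / 3 * norm u" if "x \<in> \<Omega>" for x u
    using ap' that by blast
  obtain C where C: "\<And>\<tau> u. \<tau> \<in> \<Gamma> \<Longrightarrow> \<bar>h \<tau> u\<bar> \<le> C * norm u" using h_bound by metis
  have "\<forall>\<^sub>F y in at x within \<Omega>. \<forall>u. \<bar>(\<Sum>t\<in>T. c t y * h t u) - (\<Sum>t\<in>T. c t x * h t u)\<bar> \<le> e / 3 * norm u"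
    by (rule finite_combination_near[OF T(1) harmonic_continuous[OF op c(1)] C x]) (use T e in auto)
  moreover have "\<forall>\<^sub>F y in at x within \<Omega>. y \<in> \<Omega>" by (auto simp: eventually_at_filter)
  ultimately show ?thesis
  proof eventually_elim
    case (elim y)
    show ?case
    proof
      fix u :: "real^'m"
      have "e * norm u = e / 3 * norm u + e / 3 * norm u + e / 3 * norm u" by simp
      then show "\<bar>H y u - H x u\<bar> \<le> e * norm u"
        using elim(1)[rule_format, of u] ap[OF x, of u] ap[OF elim(2), of u] by linarith
    qed
  qed
qed

text \<open>Stability of touching under uniform limits. A small paraboloid added to \<open>g\<close>
  makes contact at \<open>x0\<close> strict on a sphere, so a close approximant is touched at some
  \<open>xs\<close> inside it; by continuity of the Hessian the trace there is still too negative
  for \<open>combination_touching\<close>.\<close>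

lemma Hess_trace_nonneg:
  assumes pos: "\<And>x. x \<in> \<Omega> \<Longrightarrow> 0 < vol (body (H x))"
    and U: "open U" "x0 \<in> U" "U \<subseteq> \<Omega>" and g: "smooth_on U g"
    and le: "\<And>x. x \<in> U \<Longrightarrow> - ln (vol (body (H x))) \<le> g x"
    and eq: "- ln (vol (body (H x0))) = g x0"
  shows "0 \<le> trace (Hess g x0)"
proof (rule ccontr)
  define n where "n = real CARD('n)"
  have n: "n > 0" by (simp add: n_def)
  define m where "m = real CARD('m)"
  define \<kappa> where "\<kappa> = - trace (Hess g x0)"
  assume "\<not> ?thesis"
  then have \<kappa>: "\<kappa> > 0" by (simp add: \<kappa>_def)
  have x0: "x0 \<in> \<Omega>" using U by blast
  note C2 = smooth_on_Ck[OF g, of 2]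
  have tr: "trace (Hess g y) = (\<Sum>i\<in>UNIV. D2 g y (axis i 1) (axis i 1))" if "y \<in> U" for y
    by (simp add: trace_eq_sum_inner D2_eq_Hess[OF U(1) C2 that])
  obtain d1 where d1: "d1 > 0" "ball x0 d1 \<subseteq> U"
    "\<And>y v w. y \<in> ball x0 d1 \<Longrightarrow> \<bar>D2 g y v w - D2 g x0 v w\<bar> \<le> \<kappa> / (4 * n) * norm v * norm w"
    using C2_Hess_uniform[OF U(1) C2 U(2), of "\<kappa> / (4 * n)"] \<kappa> n by auto
  have trb: "trace (Hess g y) \<le> - (3 / 4) * \<kappa>" if y: "y \<in> ball x0 d1" for y
  proof -
    have "trace (Hess g y) - trace (Hess g x0) = (\<Sum>i\<in>UNIV. D2 g y (axis i 1) (axis i 1) - D2 g x0 (axis i 1) (axis i 1))"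
      using tr d1(2) y U(2) by (auto simp: sum_subtractf)
    also have "\<dots> \<le> (\<Sum>i\<in>(UNIV::'n set). \<kappa> / (4 * n))"
    proof (rule sum_mono)
      fix i :: 'n
      have "\<bar>D2 g y (axis i 1) (axis i 1) - D2 g x0 (axis i 1) (axis i 1)\<bar> \<le> \<kappa> / (4 * n)"
        using d1(3)[OF y, of "axis i 1" "axis i 1"] by (simp add: norm_axis_1)
      then show "D2 g y (axis i 1) (axis i 1) - D2 g x0 (axis i 1) (axis i 1) \<le> \<kappa> / (4 * n)" by linarith
    qed
    also have "\<dots> = \<kappa> / 4" using n by (simp add: n_def)
    finally show ?thesis by (simp add: \<kappa>_def)
  qed
  \<comment> \<open>Three units of radius: one is lost in moving from \<open>x0\<close> to nearby
    points, one in replacing \<open>H\<close> by the finite sum, and one remains for the volume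
    estimates.\<close>
  obtain p r where r: "r > 0" "\<And>u. p \<bullet> u + 3 * r * norm u \<le> H x0 u"
  proof -
    obtain p r where "r > 0" "\<And>u. p \<bullet> u + r * norm u \<le> H x0 u" using body_inner_ball[OF sublin_H[OF x0] pos[OF x0]] by metis
    then show thesis by (intro that[of "r / 3" p]) auto
  qed
  have "\<forall>\<^sub>F y in at x0 within \<Omega>. \<forall>u. \<bar>H y u - H x0 u\<bar> \<le> r * norm u" by (rule H_near[OF x0 r(1)])
  then obtain d2 where d2: "d2 > 0" "\<And>y u. y \<in> \<Omega> \<Longrightarrow> y \<noteq> x0 \<Longrightarrow> dist y x0 < d2 \<Longrightarrow> \<bar>H y u - H x0 u\<bar> \<le> r * norm u"
    unfolding eventually_at by auto
  define \<rho> where "\<rho> = min d1 d2 / 2"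
  have \<rho>0: "\<rho> > 0" "cball x0 \<rho> \<subseteq> ball x0 d1" using d1(1) d2(1) by (auto simp: \<rho>_def)
  then have \<rho>: "\<rho> > 0" "cball x0 \<rho> \<subseteq> ball x0 d1" "cball x0 \<rho> \<subseteq> U" "cball x0 \<rho> \<subseteq> \<Omega>"
    using d1(2) U(3) by (auto simp only: intro: subset_trans)
  have inner: "p \<bullet> u + 2 * r * norm u \<le> H y u" if y: "y \<in> cball x0 \<rho>" for y u
  proof (cases "y = x0")
    case True
    have "2 * r * norm u \<le> 3 * r * norm u" using r(1) by (intro mult_right_mono) auto
    then show ?thesis using True r(2)[of u] by simp
  next
    case False
    have "y \<in> \<Omega>" "dist y x0 < d2" using y \<rho> d1(1) d2(1) by (auto simp: \<rho>_def dist_commute)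
    then have "\<bar>H y u - H x0 u\<bar> \<le> r * norm u" using d2(2) False by blast
    moreover have "3 * r * norm u = 2 * r * norm u + r * norm u" by (simp add: algebra_simps)
    ultimately show ?thesis using r(2)[of u] by linarith
  qed
  \<comment> \<open>The paraboloid adds \<open>2 * n * \<eta> = \<kappa> / 2\<close> to the trace,
    less than the \<open>3 / 4 * \<kappa>\<close> by which it is negative on the ball.\<close>
  define \<eta> where "\<eta> = \<kappa> / (4 * n)"
  have \<eta>: "\<eta> > 0" using \<kappa> n by (simp add: \<eta>_def)
  \<comment> \<open>Each replacement of \<open>H\<close> by the finite sum costs at most a quarter
    of the gain \<open>\<eta> * \<rho>\<^sup>2\<close> on the sphere; two replacements occur in the
    comparison with \<open>x0\<close>.\<close>
  define e where "e = min r (r * \<eta> * \<rho>\<^sup>2 / (4 * m))"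
  have m: "m > 0" by (simp add: m_def)
  have e: "e > 0" "e \<le> r" "e \<le> r * \<eta> * \<rho>\<^sup>2 / (4 * m)" using r(1) \<eta> \<rho>(1) m by (auto simp: e_def)
  have me: "m * (e / r) \<le> \<eta> * \<rho>\<^sup>2 / 4" using e(3) r(1) m by (simp add: field_simps)
  obtain T c where T: "finite T" "T \<subseteq> \<Gamma>" and c': "\<forall>t\<in>T. harmonic_on \<Omega> (c t) \<and> (\<forall>x\<in>\<Omega>. 0 \<le> c t x)"
    and ap': "\<forall>x\<in>\<Omega>. \<forall>u. \<bar>(\<Sum>t\<in>T. c t x * h t u) - H x u\<bar> \<le> e * norm u"
    using H_finite_approx[OF e(1)] by (elim exE conjE) (rule that)
  have c: "harmonic_on \<Omega> (c t)" "x \<in> \<Omega> \<Longrightarrow> 0 \<le> c t x" if "t \<in> T" for t x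
    using c' that by blast+
  have ap: "\<bar>(\<Sum>t\<in>T. c t x * h t u) - H x u\<bar> \<le> e * norm u" if "x \<in> \<Omega>" for x u
    using ap' that by blast
  obtain C where C: "\<And>\<tau> u. \<tau> \<in> \<Gamma> \<Longrightarrow> \<bar>h \<tau> u\<bar> \<le> C * norm u" using h_bound by metis
  define G where "G y u = (\<Sum>t\<in>T. c t y * h t u)" for y u
  let ?B = "cball x0 \<rho>"
  have slG: "sublin (G y)" if "y \<in> \<Omega>" for y
    unfolding G_def using that T(2) by (intro sublin_sum sublin_cmult sublin_h c) auto
  have GH: "G y u \<le> H y u + e * norm u" "H y u \<le> G y u + e * norm u" if "y \<in> \<Omega>" for y u
    using ap[OF that, of u] by (auto simp: G_def abs_le_iff)
  have innerG: "p \<bullet> u + r * norm u \<le> G y u" if y: "y \<in> ?B" for y u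
  proof -
    have "e * norm u \<le> r * norm u" using e(2) by (intro mult_right_mono) auto
    moreover have "2 * r * norm u = r * norm u + r * norm u" by simp
    moreover have "y \<in> \<Omega>" using y \<rho>(4) by blast
    ultimately show ?thesis using inner[OF y, of u] GH(2)[of y u] by linarith
  qed
  have innerH: "p \<bullet> u + r * norm u \<le> H y u" if y: "y \<in> ?B" for y u
  proof -
    have "r * norm u \<ge> 0" "2 * r * norm u = r * norm u + r * norm u" using r(1) by simp_all
    then show ?thesis using inner[OF y, of u] by linarith
  qed
  have posG: "0 < vol (body (G y))" if "y \<in> ?B" for y
    using that \<rho>(4) by (intro measure_body_pos[OF slG r(1) innerG]) auto
  define vG vH where "vG y = ln (vol (body (G y)))" and "vH y = ln (vol (body (H y)))" for y
  have vGH: "vG y \<le> vH y + m * (e / r)" "vH y \<le> vG y + m * (e / r)" if y: "y \<in> ?B" for y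
  proof -
    have y\<Omega>: "y \<in> \<Omega>" using y \<rho>(4) by blast
    show "vG y \<le> vH y + m * (e / r)" unfolding vG_def vH_def m_def
      using ln_measure_body_le[OF sublin_H[OF y\<Omega>] slG[OF y\<Omega>] pos[OF y\<Omega>] posG[OF y] r(1) innerH[OF y] _ GH(1)[OF y\<Omega>]] e(1) by simp
    show "vH y \<le> vG y + m * (e / r)" unfolding vG_def vH_def m_def
      using ln_measure_body_le[OF slG[OF y\<Omega>] sublin_H[OF y\<Omega>] posG[OF y] pos[OF y\<Omega>] r(1) innerG[OF y] _ GH(2)[OF y\<Omega>]] e(1) by simp
  qed
  define gt where "gt y = g y + \<eta> * (norm (y - x0))\<^sup>2" for y
  have "continuous_on ?B vG"
    unfolding vG_def
  proof (rule continuous_on_ln_measure_body)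
    show "sublin (G y)" if "y \<in> ?B" for y using that \<rho>(4) slG by blast
    show "\<forall>\<^sub>F z in at y within ?B. \<forall>u. \<bar>G z u - G y u\<bar> \<le> e * norm u" if "y \<in> ?B" "e > 0" for y e
      unfolding G_def
      by (rule finite_combination_near[OF T(1) _ C])
        (use that T(2) continuous_on_subset[OF harmonic_continuous[OF op c(1)] \<rho>(4)] in auto)
  qed (rule posG)
  moreover have "continuous_on ?B g"
    using C2 U(1) \<rho>(3) Ck_on_Suc_imp[of 0 U g] Ck_on_Suc_imp[of "Suc 0" U g]
    by (auto simp: numeral_2_eq_2 intro: continuous_on_subset)
  ultimately have "continuous_on ?B (\<lambda>y. - vG y - gt y)" unfolding gt_def by (intro continuous_intros)
  then have "\<exists>xs\<in>?B. \<forall>y\<in>?B. - vG y - gt y \<le> - vG xs - gt xs"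
    using \<rho>(1) by (intro continuous_attains_sup) auto
  then obtain xs where xs: "xs \<in> ?B" "\<And>y. y \<in> ?B \<Longrightarrow> - vG y - gt y \<le> - vG xs - gt xs"
    by blast
  have "norm (xs - x0) < \<rho>"
  proof (rule ccontr)
    assume "\<not> norm (xs - x0) < \<rho>"
    then have "norm (xs - x0) = \<rho>" using xs(1) by (simp add: dist_norm norm_minus_commute)
    then have "gt xs = g xs + \<eta> * \<rho>\<^sup>2" by (simp add: gt_def)
    moreover have "- vG x0 - gt x0 \<le> - vG xs - gt xs" using \<rho>(1) by (intro xs(2)) auto
    moreover have "gt x0 = g x0" by (simp add: gt_def)
    moreover have "- vH xs \<le> g xs" using le xs(1) \<rho>(3) by (auto simp: vH_def)
    moreover have "- vH x0 = g x0" using eq by (simp add: vH_def)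
    moreover have "vH xs \<le> vG xs + m * (e / r)" "vG x0 \<le> vH x0 + m * (e / r)" using vGH xs(1) \<rho>(1) by auto
    moreover have "\<eta> * \<rho>\<^sup>2 > 0" using \<eta> \<rho>(1) by simp
    ultimately show False using me by argo
  qed
  then have xsb: "xs \<in> ball x0 \<rho>" by (simp add: dist_norm norm_minus_commute)
  have xsU: "xs \<in> U" using xs(1) \<rho>(3) by blast
  let ?Q = "\<lambda>k. k \<bullet> (Hess g xs *v k) + \<eta> * (2 * (norm k)\<^sup>2)"
  obtain L where "jet2 gt xs L ?Q"
    unfolding gt_def using jet2_add[OF jet2_smooth(1)[OF U(1) g xsU] jet2_cmult[OF jet2_norm_square]] by blast
  note j = this
  have "0 \<le> (\<Sum>i\<in>UNIV. ?Q (axis i 1))"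
  proof (rule combination_touching[OF T(1) open_ball xsb _ _ _ _ r(1) _ j])
    show "harmonic_on (ball x0 \<rho>) (c t)" if "t \<in> T" for t
      using harmonic_on_subset[OF c(1)[OF that]] \<rho>(4) ball_subset_cball[of x0 \<rho>] by blast
    show "p \<bullet> u + r * norm u \<le> (\<Sum>t\<in>T. c t y * h t u)" if "y \<in> ball x0 \<rho>" for y u
      using innerG[of y u] that by (auto simp: G_def)
    show "- ln (vol (body (\<lambda>u. \<Sum>t\<in>T. c t y * h t u))) - gt y
       \<le> - ln (vol (body (\<lambda>u. \<Sum>t\<in>T. c t xs * h t u))) - gt xs" if "y \<in> ball x0 \<rho>" for y
      using xs(2)[of y] that by (auto simp: vG_def G_def[abs_def])
    show "0 \<le> c t y" if "t \<in> T" "y \<in> ball x0 \<rho>" for t y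
      using c(2) that \<rho>(4) ball_subset_cball by blast
    show "\<bar>h t u\<bar> \<le> C * norm u" if "t \<in> T" for t u using C that T(2) by blast
  qed (use T(2) sublin_h in auto)
  also have "\<dots> = trace (Hess g xs) + n * (2 * \<eta>)"
    by (simp add: sum.distrib trace_eq_sum_inner norm_axis_1 n_def)
  also have "\<dots> \<le> - (3 / 4) * \<kappa> + \<kappa> / 2" using trb[of xs] xs(1) \<rho>(2) n by (auto simp: \<eta>_def)
  finally show False using \<kappa> by simp
qed

theorem neg_ln_volume_subharmonic:
  assumes pos: "\<And>x. x \<in> \<Omega> \<Longrightarrow> 0 < vol (body (H x))"
  shows "G_subharmonic F_sub \<Omega> (\<lambda>x. ereal (- ln (vol (body (H x)))))"
  unfolding G_subharmonic_def
proof (intro conjI ballI allI impI)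
  have "continuous_on \<Omega> (\<lambda>x. ln (vol (body (H x))))"
    by (rule continuous_on_ln_measure_body) (auto intro: sublin_H pos H_near)
  then show "(\<lambda>x. ereal (- ln (vol (body (H x))))) \<in> USC \<Omega>"
    by (intro USC_ereal_continuous continuous_on_minus)
  fix x U g
  assume x: "x \<in> \<Omega>" and *: "open U \<and> x \<in> U \<and> U \<subseteq> \<Omega> \<and> smooth_on U g \<and>
    (\<forall>z\<in>U. ereal (- ln (vol (body (H z)))) \<le> ereal (g z)) \<and>
    ereal (- ln (vol (body (H x)))) = ereal (g x)"
  then have "0 \<le> trace (Hess g x)" by (intro Hess_trace_nonneg[OF pos, of U]) auto
  then show "Hess g x \<in> F_sub" using jet2_smooth(2)[of U g x] * by (simp add: F_sub_def)
qed

end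

text \<open>The bodies are identified with the harmonic interpolation on \<open>\<Omega>\<close>
  only, so transfer must ignore values outside \<open>Y\<close>; filters within \<open>Y\<close> and
  test neighbourhoods inside \<open>Y\<close> do so.\<close>

lemma G_subharmonic_cong:
  assumes eq: "\<And>x. x \<in> Y \<Longrightarrow> f x = f' x" and f: "G_subharmonic G Y f"
  shows "G_subharmonic G Y f'"
  unfolding G_subharmonic_def
proof (intro conjI ballI allI impI)
  have "(\<forall>\<^sub>F w in at z within Y. f w < c) \<longleftrightarrow> (\<forall>\<^sub>F w in at z within Y. f' w < c)" for z c
    by (intro eventually_cong) (auto simp: eventually_at_filter eq)
  then show "f' \<in> USC Y" using f eq by (auto simp: USC_def G_subharmonic_def)
  fix x U g
  assume x: "x \<in> Y" and *: "open U \<and> x \<in> U \<and> U \<subseteq> Y \<and> smooth_on U g \<and>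
    (\<forall>z\<in>U. f' z \<le> ereal (g z)) \<and> f' x = ereal (g x)"
  then have "\<forall>z\<in>U. f z \<le> ereal (g z)" "f x = ereal (g x)" using eq by (metis subsetD)+
  then show "Hess g x \<in> G" using f x * unfolding G_subharmonic_def by metis
qed

theorem proposition10p8:
  fixes \<Omega> :: "(real^'n) set"
    and A :: "real^'n \<Rightarrow> (real^'m) set"
    and \<omega> :: "real^'n \<Rightarrow> (real^'n) measure"
  assumes "open \<Omega>" and "bounded \<Omega>" and "smooth_boundary \<Omega>"
    and "\<And>\<tau>. \<tau> \<in> frontier \<Omega> \<Longrightarrow> A \<tau> \<noteq> {} \<and> compact (A \<tau>) \<and> convex (A \<tau>)"
    and "\<And>\<tau>. \<tau> \<in> frontier \<Omega> \<Longrightarrow>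
           ((\<lambda>\<sigma>. hausdorff_dist (A \<sigma>) (A \<tau>)) \<longlongrightarrow> 0) (at \<tau> within frontier \<Omega>)"
    and "harmonic_measure \<Omega> \<omega>"
  shows "(\<forall>x\<in>\<Omega>. F_interpolation F_sub \<Omega> A x = harmonic_interpolation \<omega> A x) \<and>
         ((\<forall>x\<in>\<Omega>. measure lebesgue (harmonic_interpolation \<omega> A x) > 0) \<longrightarrow>
            G_subharmonic F_sub \<Omega>
              (\<lambda>x. ereal (- ln (measure lebesgue (harmonic_interpolation \<omega> A x)))))"
proof -
  interpret interp_setting \<Omega> A \<omega>
    by (unfold_locales) (use assms in auto)
  show ?thesis
    using F_interpolation_eq_body harmonic_interpolation_eq_body neg_ln_volume_subharmonic
      G_subharmonic_cong[of \<Omega> "\<lambda>x. ereal (- ln (measure lebesgue (body (H x))))"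
        "\<lambda>x. ereal (- ln (measure lebesgue (harmonic_interpolation \<omega> A x)))" F_sub]
    by auto
qed

end
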